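(* Assume $\mathbf U_h^{(0)}=\mathbf U_h^n\in\mathbb G_h^k$. Then the solutions $\mathbf U_h^{(i)}$, $1\le i\le N_r$, computed by the fully discrete scheme $$\mathbf U_h^{(i)}=\mathbf\Pi_h\Big\{\sum_{\ell=0}^{i-1}\alpha_{i\ell}\big(\mathbf U_h^{(\ell)}+\beta_{i\ell}\Delta t_n\mathbf L_h(\mathbf U_h^{(\ell)})\big)\Big\}$$ belong to $\mathbb G_h^k$, under the CFL condition that for all $1\le i\le N_r$, $0\le\ell\le i-1$, $1\le q\le Q$, all $\mathscr E\in\partial K$ and all $K\in\mathcal T_h$, $$\Delta t_n\,\beta_{i\ell}\,\omega_q\big(a+\sigma_{K,\mathscr E,q}(\mathbf U_h^{(\ell)})\big)|\mathscr E|<\varpi_{\mathscr E}^{(q)}|K|,\qquad a=1.$$ (The conditions are imposed successively in $\ell$, as the stages $\mathbf U_h^{(\ell)}$ are computed.)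
   Context: **RMHD quantities.** The equation of state is a function $H=H(p,\rho)$, differentiable on $(0,\infty)^2$, satisfying for all $p,\rho>0$: $H(p,\rho)\ge\sqrt{1+p^2/\rho^2}+p/\rho$ and $H(p,\rho)\big(\frac1\rho-\frac{\partial H}{\partial p}\big)<\frac{\partial H}{\partial\rho}<0$. For $\rho,p>0$, $\mathbf v,\mathbf B\in\mathbb R^3$, $|\mathbf v|<1$, put $W=(1-|\mathbf v|^2)^{-1/2}$, $H=H(p,\rho)$, $e=H-1-p/\rho$, $p_{tot}=p+\frac12(W^{-2}|\mathbf B|^2+(\mathbf v\cdot\mathbf B)^2)$, $D=\rho W$, $\mathbf m=(\rho HW^2+|\mathbf B|^2)\mathbf v-(\mathbf v\cdot\mathbf B)\mathbf B$, $E=\rho HW^2-p_{tot}+|\mathbf B|^2$. The admissible set $\mathcal G\subset\mathbb R^8$ is the set of $\mathbf U=(D,\mathbf m,\mathbf B,E)^\top$ arising from such primitive variables with $\rho>0$, $p>0$, $e>0$, $|\mathbf v|<1$; each $\mathbf U\in\mathcal G$ determines its primitive variables uniquely, so $\rho,p,\mathbf v,H$ are functions of $\mathbf U\in\mathcal G$. For $\mathbf U\in\mathcal G$, $\mathbf F_i(\mathbf U)=\big(Dv_i,\ v_i\mathbf m-B_i(W^{-2}\mathbf B+(\mathbf v\cdot\mathbf B)\mathbf v)+p_{tot}\mathbf e_i,\ v_i\mathbf B-B_i\mathbf v,\ m_i\big)^\top$ ($\mathbf e_i$ the $i$-th row of the $3\times 3$ identity), and $\mathbf S(\mathbf U)=\big(0,(1-|\mathbf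 v|^2)\mathbf B+(\mathbf v\cdot\mathbf B)\mathbf v,\mathbf v,\mathbf v\cdot\mathbf B\big)^\top$. Here $d=2$; for $\mathbf n\in\mathbb R^d$, $\langle\mathbf n,\mathbf B\rangle=\sum_{j=1}^dn_jB_j$ and $\langle\mathbf n,\mathbf F\rangle=\sum_{j=1}^dn_j\mathbf F_j$. **Mesh and spaces.** A bounded 2D domain is partitioned into a mesh $\mathcal T_h$ of finitely many polygonal cells $K$ of area $|K|$; $\mathscr E\in\partial K$ denotes an edge of $K$, of length $|\mathscr E|$, with outward unit normal $\mathbf n_{\mathscr E,K}$. Every edge of $K$ is shared with exactly one adjacent cell (e.g. periodic boundary conditions); superscripts $\mathrm{int}(K)$ and $\mathrm{ext}(K)$ denote the traces on $\mathscr E$ from inside $K$ and from the adjacent cell. For an integer $k\ge0$, $\mathbb W_h^k$ is the space of $\mathbf u=(u_1,\dots,u_8)^\top$ with each $u_\ell|_K$ a polynomial of total degree $\le k$ and $\sum_{i=1}^d\partial u_{4+i}/\partial x_i=0$ in each $K\in\mathcal T_h$ (components $5,6,7$ are the magnetic field). $\overline{\mathbb G}_h^k=\{\mathbf u\in\mathbb W_h^k:\frac1{|K|}\int_K\mathbf u\,d\mathbf x\in\mathcal G\ \forall K\in\mathcal T_h\}$ and $\mathbb G_h^k=\{\mathbf u\in\overline{\mathbb G}_h^k:\mathbf u|_K(\mathbf x)\in\mathcal G\ \forall\mathbf x\in\mathbb S_K,\ \forall K\in\mathcal T_h\}$, with $\mathbb S_K$ given next. **Quadratures.** On each edge $\mathscr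 E$: the Gauss quadrature with $Q=k+1$ points $\mathbf x_{\mathscr E}^{(q)}$ and positive weights $\omega_q$, $\sum_q\omega_q=1$. On each cell $K$: a quadrature with points $\breve{\mathbf x}_K^{(q)}$ and weights $\breve\omega_q$, $1\le q\le\breve Q$, of algebraic degree at least $2k$; $\breve{\mathbb S}_K=\{\breve{\mathbf x}_K^{(q)}\}$. It is assumed that each $K$ admits a special quadrature with positive weights, summing to $1$: $$\frac1{|K|}\int_Ku\,d\mathbf x=\sum_{\mathscr E\in\partial K}\sum_{q=1}^Q\varpi_{\mathscr E}^{(q)}u(\mathbf x_{\mathscr E}^{(q)})+\sum_{q=1}^{\widetilde Q}\widetilde\varpi_q\,u(\widetilde{\mathbf x}_K^{(q)})$$ for all polynomials $u$ of degree $\le k$ on $K$; $\widehat{\mathbb S}_K$ is the set of all its nodes. Set $\mathbb S_K=\widehat{\mathbb S}_K\cup\breve{\mathbb S}_K$. **The operator $\mathbf L_h$.** The numerical flux is $\hat{\mathbf F}(\mathbf U^-,\mathbf U^+;\mathbf n)=\frac12\big(\langle\mathbf n,\mathbf F(\mathbf U^-)+\mathbf F(\mathbf U^+)\rangle-a(\mathbf U^+-\mathbf U^-)\big)$ with $a=1$. For $\mathbf U_h\in\mathbb G_h^k$, $\mathbf L_h(\mathbf U_h)\in\mathbb W_h^k$ is defined by $\int_K\mathbf L_h(\mathbf U_h)\cdot\mathbf u\,d\mathbf x=\mathcal J_K(\mathbf U_h,\mathbf u)$ for all $\mathbf u\in\mathbb W_h^k$, $K\in\mathcal T_h$, where $$\mathcal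 J_K(\mathbf U_h,\mathbf u)=-\sum_{\mathscr E\in\partial K}|\mathscr E|\sum_{q=1}^Q\omega_q\Big[\hat{\mathbf F}\big(\mathbf U_h^{\mathrm{int}(K)},\mathbf U_h^{\mathrm{ext}(K)};\mathbf n_{\mathscr E,K}\big)+\tfrac12\big\langle\mathbf n_{\mathscr E,K},\mathbf B_h^{\mathrm{ext}(K)}-\mathbf B_h^{\mathrm{int}(K)}\big\rangle\mathbf S\big(\mathbf U_h^{\mathrm{int}(K)}\big)\Big]\cdot\mathbf u^{\mathrm{int}(K)}\Big|_{\mathbf x_{\mathscr E}^{(q)}}+|K|\sum_{q=1}^{\breve Q}\breve\omega_q\sum_{i=1}^d\mathbf F_i\big(\mathbf U_h(\breve{\mathbf x}_K^{(q)})\big)\cdot\frac{\partial\mathbf u}{\partial x_i}(\breve{\mathbf x}_K^{(q)}).$$ For $\mathbf U_h\in\mathbb G_h^k$, $\sigma_{K,\mathscr E,q}(\mathbf U_h):=\frac12\big|\big\langle\mathbf n_{\mathscr E,K},\mathbf B_h^{\mathrm{int}(K)}-\mathbf B_h^{\mathrm{ext}(K)}\big\rangle\big|\big/\sqrt{\rho H}$, everything evaluated at $\mathbf x_{\mathscr E}^{(q)}$, with $\rho,H$ computed from $\mathbf U_h^{\mathrm{int}(K)}(\mathbf x_{\mathscr E}^{(q)})$. **The limiter $\mathbf\Pi_h:\overline{\mathbb G}_h^k\to\mathbb G_h^k$.** For $\mathbf U=(D,\mathbf m,\mathbf B,E)^\top$ put $q(\mathbf U)=E-\sqrt{D^2+|\mathbf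 m|^2}$, $\Phi(\mathbf U)=\sqrt{(|\mathbf B|^2-E)^2+3(E^2-D^2-|\mathbf m|^2)}$, $\Psi(\mathbf U)=\big(\Phi(\mathbf U)-2(|\mathbf B|^2-E)\big)\sqrt{\Phi(\mathbf U)+|\mathbf B|^2-E}-\sqrt{\tfrac{27}2\big(D^2|\mathbf B|^2+(\mathbf m\cdot\mathbf B)^2\big)}$, $\Psi_\epsilon(\mathbf U)=\Psi(D,\mathbf m,\mathbf B,E-\epsilon)$, and $\mathcal G_\epsilon=\{\mathbf U:D\ge\epsilon,\ q(\mathbf U)\ge\epsilon,\ \Psi_\epsilon(\mathbf U)\ge0\}$. Given $\mathbf U_h\in\overline{\mathbb G}_h^k$ with $\mathbf U_K=\mathbf U_h|_K=(D_K,\mathbf m_K,\mathbf B_K,E_K)^\top$ and cell averages $\bar{\mathbf U}_K=(\bar D_K,\bar{\mathbf m}_K,\bar{\mathbf B}_K,\bar E_K)^\top$, choose a sufficiently small $\epsilon>0$ such that $\bar{\mathbf U}_K\in\mathcal G_\epsilon$ for all $K$. On each $K$: (1) $\widehat D_K=\theta_1(D_K-\bar D_K)+\bar D_K$, $\theta_1=\min\{1,(\bar D_K-\epsilon)/(\bar D_K-\min_{\mathbb S_K}D_K)\}$, and $\widehat{\mathbf U}_K=(\widehat D_K,\mathbf m_K,\mathbf B_K,E_K)^\top$; (2) $\check{\mathbf U}_K=\big(\theta_2(\widehat D_K-\bar D_K)+\bar D_K,\ \theta_2(\mathbf m_K-\bar{\mathbf m}_K)+\bar{\mathbf m}_K,\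 \mathbf B_K,\ \theta_2(E_K-\bar E_K)+\bar E_K\big)^\top$, $\theta_2=\min\{1,(q(\bar{\mathbf U}_K)-\epsilon)/(q(\bar{\mathbf U}_K)-\min_{\mathbb S_K}q(\widehat{\mathbf U}_K))\}$; (3) $(\mathbf\Pi_h\mathbf U_h)|_K=\theta_3(\check{\mathbf U}_K-\bar{\mathbf U}_K)+\bar{\mathbf U}_K$, $\theta_3=\min_{\mathbf x\in\mathbb S_K}\tilde\theta(\mathbf x)$, where $\tilde\theta(\mathbf x)=1$ if $\Psi_\epsilon(\check{\mathbf U}_K(\mathbf x))\ge0$ and otherwise $\tilde\theta(\mathbf x)\in[0,1)$ is the unique solution of $\Psi_\epsilon\big((1-\tilde\theta)\bar{\mathbf U}_K+\tilde\theta\check{\mathbf U}_K(\mathbf x)\big)=0$. (If a denominator in $\theta_1$ or $\theta_2$ vanishes, the corresponding $\theta$ is $1$.) For $k=0$, $\mathbf\Pi_h$ is the identity. **Runge–Kutta parameters.** $N_r\ge1$ stages; $\alpha_{i\ell}\ge0$, $\beta_{i\ell}\ge0$ ($1\le i\le N_r$, $0\le\ell\le i-1$), $\sum_{\ell=0}^{i-1}\alpha_{i\ell}=1$. $\Delta t_n>0$ is the time step.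
   Formalization: Adds the assumption that for every ρ>0 the internal energy e=H−1−p/ρ tends to 0 as p→0+; without it the claim fails for k≥1, e.g. for H=2+2p/ρ, since the limiter's q and Ψ do not involve H. *)

theory Defs
  imports "HOL-Analysis.Analysis" "HOL-Computational_Algebra.Polynomial"
begin

section \<open>Relativistic MHD states\<close>

text \<open>
  The conservative vector \<open>U = (D, m, B, E)\<close> is an element of
  \<open>real \<times> real^3 \<times> real^3 \<times> real\<close>, the product copy of 8-dimensional Euclidean space; addition,
  scaling and \<open>\<bullet>\<close> are those of the product.
\<close>

type_synonym state = "real \<times> (real^3) \<times> (real^3) \<times> real"

fun Dc :: "state \<Rightarrow> real" where "Dc (D, m, B, E) = D"
fun mc :: "state \<Rightarrow> real^3" where "mc (D, m, B, E) = m"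
fun Bc :: "state \<Rightarrow> real^3" where "Bc (D, m, B, E) = B"
fun Ec :: "state \<Rightarrow> real" where "Ec (D, m, B, E) = E"

definition equation_of_state :: "(real \<Rightarrow> real \<Rightarrow> real) \<Rightarrow> bool" where
  "equation_of_state H \<longleftrightarrow> (\<forall>p>0. \<forall>\<rho>>0.
     (\<lambda>(p, \<rho>). H p \<rho>) differentiable (at (p, \<rho>)) \<and>
     H p \<rho> \<ge> sqrt (1 + p\<^sup>2 / \<rho>\<^sup>2) + p / \<rho> \<and>
     H p \<rho> * (1 / \<rho> - deriv (\<lambda>p. H p \<rho>) p) < deriv (\<lambda>\<rho>. H p \<rho>) \<rho> \<and>
     deriv (\<lambda>\<rho>. H p \<rho>) \<rho> < 0)"

text \<open>
  The internal energy \<open>e = H - 1 - p/\<rho>\<close> vanishes as \<open>p\<close> tends to \<open>0\<close>, i.e. \<open>H\<close> tends to \<open>1\<close>.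
  The conditions in \<open>equation_of_state\<close> do not imply this (\<open>H = 2 + 2 p/\<rho>\<close> satisfies them), and
  without it the limiter below, whose functions \<open>q\<close> and \<open>\<Psi>\<close> do not involve \<open>H\<close>, need not produce
  states of the admissible set.
\<close>

definition vanishing_energy_limit :: "(real \<Rightarrow> real \<Rightarrow> real) \<Rightarrow> bool" where
  "vanishing_energy_limit H \<longleftrightarrow>
     (\<forall>\<rho>>0. ((\<lambda>p. H p \<rho> - 1 - p / \<rho>) \<longlongrightarrow> 0) (at_right 0))"

definition lorentz :: "real^3 \<Rightarrow> real" where
  "lorentz v = 1 / sqrt (1 - (norm v)\<^sup>2)"

definition ptot :: "real \<Rightarrow> real^3 \<Rightarrow> real^3 \<Rightarrow> real" where
  "ptot p v B = p + ((norm B)\<^sup>2 / (lorentz v)\<^sup>2 + (v \<bullet> B)\<^sup>2) / 2"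

definition cons :: "(real \<Rightarrow> real \<Rightarrow> real) \<Rightarrow> real \<Rightarrow> real \<Rightarrow> real^3 \<Rightarrow> real^3 \<Rightarrow> state" where
  "cons H \<rho> p v B =
     (\<rho> * lorentz v,
      (\<rho> * H p \<rho> * (lorentz v)\<^sup>2 + (norm B)\<^sup>2) *\<^sub>R v - (v \<bullet> B) *\<^sub>R B,
      B,
      \<rho> * H p \<rho> * (lorentz v)\<^sup>2 - ptot p v B + (norm B)\<^sup>2)"

definition is_prim :: "(real \<Rightarrow> real \<Rightarrow> real) \<Rightarrow> state \<Rightarrow> real \<times> real \<times> (real^3) \<Rightarrow> bool" where
  "is_prim H U = (\<lambda>(\<rho>, p, v).
     \<rho> > 0 \<and> p > 0 \<and> H p \<rho> - 1 - p / \<rho> > 0 \<and> norm v < 1 \<and> U = cons H \<rho> p v (Bc U))"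

definition admissible :: "(real \<Rightarrow> real \<Rightarrow> real) \<Rightarrow> state set" where
  "admissible H = {U. \<exists>w. is_prim H U w}"

text \<open>On the admissible set the primitive variables are unique, so \<open>SOME\<close> denotes them.\<close>

definition prim :: "(real \<Rightarrow> real \<Rightarrow> real) \<Rightarrow> state \<Rightarrow> real \<times> real \<times> (real^3)" where
  "prim H U = (SOME w. is_prim H U w)"

definition rho_of :: "(real \<Rightarrow> real \<Rightarrow> real) \<Rightarrow> state \<Rightarrow> real" where
  "rho_of H U = fst (prim H U)"

definition p_of :: "(real \<Rightarrow> real \<Rightarrow> real) \<Rightarrow> state \<Rightarrow> real" where
  "p_of H U = fst (snd (prim H U))"

definition v_of :: "(real \<Rightarrow> real \<Rightarrow> real) \<Rightarrow> state \<Rightarrow> real^3" where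
  "v_of H U = snd (snd (prim H U))"

definition flux :: "(real \<Rightarrow> real \<Rightarrow> real) \<Rightarrow> 3 \<Rightarrow> state \<Rightarrow> state" where
  "flux H i U = (let p = p_of H U; v = v_of H U; m = mc U; B = Bc U in
     (Dc U * v $ i,
      (v $ i) *\<^sub>R m - (B $ i) *\<^sub>R ((1 / (lorentz v)\<^sup>2) *\<^sub>R B + (v \<bullet> B) *\<^sub>R v)
        + ptot p v B *\<^sub>R axis i 1,
      (v $ i) *\<^sub>R B - (B $ i) *\<^sub>R v,
      m $ i))"

definition source :: "(real \<Rightarrow> real \<Rightarrow> real) \<Rightarrow> state \<Rightarrow> state" where
  "source H U = (let v = v_of H U; B = Bc U in
     (0, (1 - (norm v)\<^sup>2) *\<^sub>R B + (v \<bullet> B) *\<^sub>R v, v, v \<bullet> B))"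

text \<open>Spatial dimension two: directions are in \<open>real^2\<close> and act on the first two components.\<close>

definition dirB :: "real^2 \<Rightarrow> real^3 \<Rightarrow> real" where
  "dirB n B = n $ 1 * B $ 1 + n $ 2 * B $ 2"

definition dir_flux :: "(real \<Rightarrow> real \<Rightarrow> real) \<Rightarrow> real^2 \<Rightarrow> state \<Rightarrow> state" where
  "dir_flux H n U = (n $ 1) *\<^sub>R flux H 1 U + (n $ 2) *\<^sub>R flux H 2 U"

definition num_flux ::
    "(real \<Rightarrow> real \<Rightarrow> real) \<Rightarrow> real \<Rightarrow> state \<Rightarrow> state \<Rightarrow> real^2 \<Rightarrow> state" where
  "num_flux H a Um Up n =
     (1/2) *\<^sub>R (dir_flux H n Um + dir_flux H n Up - a *\<^sub>R (Up - Um))"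


section \<open>Mesh and quadratures\<close>

text \<open>
  An edge is given by its two end points, in an order that is arbitrary but the same for both
  cells sharing the edge (it only serves to number the Gauss points). The neighbour of \<open>K\<close> across
  the edge \<open>e\<close> is \<open>nbr K e\<close>. To include periodic boundary conditions, the points of \<open>e\<close> correspond
  to those of an edge of the neighbour by a translation by \<open>shift K e\<close>, which is \<open>0\<close> except
  possibly on the boundary of the domain.

  \<open>gauss_x\<close>, \<open>gauss_w\<close>: nodes and weights of the Gauss rule on \<open>[0,1]\<close>;
  \<open>vol_Q\<close>, \<open>vol_x\<close>, \<open>vol_w\<close>: the quadrature for the volume integral of the flux (breve);
  \<open>dec_edge_w\<close> and \<open>dec_Q\<close>, \<open>dec_x\<close>, \<open>dec_w\<close>: the edge weights and the remaining nodes and weights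
  (tilde) of the special quadrature decomposing the cell average. Sequences of nodes start at \<open>1\<close>.
\<close>

type_synonym point = "real^2"
type_synonym cell = "point set"
type_synonym edge = "point \<times> point"

record mesh =
  domain :: "point set"
  cells :: "cell set"
  edges :: "cell \<Rightarrow> edge set"
  normal :: "cell \<Rightarrow> edge \<Rightarrow> point"
  nbr :: "cell \<Rightarrow> edge \<Rightarrow> cell"
  shift :: "cell \<Rightarrow> edge \<Rightarrow> point"

record disc = mesh +
  gauss_x :: "nat \<Rightarrow> real"
  gauss_w :: "nat \<Rightarrow> real"
  vol_Q :: "cell \<Rightarrow> nat"
  vol_x :: "cell \<Rightarrow> nat \<Rightarrow> point"
  vol_w :: "cell \<Rightarrow> nat \<Rightarrow> real"
  dec_edge_w :: "cell \<Rightarrow> edge \<Rightarrow> nat \<Rightarrow> real"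
  dec_Q :: "cell \<Rightarrow> nat"
  dec_x :: "cell \<Rightarrow> nat \<Rightarrow> point"
  dec_w :: "cell \<Rightarrow> nat \<Rightarrow> real"

definition edge_seg :: "edge \<Rightarrow> point set" where
  "edge_seg e = closed_segment (fst e) (snd e)"

definition edge_length :: "edge \<Rightarrow> real" where
  "edge_length e = dist (fst e) (snd e)"

definition area :: "cell \<Rightarrow> real" where
  "area K = measure lebesgue K"

text \<open>Polygons need not be convex, and consecutive edges may be collinear (hanging nodes).\<close>

definition polygon :: "cell \<Rightarrow> edge set \<Rightarrow> bool" where
  "polygon K es \<longleftrightarrow>
     compact K \<and> K \<noteq> {} \<and> closure (interior K) = K \<and> connected (interior K) \<and>
     finite es \<and> (\<forall>(a, b)\<in>es. a \<noteq> b) \<and> frontier K = (\<Union>e\<in>es. edge_seg e) \<and>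
     (\<forall>(a, b)\<in>es. \<forall>(c, d)\<in>es. (a, b) \<noteq> (c, d) \<longrightarrow>
        edge_seg (a, b) \<inter> edge_seg (c, d) \<subseteq> {a, b} \<inter> {c, d})"

definition outward_unit_normal :: "cell \<Rightarrow> edge \<Rightarrow> point \<Rightarrow> bool" where
  "outward_unit_normal K e n \<longleftrightarrow>
     norm n = 1 \<and> n \<bullet> (snd e - fst e) = 0 \<and>
     (\<forall>x\<in>open_segment (fst e) (snd e). \<exists>r>0. \<forall>t. 0 < t \<and> t < r \<longrightarrow>
        x - t *\<^sub>R n \<in> interior K \<and> x + t *\<^sub>R n \<notin> K)"

definition polygonal_mesh :: "'z mesh_scheme \<Rightarrow> bool" where
  "polygonal_mesh M \<longleftrightarrow>
     open (domain M) \<and> connected (domain M) \<and> bounded (domain M) \<and> domain M \<noteq> {} \<and>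
     finite (cells M) \<and> \<Union>(cells M) = closure (domain M) \<and>
     (\<forall>K\<in>cells M. \<forall>K'\<in>cells M. K \<noteq> K' \<longrightarrow> interior K \<inter> interior K' = {}) \<and>
     (\<forall>K\<in>cells M. polygon K (edges M K)) \<and>
     (\<forall>K\<in>cells M. \<forall>e\<in>edges M K. outward_unit_normal K e (normal M K e)) \<and>
     (\<forall>K\<in>cells M. \<forall>e\<in>edges M K.
        let K' = nbr M K e; s = shift M K e; e' = (fst e + s, snd e + s) in
          K' \<in> cells M \<and> e' \<in> edges M K' \<and>
          nbr M K' e' = K \<and> shift M K' e' = - s \<and> normal M K' e' = - normal M K e \<and>
          (s \<noteq> 0 \<longrightarrow> edge_seg e \<subseteq> frontier (domain M)))"

definition edge_point :: "disc \<Rightarrow> edge \<Rightarrow> nat \<Rightarrow> point" where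
  "edge_point M e q = fst e + gauss_x M q *\<^sub>R (snd e - fst e)"

definition cell_average :: "cell \<Rightarrow> (point \<Rightarrow> 'b::euclidean_space) \<Rightarrow> 'b" where
  "cell_average K f = (1 / area K) *\<^sub>R integral K f"

text \<open>Polynomials of total degree at most \<open>k\<close> in two variables, with vector coefficients.\<close>

definition poly_le :: "nat \<Rightarrow> (point \<Rightarrow> 'b::real_vector) \<Rightarrow> bool" where
  "poly_le k f \<longleftrightarrow> (\<exists>c. \<forall>x. f x = (\<Sum>i\<le>k. \<Sum>j\<le>k - i. ((x $ 1) ^ i * (x $ 2) ^ j) *\<^sub>R c i j))"

definition gauss_rule :: "nat \<Rightarrow> (nat \<Rightarrow> real) \<Rightarrow> (nat \<Rightarrow> real) \<Rightarrow> bool" where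
  "gauss_rule Q \<xi> \<omega> \<longleftrightarrow>
     inj_on \<xi> {1..Q} \<and> \<xi> ` {1..Q} \<subseteq> {0..1} \<and> (\<forall>q\<in>{1..Q}. \<omega> q > 0) \<and> (\<Sum>q=1..Q. \<omega> q) = 1 \<and>
     (\<forall>P::real poly. degree P \<le> 2 * Q - 1 \<longrightarrow>
        integral {0..1} (poly P) = (\<Sum>q=1..Q. \<omega> q * poly P (\<xi> q)))"

definition volume_quadrature :: "disc \<Rightarrow> nat \<Rightarrow> cell \<Rightarrow> bool" where
  "volume_quadrature M d K \<longleftrightarrow>
     (\<forall>q\<in>{1..vol_Q M K}. vol_x M K q \<in> K) \<and>
     (\<forall>f::point \<Rightarrow> real. poly_le d f \<longrightarrow>
        cell_average K f = (\<Sum>q=1..vol_Q M K. vol_w M K q * f (vol_x M K q)))"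

definition special_quadrature :: "disc \<Rightarrow> nat \<Rightarrow> cell \<Rightarrow> bool" where
  "special_quadrature M k K \<longleftrightarrow>
     (\<forall>q\<in>{1..dec_Q M K}. dec_x M K q \<in> K) \<and>
     (\<forall>e\<in>edges M K. \<forall>q\<in>{1..k+1}. dec_edge_w M K e q > 0) \<and>
     (\<forall>q\<in>{1..dec_Q M K}. dec_w M K q > 0) \<and>
     (\<Sum>e\<in>edges M K. \<Sum>q=1..k+1. dec_edge_w M K e q) + (\<Sum>q=1..dec_Q M K. dec_w M K q) = 1 \<and>
     (\<forall>f::point \<Rightarrow> real. poly_le k f \<longrightarrow>
        cell_average K f =
          (\<Sum>e\<in>edges M K. \<Sum>q=1..k+1. dec_edge_w M K e q * f (edge_point M e q))
          + (\<Sum>q=1..dec_Q M K. dec_w M K q * f (dec_x M K q)))"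

definition discretization :: "disc \<Rightarrow> nat \<Rightarrow> bool" where
  "discretization M k \<longleftrightarrow>
     polygonal_mesh M \<and> gauss_rule (k + 1) (gauss_x M) (gauss_w M) \<and>
     (\<forall>K\<in>cells M. volume_quadrature M (2 * k) K \<and> special_quadrature M k K)"

definition nodes :: "disc \<Rightarrow> nat \<Rightarrow> cell \<Rightarrow> point set" where
  "nodes M k K =
     {edge_point M e q | e q. e \<in> edges M K \<and> q \<in> {1..k+1}}
     \<union> dec_x M K ` {1..dec_Q M K} \<union> vol_x M K ` {1..vol_Q M K}"


section \<open>Discontinuous Galerkin spaces\<close>

text \<open>
  A discontinuous piecewise polynomial \<open>u\<close> assigns to each cell \<open>K\<close> the polynomial \<open>u K\<close>, extended to
  the whole plane, which agrees with \<open>u\<close> on \<open>K\<close>; so \<open>u K x\<close> at a boundary point is the trace from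
  inside \<open>K\<close>. Values \<open>u K\<close> for \<open>K\<close> outside the mesh are irrelevant.
\<close>

type_synonym field = "cell \<Rightarrow> point \<Rightarrow> state"

definition partial :: "2 \<Rightarrow> (point \<Rightarrow> 'b::real_normed_vector) \<Rightarrow> point \<Rightarrow> 'b" where
  "partial i f x = frechet_derivative f (at x) (axis i 1)"

definition Wh :: "disc \<Rightarrow> nat \<Rightarrow> field set" where
  "Wh M k = {u. \<forall>K\<in>cells M. poly_le k (u K) \<and>
     (\<forall>x\<in>K. partial 1 (\<lambda>y. Bc (u K y) $ 1) x + partial 2 (\<lambda>y. Bc (u K y) $ 2) x = 0)}"

definition Gbar_h :: "(real \<Rightarrow> real \<Rightarrow> real) \<Rightarrow> disc \<Rightarrow> nat \<Rightarrow> field set" where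
  "Gbar_h H M k = {u \<in> Wh M k. \<forall>K\<in>cells M. cell_average K (u K) \<in> admissible H}"

definition G_h :: "(real \<Rightarrow> real \<Rightarrow> real) \<Rightarrow> disc \<Rightarrow> nat \<Rightarrow> field set" where
  "G_h H M k = {u \<in> Gbar_h H M k. \<forall>K\<in>cells M. \<forall>x\<in>nodes M k K. u K x \<in> admissible H}"

definition ext_trace :: "disc \<Rightarrow> field \<Rightarrow> cell \<Rightarrow> edge \<Rightarrow> point \<Rightarrow> state" where
  "ext_trace M u K e x = u (nbr M K e) (x + shift M K e)"

definition J_form ::
    "(real \<Rightarrow> real \<Rightarrow> real) \<Rightarrow> disc \<Rightarrow> nat \<Rightarrow> cell \<Rightarrow> field \<Rightarrow> field \<Rightarrow> real" where
  "J_form H M k K U u =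
     - (\<Sum>e\<in>edges M K. edge_length e * (\<Sum>q=1..k+1. gauss_w M q *
          (let x = edge_point M e q; n = normal M K e;
               Ui = U K x; Ue = ext_trace M U K e x
           in (num_flux H 1 Ui Ue n + (dirB n (Bc Ue - Bc Ui) / 2) *\<^sub>R source H Ui) \<bullet> u K x)))
     + area K * (\<Sum>q=1..vol_Q M K. vol_w M K q *
          (let x = vol_x M K q
           in flux H 1 (U K x) \<bullet> partial 1 (u K) x + flux H 2 (U K x) \<bullet> partial 2 (u K) x))"

text \<open>The variational problem determines its solution on the cells of the mesh.\<close>

definition L_h :: "(real \<Rightarrow> real \<Rightarrow> real) \<Rightarrow> disc \<Rightarrow> nat \<Rightarrow> field \<Rightarrow> field" where
  "L_h H M k U = (SOME L. L \<in> Wh M k \<and>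
     (\<forall>u\<in>Wh M k. \<forall>K\<in>cells M. integral K (\<lambda>x. L K x \<bullet> u K x) = J_form H M k K U u))"

definition jump_sigma ::
    "(real \<Rightarrow> real \<Rightarrow> real) \<Rightarrow> disc \<Rightarrow> cell \<Rightarrow> edge \<Rightarrow> nat \<Rightarrow> field \<Rightarrow> real" where
  "jump_sigma H M K e q U =
     (let x = edge_point M e q; Ui = U K x; Ue = ext_trace M U K e x; \<rho> = rho_of H Ui
      in \<bar>dirB (normal M K e) (Bc Ui - Bc Ue)\<bar> / 2 / sqrt (\<rho> * H (p_of H Ui) \<rho>))"


section \<open>Limiter\<close>

definition qf :: "state \<Rightarrow> real" where
  "qf U = Ec U - sqrt ((Dc U)\<^sup>2 + (norm (mc U))\<^sup>2)"

definition Phi :: "state \<Rightarrow> real" where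
  "Phi U = sqrt (((norm (Bc U))\<^sup>2 - Ec U)\<^sup>2 + 3 * ((Ec U)\<^sup>2 - (Dc U)\<^sup>2 - (norm (mc U))\<^sup>2))"

definition Psi :: "state \<Rightarrow> real" where
  "Psi U = (Phi U - 2 * ((norm (Bc U))\<^sup>2 - Ec U)) * sqrt (Phi U + (norm (Bc U))\<^sup>2 - Ec U)
           - sqrt (27/2 * ((Dc U)\<^sup>2 * (norm (Bc U))\<^sup>2 + (mc U \<bullet> Bc U)\<^sup>2))"

definition Psi_eps :: "real \<Rightarrow> state \<Rightarrow> real" where
  "Psi_eps \<epsilon> U = Psi (Dc U, mc U, Bc U, Ec U - \<epsilon>)"

definition G_eps :: "real \<Rightarrow> state set" where
  "G_eps \<epsilon> = {U. Dc U \<ge> \<epsilon> \<and> qf U \<ge> \<epsilon> \<and> Psi_eps \<epsilon> U \<ge> 0}"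

text \<open>In the following, \<open>S\<close> is the node set, \<open>Ub\<close> the average and \<open>f\<close> the polynomial on one cell.\<close>

definition theta1 :: "real \<Rightarrow> point set \<Rightarrow> state \<Rightarrow> (point \<Rightarrow> state) \<Rightarrow> real" where
  "theta1 \<epsilon> S Ub f = (let d = Dc Ub - Min ((\<lambda>x. Dc (f x)) ` S) in
     if d = 0 then 1 else min 1 ((Dc Ub - \<epsilon>) / d))"

definition lim_hat :: "real \<Rightarrow> point set \<Rightarrow> state \<Rightarrow> (point \<Rightarrow> state) \<Rightarrow> point \<Rightarrow> state" where
  "lim_hat \<epsilon> S Ub f = (let \<theta> = theta1 \<epsilon> S Ub f in
     (\<lambda>x. (\<theta> * (Dc (f x) - Dc Ub) + Dc Ub, mc (f x), Bc (f x), Ec (f x))))"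

definition theta2 :: "real \<Rightarrow> point set \<Rightarrow> state \<Rightarrow> (point \<Rightarrow> state) \<Rightarrow> real" where
  "theta2 \<epsilon> S Ub f = (let d = qf Ub - Min ((\<lambda>x. qf (lim_hat \<epsilon> S Ub f x)) ` S) in
     if d = 0 then 1 else min 1 ((qf Ub - \<epsilon>) / d))"

definition lim_check :: "real \<Rightarrow> point set \<Rightarrow> state \<Rightarrow> (point \<Rightarrow> state) \<Rightarrow> point \<Rightarrow> state" where
  "lim_check \<epsilon> S Ub f = (let \<theta> = theta2 \<epsilon> S Ub f; g = lim_hat \<epsilon> S Ub f in
     (\<lambda>x. (\<theta> * (Dc (g x) - Dc Ub) + Dc Ub,
           \<theta> *\<^sub>R (mc (f x) - mc Ub) + mc Ub,
           Bc (f x),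
           \<theta> * (Ec (f x) - Ec Ub) + Ec Ub)))"

text \<open>
  The solution chosen by \<open>SOME\<close> is the unique one if \<open>Psi_eps \<epsilon> Ub > 0\<close>; in the borderline case
  \<open>Psi_eps \<epsilon> Ub = 0\<close>, which \<open>G_eps\<close> does not exclude, there may be a second one.
\<close>

definition theta_tilde :: "real \<Rightarrow> state \<Rightarrow> state \<Rightarrow> real" where
  "theta_tilde \<epsilon> Ub V = (if Psi_eps \<epsilon> V \<ge> 0 then 1
     else (SOME \<theta>. 0 \<le> \<theta> \<and> \<theta> < 1 \<and> Psi_eps \<epsilon> ((1 - \<theta>) *\<^sub>R Ub + \<theta> *\<^sub>R V) = 0))"

definition theta3 :: "real \<Rightarrow> point set \<Rightarrow> state \<Rightarrow> (point \<Rightarrow> state) \<Rightarrow> real" where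
  "theta3 \<epsilon> S Ub f = Min ((\<lambda>x. theta_tilde \<epsilon> Ub (lim_check \<epsilon> S Ub f x)) ` S)"

definition cell_limiter :: "real \<Rightarrow> point set \<Rightarrow> state \<Rightarrow> (point \<Rightarrow> state) \<Rightarrow> point \<Rightarrow> state" where
  "cell_limiter \<epsilon> S Ub f =
     (\<lambda>x. theta3 \<epsilon> S Ub f *\<^sub>R (lim_check \<epsilon> S Ub f x - Ub) + Ub)"

text \<open>
  The parameter \<open>\<epsilon>\<close> may depend on the function being limited. The limiter is only meaningful, and the
  choice of \<open>\<epsilon>\<close> only constrained, for functions with admissible cell averages.
\<close>

definition eps_choice ::
    "(real \<Rightarrow> real \<Rightarrow> real) \<Rightarrow> disc \<Rightarrow> nat \<Rightarrow> (field \<Rightarrow> real) \<Rightarrow> bool" where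
  "eps_choice H M k \<epsilon> \<longleftrightarrow>
     (\<forall>U\<in>Gbar_h H M k. \<epsilon> U > 0 \<and> (\<forall>K\<in>cells M. cell_average K (U K) \<in> G_eps (\<epsilon> U)))"

definition limiter :: "disc \<Rightarrow> nat \<Rightarrow> (field \<Rightarrow> real) \<Rightarrow> field \<Rightarrow> field" where
  "limiter M k \<epsilon> U = (if k = 0 then U
     else (\<lambda>K. cell_limiter (\<epsilon> U) (nodes M k K) (cell_average K (U K)) (U K)))"

end

theory Submission
  imports Defs
begin

text \<open>
  For \<open>|v\<^sup>*| < 1\<close> and \<open>B\<^sup>* \<in> \<real>\<^sup>3\<close> put
  \<open>\<xi>\<^sup>* = (- sqrt (1 - |v\<^sup>*|\<^sup>2), - v\<^sup>*, - ((1 - |v\<^sup>*|\<^sup>2) B\<^sup>* + (v\<^sup>* \<bullet> B\<^sup>*) v\<^sup>*), 1)\<close> and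
  \<open>p\<^sup>* = ((1 - |v\<^sup>*|\<^sup>2) |B\<^sup>*|\<^sup>2 + (v\<^sup>* \<bullet> B\<^sup>*)\<^sup>2) / 2\<close>. The admissible set is the set of all \<open>U\<close> with \<open>D > 0\<close> and
  \<open>U \<bullet> \<xi>\<^sup>* + p\<^sup>* > 0\<close> for all \<open>v\<^sup>*, B\<^sup>*\<close>, so it is convex and its membership is a family of affine
  inequalities. For a unit vector \<open>k\<close>, the expression
  \<open>(U + k \<bullet> F(U)) \<bullet> \<xi>\<^sup>* + p\<^sup>* (1 + k \<bullet> v\<^sup>*) - (k \<bullet> B) (v\<^sup>* \<bullet> B\<^sup>*)\<close> is the contraction of an energy-momentum
  tensor with a null vector: a perfect-fluid part plus the electromagnetic part of the difference of the
  fields of \<open>(v, B)\<close> and \<open>(v\<^sup>*, B\<^sup>*)\<close>, both nonnegative. Together with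
  \<open>|S(U) \<bullet> \<xi>\<^sup>* + v\<^sup>* \<bullet> B\<^sup>*| \<le> (U \<bullet> \<xi>\<^sup>* + p\<^sup>*) / sqrt (\<rho> H)\<close> this bounds the edge contributions to an Euler step
  from below by \<open>- (1 + \<sigma>)\<close> times the interior value, up to \<open>p\<^sup>* (n \<bullet> v\<^sup>*) - (n \<bullet> B) (v\<^sup>* \<bullet> B\<^sup>*)\<close>; these
  remainders cancel by the divergence theorem, because the polynomial magnetic field is divergence-free in
  each cell. The limiter then works since the functions \<open>q\<close> and \<open>\<Psi>\<close> describe the same convex set.
\<close>

section \<open>Fluid and electromagnetic parts of the flux inequality\<close>

text \<open>The primitive variables are only implicit functions of U, so neither convexity of the
  admissible set nor the effect of averaging can be read off its definition; affine forms commute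
  with averages, and each estimate on a cell becomes a sum over nodes. The null vector comes from a
  = 1, the speed of light: with this viscosity the numerical flux is assembled from U - n . F(U) for
  both traces. The magnetic remainder has no sign and must cancel in the sum over the edges. The
  numerical flux produces it with the mean of the two normal traces, which do not belong to one
  divergence-free polynomial. The source term, weighted by half the jump of the normal field,
  replaces this mean by the interior trace; the price is the source estimate times the jump, and
  this is the origin of \<open>jump_sigma\<close> in the CFL condition. The inequalities do not
  contain \<open>H\<close>. Its lower bound shows that admissible states satisfy them; to return
  from the inequalities to primitive variables the internal energy must become small with the
  pressure.\<close>

text \<open>
  These are \<open>\<xi>\<^sup>*\<close> and \<open>p\<^sup>*\<close>, with \<open>v\<close>, \<open>B\<close> for \<open>v\<^sup>*\<close>, \<open>B\<^sup>*\<close>.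
\<close>

definition dual_vec :: "real^3 \<Rightarrow> real^3 \<Rightarrow> state" where
  "dual_vec v B = (- sqrt (1 - (norm v)\<^sup>2), - v, - ((1 - (norm v)\<^sup>2) *\<^sub>R B + (v \<bullet> B) *\<^sub>R v), 1)"

definition pmag :: "real^3 \<Rightarrow> real^3 \<Rightarrow> real" where
  "pmag v B = ((1 - (norm v)\<^sup>2) * (norm B)\<^sup>2 + (v \<bullet> B)\<^sup>2) / 2"

unbundle cross3_syntax

text \<open>
  The energy-momentum tensor of the electric field \<open>e\<close> and the magnetic field \<open>h\<close>, contracted with the
  covectors \<open>(-1, -k)\<close> and \<open>(-1, v)\<close>. For \<open>|k| = 1\<close> and \<open>|v| < 1\<close> its sign is the dominant energy condition.
\<close>

definition em_contraction :: "real^3 \<Rightarrow> real^3 \<Rightarrow> real^3 \<Rightarrow> real^3 \<Rightarrow> real" where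
  "em_contraction k v e h = ((e \<bullet> e + h \<bullet> h) / 2) * (1 - k \<bullet> v) + (k - v) \<bullet> (e \<times> h) + (e \<bullet> k) * (e \<bullet> v) + (h \<bullet> k) * (h \<bullet> v)"

text \<open>Complete the square in \<open>h\<close>: the cross term of |h - v \<times> e|^2 is 2 v .
  (e \<times> h), and |v \<times> e| \<le> |e|. The case \<open>k = 0\<close> is the electromagnetic
  part of \<open>lin_form\<close>; the square is kept because the source estimate uses it.\<close>

lemma em_contraction_rest:
  assumes "norm v \<le> 1"
  shows "(norm (h - v \<times> e))\<^sup>2 / 2 \<le> em_contraction 0 v e h"
proof -
  have "(norm (v \<times> e))\<^sup>2 \<le> (norm e)\<^sup>2"
    using assms norm_cross[of v e]
    by (smt (verit, best) mult_left_le_one_le norm_ge_zero power_le_one power_mult_distrib zero_le_power2)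
  moreover have "(norm (h - v \<times> e))\<^sup>2 = (norm h)\<^sup>2 + (norm (v \<times> e))\<^sup>2 - 2 * (v \<bullet> (e \<times> h))"
    unfolding power2_norm_eq_inner by (simp add: cross3_simps inner_diff)
  ultimately show ?thesis
    unfolding em_contraction_def by (simp add: power2_norm_eq_inner field_simps)
qed

text \<open>A null direction makes the contraction a sum of squares after multiplication by 2 (1 + k
  . v); the last vector is the part of \<open>e + h \<times> k\<close> transverse to
  \<open>k\<close>. The polynomial identity holds modulo k . k = 1.\<close>

lemma em_contraction_sum_of_squares:
  assumes "k \<bullet> k = 1"
  shows "2 * (1 + k \<bullet> v) * em_contraction k v e h =
    (e \<bullet> (k + v) + h \<bullet> (k \<times> v))\<^sup>2 + (h \<bullet> (k + v) - e \<bullet> (k \<times> v))\<^sup>2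
    + (1 - v \<bullet> v) * (norm (e - (e \<bullet> k) *\<^sub>R k + h \<times> k))\<^sup>2"
proof -
  have "k$1*k$1 + k$2*k$2+k$3*k$3 = 1" using assms by (simp add: inner_vec_def sum_3)
  then show ?thesis unfolding em_contraction_def power2_norm_eq_inner
    apply (simp add: inner_vec_def sum_3 cross3_def vector_3)
    apply (simp only: power2_eq_square)
    by algebra
qed

lemma lorentz_facts:
  assumes "norm v < 1"
  shows "1 / (lorentz v)\<^sup>2 = 1 - (norm v)\<^sup>2" "lorentz v > 0" "(lorentz v)\<^sup>2 * (1 - (norm v)\<^sup>2) = 1" "1 - (norm v)\<^sup>2 > 0"
    "lorentz v * sqrt (1 - (norm v)\<^sup>2) = 1"
proof -
  show *: "1 - (norm v)\<^sup>2 > 0" using assms by (simp add: power_less_one_iff abs_square_less_1)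
  then show "1 / (lorentz v)\<^sup>2 = 1 - (norm v)\<^sup>2" "lorentz v > 0" "(lorentz v)\<^sup>2 * (1 - (norm v)\<^sup>2) = 1"
     "lorentz v * sqrt (1 - (norm v)\<^sup>2) = 1"
    by (auto simp: lorentz_def power_divide)
qed

text \<open>Takes any \<open>k\<close> in three-space and explicit \<open>p\<close> and
  \<open>v\<close>, so that the flux identity is independent of the choice in \<open>prim\<close>.
  It vanishes at \<open>k = 0\<close>, which lets the same identity describe
  \<open>lin_form\<close>.\<close>

definition prim_flux :: "real^3 \<Rightarrow> real \<Rightarrow> real^3 \<Rightarrow> state \<Rightarrow> state" where
  "prim_flux k p v U =
     (Dc U * (k \<bullet> v),
      (k \<bullet> v) *\<^sub>R mc U - (k \<bullet> Bc U) *\<^sub>R ((1 / (lorentz v)\<^sup>2) *\<^sub>R Bc U + (v \<bullet> Bc U) *\<^sub>R v) + ptot p v (Bc U) *\<^sub>R k,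
      (k \<bullet> v) *\<^sub>R Bc U - (k \<bullet> Bc U) *\<^sub>R v,
      k \<bullet> mc U)"

text \<open>\<open>h\<close> is the enthalpy density \<open>\<rho> * H p \<rho>\<close>. The first
  two terms contract the perfect-fluid tensor; the last is the mass current weighted by the first
  entry of \<open>dual_vec\<close>.\<close>

definition fluid_contraction :: "real^3 \<Rightarrow> real \<Rightarrow> real \<Rightarrow> real \<Rightarrow> real^3 \<Rightarrow> real^3 \<Rightarrow> real" where
  "fluid_contraction k h \<rho> p v w = h * (lorentz v)\<^sup>2 * (1 + k \<bullet> v) * (1 - v \<bullet> w) - p * (1 + k \<bullet> w)
     - \<rho> * lorentz v * sqrt (1 - (norm w)\<^sup>2) * (1 + k \<bullet> v)"

text \<open>A product of two triple products is the determinant of the nine inner products; this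
  removes the cross products left in the electromagnetic part.\<close>

lemma triple_mult:
  fixes a b c x y z :: "real^3"
  shows "((a \<times> b) \<bullet> c) * ((x \<times> y) \<bullet> z) =
    (a \<bullet> x) * ((b \<bullet> y) * (c \<bullet> z) - (b \<bullet> z) * (c \<bullet> y))
    - (a \<bullet> y) * ((b \<bullet> x) * (c \<bullet> z) - (b \<bullet> z) * (c \<bullet> x))
    + (a \<bullet> z) * ((b \<bullet> x) * (c \<bullet> y) - (b \<bullet> y) * (c \<bullet> x))"
  by (simp add: inner_vec_def sum_3 cross3_def vector_3) (simp add: algebra_simps)

text \<open>The ideal electric field is - v \<times> B, so the last two arguments are the
  differences of the fields of (v, B) and (w, C). The electromagnetic part is quadratic: the square
  of the second field gives \<open>pmag w C * (1 + k \<bullet> w)\<close>, and the mixed terms give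
  the magnetic entry of \<open>dual_vec\<close> and (k . B)(w . C). Once everything is written in
  inner products, both sides agree as polynomials.\<close>

lemma flux_decomposition:
  assumes v: "norm v < 1" and U: "U = cons H \<rho> p v B"
  shows "(U + prim_flux k p v U) \<bullet> dual_vec w C + pmag w C * (1 + k \<bullet> w) - (k \<bullet> B) * (w \<bullet> C)
    = fluid_contraction k (\<rho> * H p \<rho>) \<rho> p v w + em_contraction k w (w \<times> C - v \<times> B) (B - C)"
proof -
  define X where "X = \<rho> * H p \<rho> * (lorentz v)\<^sup>2"
  define d where "d = \<rho> * lorentz v"
  define s where "s = sqrt (1 - (norm w)\<^sup>2)"
  have pt: "ptot p v B = p + ((1 - v \<bullet> v) * (B \<bullet> B) + (v \<bullet> B)\<^sup>2) / 2"
  proof -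
    have "(norm B)\<^sup>2 / (lorentz v)\<^sup>2 = (1 - v \<bullet> v) * (B \<bullet> B)"
      using arg_cong[OF lorentz_facts(1)[OF v], of "\<lambda>t. (norm B)\<^sup>2 * t"] by (simp add: power2_norm_eq_inner mult.commute)
    then show ?thesis unfolding ptot_def by simp
  qed
  have U': "U = (d, (X + B \<bullet> B) *\<^sub>R v - (v \<bullet> B) *\<^sub>R B, B, X - (p + ((1 - v \<bullet> v) * (B \<bullet> B) + (v \<bullet> B)\<^sup>2) / 2) + B \<bullet> B)"
    unfolding U cons_def pt X_def d_def by (simp add: power2_norm_eq_inner)
  have F: "prim_flux k p v U = (d * (k \<bullet> v),
      (k \<bullet> v) *\<^sub>R ((X + B \<bullet> B) *\<^sub>R v - (v \<bullet> B) *\<^sub>R B) - (k \<bullet> B) *\<^sub>R ((1 - v \<bullet> v) *\<^sub>R B + (v \<bullet> B) *\<^sub>R v) + (p + ((1 - v \<bullet> v) * (B \<bullet> B) + (v \<bullet> B)\<^sup>2) / 2) *\<^sub>R k,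
      (k \<bullet> v) *\<^sub>R B - (k \<bullet> B) *\<^sub>R v,
      k \<bullet> ((X + B \<bullet> B) *\<^sub>R v - (v \<bullet> B) *\<^sub>R B))"
    unfolding U' prim_flux_def lorentz_facts(1)[OF v] pt[symmetric] by (simp add: power2_norm_eq_inner)
  have fl: "fluid_contraction k (\<rho> * H p \<rho>) \<rho> p v w = X * (1 + k \<bullet> v) * (1 - v \<bullet> w) - p * (1 + k \<bullet> w) - d * s * (1 + k \<bullet> v)"
    unfolding fluid_contraction_def X_def d_def s_def by simp
  have vi: "dual_vec w C = (- s, - w, - ((1 - w \<bullet> w) *\<^sub>R C + (w \<bullet> C) *\<^sub>R w), 1)"
    unfolding dual_vec_def s_def by (simp add: power2_norm_eq_inner)
  define e where "e = w \<times> C - v \<times> B"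
  define h where "h = B - C"
  have ee: "e \<bullet> e = ((w \<bullet> w) * (C \<bullet> C) - (w \<bullet> C)\<^sup>2) - 2 * ((w \<bullet> v) * (C \<bullet> B) - (w \<bullet> B) * (v \<bullet> C))
      + ((v \<bullet> v) * (B \<bullet> B) - (v \<bullet> B)\<^sup>2)"
    unfolding e_def by (simp add: inner_diff_left inner_diff_right dot_cross) (simp add: inner_commute algebra_simps power2_eq_square)
  have hh: "h \<bullet> h = B \<bullet> B - 2 * (C \<bullet> B) + C \<bullet> C"
    unfolding h_def by (simp add: inner_diff_left inner_diff_right inner_commute)
  have eh: "e \<times> h = (w \<bullet> h) *\<^sub>R C - (C \<bullet> h) *\<^sub>R w - (v \<bullet> h) *\<^sub>R B + (B \<bullet> h) *\<^sub>R v"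
    unfolding e_def by (simp add: vec_eq_iff forall_3 cross3_def vector_3 inner_vec_def sum_3) (simp add: algebra_simps)
  have tt: "(e \<bullet> k) * (e \<bullet> w) =
     ((v \<times> B) \<bullet> k) * ((v \<times> B) \<bullet> w) - ((w \<times> C) \<bullet> k) * ((v \<times> B) \<bullet> w)"
    unfolding e_def using dot_cross_self[of w C] by (simp add: inner_diff_left left_diff_distrib)
  have c: "v \<bullet> w = w \<bullet> v" "B \<bullet> v = v \<bullet> B" "C \<bullet> v = v \<bullet> C" "B \<bullet> w = w \<bullet> B" "C \<bullet> w = w \<bullet> C"
    "v \<bullet> k = k \<bullet> v" "w \<bullet> k = k \<bullet> w" "B \<bullet> k = k \<bullet> B" "C \<bullet> k = k \<bullet> C" "C \<bullet> B = B \<bullet> C"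
    by (simp_all add: inner_commute)
  show ?thesis
    unfolding F unfolding fl vi pmag_def U' em_contraction_def e_def[symmetric] h_def[symmetric] ee hh eh tt triple_mult power2_norm_eq_inner
    unfolding h_def
    apply (simp only: add_Pair inner_Pair inner_diff_left inner_diff_right inner_add_left inner_add_right
       inner_scaleR_left inner_scaleR_right inner_minus_left inner_minus_right c inner_real_def)
    apply (simp only: power2_eq_square)
    by (simp add: field_simps)
qed

text \<open>The hypothesis on \<open>h\<close> gives
  \<open>\<rho>\<^sup>2 \<le> h * (h - 2 * p)\<close>, so the quadratic form h a^2 - 2 \<rho> a c +
  (h - 2 p) c^2 has nonnegative determinant.\<close>

lemma weighted_sum_bound:
  fixes \<rho> p h a c :: real
  assumes "\<rho> > 0" "p > 0" "h \<ge> sqrt (\<rho>\<^sup>2 + p\<^sup>2) + p" "c > 0"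
  shows "\<rho> * a + p * c \<le> h * (a\<^sup>2 + c\<^sup>2) / (2 * c)"
proof -
  have "h > p" using assms by (smt (verit) real_sqrt_gt_zero zero_less_power)
  have "\<rho>\<^sup>2 + p\<^sup>2 \<le> (h - p)\<^sup>2"
    using assms by (smt (verit) real_le_lsqrt real_sqrt_le_iff real_sqrt_unique \<open>h > p\<close>)
  then have 1: "\<rho>\<^sup>2 \<le> h * (h - 2 * p)" by (simp add: power2_eq_square algebra_simps)
  have "0 \<le> (h * a - \<rho> * c)\<^sup>2 + (h * (h - 2 * p) - \<rho>\<^sup>2) * c\<^sup>2"
    using 1 by simp
  also have "\<dots> = h * (h * (a\<^sup>2 + c\<^sup>2) - 2 * c * (\<rho> * a + p * c))"
    by (simp add: power2_eq_square algebra_simps)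
  finally have "0 \<le> h * (a\<^sup>2 + c\<^sup>2) - 2 * c * (\<rho> * a + p * c)"
    using \<open>h > p\<close> assms(2) by (simp add: zero_le_mult_iff)
  then show ?thesis using assms(4) by (simp add: field_simps)
qed

lemma one_plus_inner_pos:
  fixes k w :: "'a::real_inner"
  assumes "norm k \<le> 1" "norm w < 1"
  shows "1 + k \<bullet> w > 0"
proof -
  have "\<bar>k \<bullet> w\<bar> \<le> norm k * norm w" by (rule Cauchy_Schwarz_ineq2)
  also have "\<dots> \<le> norm w" using assms(1) by (simp add: mult_left_le_one_le)
  finally show ?thesis using assms(2) by linarith
qed

text \<open>Apply \<open>weighted_sum_bound\<close> to W A s and C, with W the Lorentz factor of
  \<open>v\<close> and s = sqrt (1 - |w|^2). What remains is the Minkowski square of C (1, v) - A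
  (1, w). Pairing this vector with (1, k) gives 0, so its square is nonnegative for |k| \<le> 1; at
  \<open>k = 0\<close> it is |v - w|^2.\<close>

lemma fluid_lower:
  assumes r: "\<rho> > 0" "p > 0" "h \<ge> sqrt (\<rho>\<^sup>2 + p\<^sup>2) + p"
    and v: "norm v < 1" and w: "norm w < 1" and k: "norm k \<le> 1"
  defines "A \<equiv> 1 + k \<bullet> v" and "C \<equiv> 1 + k \<bullet> w"
  shows "h * (lorentz v)\<^sup>2 / (2 * C) * ((norm (C *\<^sub>R v - A *\<^sub>R w))\<^sup>2 - (A - C)\<^sup>2) \<le> fluid_contraction k h \<rho> p v w"
proof -
  define s where "s = sqrt (1 - (norm w)\<^sup>2)"
  define W where "W = lorentz v"
  have C: "C > 0" unfolding C_def by (rule one_plus_inner_pos[OF k w])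
  have s2: "s\<^sup>2 = 1 - w \<bullet> w" unfolding s_def using lorentz_facts(4)[OF w] by (simp add: power2_norm_eq_inner)
  have W2: "W\<^sup>2 * (1 - v \<bullet> v) = 1" unfolding W_def using lorentz_facts(3)[OF v] by (simp add: power2_norm_eq_inner)
  have "\<rho> * (W * A * s) + p * C \<le> h * ((W * A * s)\<^sup>2 + C\<^sup>2) / (2 * C)"
    by (rule weighted_sum_bound[OF r C])
  moreover have "fluid_contraction k h \<rho> p v w = h * W\<^sup>2 * A * (1 - v \<bullet> w) - (\<rho> * (W * A * s) + p * C)"
    unfolding fluid_contraction_def A_def C_def W_def s_def by simp
  moreover have "h * W\<^sup>2 / (2 * C) * ((norm (C *\<^sub>R v - A *\<^sub>R w))\<^sup>2 - (A - C)\<^sup>2)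
     = h * W\<^sup>2 * A * (1 - v \<bullet> w) - h * ((W * A * s)\<^sup>2 + C\<^sup>2) / (2 * C)"
  proof -
    have "h * W\<^sup>2 * ((norm (C *\<^sub>R v - A *\<^sub>R w))\<^sup>2 - (A - C)\<^sup>2)
      = h * W\<^sup>2 * (2 * A * C * (1 - v \<bullet> w) - A\<^sup>2 * (1 - w \<bullet> w) - C\<^sup>2 * (1 - v \<bullet> v))"
      unfolding power2_norm_eq_inner
      by (simp add: inner_diff_left inner_diff_right inner_commute power2_eq_square algebra_simps)
    also have "\<dots> = h * W\<^sup>2 * (2 * A * C * (1 - v \<bullet> w) - A\<^sup>2 * s\<^sup>2) - h * C\<^sup>2 * (W\<^sup>2 * (1 - v \<bullet> v))"
      unfolding s2 by (simp add: algebra_simps)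
    also have "\<dots> = 2 * C * (h * W\<^sup>2 * A * (1 - v \<bullet> w)) - h * ((W * A * s)\<^sup>2 + C\<^sup>2)"
      unfolding W2 by (simp add: power_mult_distrib algebra_simps)
    finally show ?thesis using C by (simp add: field_simps)
  qed
  ultimately show ?thesis unfolding W_def by linarith
qed

lemma fluid_nonneg:
  assumes r: "\<rho> > 0" "p > 0" "h \<ge> sqrt (\<rho>\<^sup>2 + p\<^sup>2) + p"
    and v: "norm v < 1" and w: "norm w < 1" and k: "norm k \<le> 1"
  shows "0 \<le> fluid_contraction k h \<rho> p v w"
proof -
  define A where "A = 1 + k \<bullet> v"
  define C where "C = 1 + k \<bullet> w"
  have h: "h > 0" using r by (smt (verit) real_sqrt_ge_zero zero_le_power2)
  have C: "C > 0" unfolding C_def by (rule one_plus_inner_pos[OF k w])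
  have "A - C = k \<bullet> (C *\<^sub>R v - A *\<^sub>R w)"
    unfolding A_def C_def by (simp add: inner_diff_right algebra_simps)
  then have "\<bar>A - C\<bar> \<le> norm k * norm (C *\<^sub>R v - A *\<^sub>R w)"
    using Cauchy_Schwarz_ineq2 by metis
  also have "\<dots> \<le> norm (C *\<^sub>R v - A *\<^sub>R w)" using k by (simp add: mult_left_le_one_le)
  finally have "(A - C)\<^sup>2 \<le> (norm (C *\<^sub>R v - A *\<^sub>R w))\<^sup>2"
    using abs_le_square_iff[of "A - C" "norm (C *\<^sub>R v - A *\<^sub>R w)"] by simp
  then have "0 \<le> h * (lorentz v)\<^sup>2 / (2 * C) * ((norm (C *\<^sub>R v - A *\<^sub>R w))\<^sup>2 - (A - C)\<^sup>2)"
    using h C by simp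
  then show ?thesis using fluid_lower[OF r v w k] unfolding A_def C_def by linarith
qed

lemma em_contraction_nonneg:
  assumes k: "norm k = 1" and v: "norm v < 1"
  shows "0 \<le> em_contraction k v e h"
proof -
  have kk: "k \<bullet> k = 1" using k by (simp add: dot_square_norm)
  have pos: "1 + k \<bullet> v > 0" using one_plus_inner_pos[of k v] k v by simp
  have "1 - v \<bullet> v \<ge> 0" using lorentz_facts(4)[OF v] by (simp add: power2_norm_eq_inner)
  then have "0 \<le> 2 * (1 + k \<bullet> v) * em_contraction k v e h" unfolding em_contraction_sum_of_squares[OF kk] by simp
  then show ?thesis using pos by (simp add: zero_le_mult_iff)
qed

lemma eos_bound:
  assumes "equation_of_state H" "\<rho> > 0" "p > 0"
  shows "sqrt (\<rho>\<^sup>2 + p\<^sup>2) + p \<le> \<rho> * H p \<rho>"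
proof -
  have "\<rho> * (sqrt (1 + p\<^sup>2 / \<rho>\<^sup>2) + p / \<rho>) \<le> \<rho> * H p \<rho>"
    using assms unfolding equation_of_state_def by (intro mult_left_mono) auto
  moreover have "\<rho> * sqrt (1 + p\<^sup>2 / \<rho>\<^sup>2) = sqrt (\<rho>\<^sup>2 + p\<^sup>2)"
  proof -
    have "\<rho> * sqrt (1 + p\<^sup>2 / \<rho>\<^sup>2) = sqrt (\<rho>\<^sup>2) * sqrt (1 + p\<^sup>2 / \<rho>\<^sup>2)" using assms by simp
    also have "\<dots> = sqrt (\<rho>\<^sup>2 + p\<^sup>2)" using assms by (simp only: real_sqrt_mult[symmetric]) (simp add: field_simps)
    finally show ?thesis .
  qed
  ultimately show ?thesis using assms by (simp add: algebra_simps)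
qed

lemma is_primD:
  assumes "is_prim H U (\<rho>, p, v)"
  shows "\<rho> > 0" "p > 0" "H p \<rho> - 1 - p / \<rho> > 0" "norm v < 1" "U = cons H \<rho> p v (Bc U)"
  using assms by (auto simp: is_prim_def)

section \<open>The affine forms on admissible states, and the source term\<close>

definition lin_form :: "real^3 \<Rightarrow> real^3 \<Rightarrow> state \<Rightarrow> real" where
  "lin_form w C U = U \<bullet> dual_vec w C + pmag w C"

lemma flux_inequality:
  assumes eos: "equation_of_state H" and U: "is_prim H U (\<rho>, p, v)"
    and k: "norm k = 1" and w: "norm w < 1"
  shows "0 \<le> (U + prim_flux k p v U) \<bullet> dual_vec w C + pmag w C * (1 + k \<bullet> w) - (k \<bullet> Bc U) * (w \<bullet> C)"
  using flux_decomposition[OF is_primD(4,5)[OF U]] em_contraction_nonneg[OF k w]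
    fluid_nonneg[OF is_primD(1,2)[OF U] eos_bound[OF eos is_primD(1,2)[OF U]] is_primD(4)[OF U] w] k
  by (metis add_nonneg_nonneg order_refl)

lemma lin_form_decomposition:
  assumes "is_prim H U (\<rho>, p, v)"
  shows "lin_form w C U = fluid_contraction 0 (\<rho> * H p \<rho>) \<rho> p v w + em_contraction 0 w (w \<times> C - v \<times> Bc U) (Bc U - C)"
  using flux_decomposition[OF is_primD(4,5)[OF assms], of 0 w C]
  by (simp add: lin_form_def prim_flux_def zero_prod_def[symmetric])

text \<open>Both squares left over at \<open>k = 0\<close> are kept, because their bases are the two
  factors in \<open>source_identity\<close>. The factor W^2 \<ge> 1 of the fluid square is
  dropped.\<close>

lemma lin_form_lower:
  assumes eos: "equation_of_state H" and U: "is_prim H U (\<rho>, p, v)" and w: "norm w < 1"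
  shows "(\<rho> * H p \<rho> * (norm (v - w))\<^sup>2 + (norm (Bc U - C - w \<times> (w \<times> C - v \<times> Bc U)))\<^sup>2) / 2 \<le> lin_form w C U"
proof -
  note P = is_primD[OF U]
  note b = eos_bound[OF eos P(1,2)]
  have h: "\<rho> * H p \<rho> > 0" using b P(1,2) by (smt (verit) real_sqrt_ge_zero zero_le_power2)
  have "1 \<le> (lorentz v)\<^sup>2"
    using lorentz_facts(3,4)[OF P(4)] by (smt (verit, best) mult_left_less_imp_less mult_less_cancel_left2 zero_le_power2 mult_right_le_one_le)
  then have "\<rho> * H p \<rho> * (norm (v - w))\<^sup>2 / 2 \<le> \<rho> * H p \<rho> * (lorentz v)\<^sup>2 * (norm (v - w))\<^sup>2 / 2"
    using h mult_right_mono[of "\<rho> * H p \<rho> * 1" "\<rho> * H p \<rho> * (lorentz v)\<^sup>2" "(norm (v - w))\<^sup>2"] mult_left_mono[of 1 "(lorentz v)\<^sup>2" "\<rho> * H p \<rho>"]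
    by simp
  also have "\<dots> \<le> fluid_contraction 0 (\<rho> * H p \<rho>) \<rho> p v w"
    using fluid_lower[OF P(1,2) b P(4) w, of 0] by simp
  finally show ?thesis using em_contraction_rest[of w "Bc U - C" "w \<times> C - v \<times> Bc U"] w
    unfolding lin_form_decomposition[OF U] by simp
qed

lemma lin_form_pos:
  assumes eos: "equation_of_state H" and U: "is_prim H U (\<rho>, p, v)" and w: "norm w < 1"
  shows "0 < lin_form w C U"
proof (cases "v = w")
  case False
  have "\<rho> * H p \<rho> > 0" using eos_bound[OF eos is_primD(1,2)[OF U]] is_primD(1,2)[OF U]
    by (smt (verit) real_sqrt_ge_zero zero_le_power2)
  then have "\<rho> * H p \<rho> * (norm (v - w))\<^sup>2 > 0" using False by simp
  then show ?thesis using lin_form_lower[OF eos U w, of C]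
    by (smt (verit) zero_le_power2 divide_pos_pos)
next
  case True
  note P = is_primD[OF U]
  \<comment> \<open>At \<open>v = w\<close> the fluid square gives nothing; the fluid part is then
    exactly \<open>\<rho>\<close> times the internal energy.\<close>
  have "fluid_contraction 0 (\<rho> * H p \<rho>) \<rho> p v w = \<rho> * H p \<rho> * ((lorentz v)\<^sup>2 * (1 - (norm v)\<^sup>2)) - p - \<rho> * (lorentz v * sqrt (1 - (norm v)\<^sup>2))"
    unfolding fluid_contraction_def True[symmetric] by (simp add: power2_norm_eq_inner)
  also have "\<dots> = \<rho> * (H p \<rho> - 1 - p / \<rho>)"
    unfolding lorentz_facts(3,5)[OF P(4)] using P(1) by (simp add: field_simps)
  finally have "fluid_contraction 0 (\<rho> * H p \<rho>) \<rho> p v w > 0" using P(1,3) by simp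
  then show ?thesis
    unfolding lin_form_decomposition[OF U] using em_contraction_rest[of w "Bc U - C" "w \<times> C - v \<times> Bc U"] w
    by (smt (verit) zero_le_power2 divide_nonneg_pos)
qed

definition prim_source :: "real^3 \<Rightarrow> state \<Rightarrow> state" where
  "prim_source v U = (0, (1 - (norm v)\<^sup>2) *\<^sub>R Bc U + (v \<bullet> Bc U) *\<^sub>R v, v, v \<bullet> Bc U)"

text \<open>Adding w . C makes the expression vanish at \<open>v = w\<close>; the second factor is
  the field combination squared in \<open>lin_form_lower\<close>.\<close>

lemma source_identity:
  "prim_source v U \<bullet> dual_vec w C + w \<bullet> C = (v - w) \<bullet> (Bc U - C - w \<times> (w \<times> C - v \<times> Bc U))"
proof -
  define B where "B = Bc U"
  have c: "w \<times> (w \<times> C - v \<times> B) = (w \<bullet> C) *\<^sub>R w - (w \<bullet> w) *\<^sub>R C - (w \<bullet> B) *\<^sub>R v + (w \<bullet> v) *\<^sub>R B"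
    by (simp add: vec_eq_iff forall_3 cross3_def vector_3 inner_vec_def sum_3) (simp add: algebra_simps)
  have "prim_source v U = (0, (1 - v \<bullet> v) *\<^sub>R B + (v \<bullet> B) *\<^sub>R v, v, v \<bullet> B)"
    unfolding prim_source_def B_def by (simp add: power2_norm_eq_inner)
  then show ?thesis
    unfolding dual_vec_def B_def[symmetric] c
    by (simp add: inner_diff_left inner_diff_right inner_add_left inner_add_right power2_norm_eq_inner) (simp add: inner_commute algebra_simps)
qed

text \<open>Cauchy-Schwarz in \<open>source_identity\<close>, then h x y \<le> (h^2 x^2 + y^2) / 2
  with h^2 = \<rho> H. Balancing the two squares of \<open>lin_form_lower\<close> is what puts sqrt
  (\<rho> H) into \<open>jump_sigma\<close>.\<close>

lemma source_inequality:
  assumes eos: "equation_of_state H" and U: "is_prim H U (\<rho>, p, v)" and w: "norm w < 1"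
  shows "\<bar>prim_source v U \<bullet> dual_vec w C + w \<bullet> C\<bar> \<le> lin_form w C U / sqrt (\<rho> * H p \<rho>)"
proof -
  define x where "x = norm (v - w)"
  define y where "y = norm (Bc U - C - w \<times> (w \<times> C - v \<times> Bc U))"
  define h where "h = sqrt (\<rho> * H p \<rho>)"
  have pos: "\<rho> * H p \<rho> > 0" using eos_bound[OF eos is_primD(1,2)[OF U]] is_primD(1,2)[OF U]
    by (smt (verit) real_sqrt_ge_zero zero_le_power2)
  then have h: "h > 0" "h\<^sup>2 = \<rho> * H p \<rho>" unfolding h_def by auto
  have "\<bar>prim_source v U \<bullet> dual_vec w C + w \<bullet> C\<bar> \<le> x * y"
    unfolding source_identity x_def y_def by (rule Cauchy_Schwarz_ineq2)
  moreover have "h * (x * y) \<le> lin_form w C U"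
  proof -
    have "0 \<le> (h * x - y)\<^sup>2" by simp
    then have "h * (x * y) \<le> (h\<^sup>2 * x\<^sup>2 + y\<^sup>2) / 2" by (simp add: power2_eq_square algebra_simps)
    then show ?thesis using lin_form_lower[OF eos U w, of C] unfolding h(2) x_def y_def by linarith
  qed
  ultimately show ?thesis using h unfolding h_def[symmetric]
    by (smt (verit, best) mult.commute pos_le_divide_eq)
qed

section \<open>Affine description of the admissible set\<close>

unbundle no cross3_syntax

text \<open>In \<open>C\<close> the form is a convex quadratic; its minimum is at
  \<open>C = B\<close>.\<close>

lemma lin_form_ge_at_field:
  assumes w: "norm w < 1"
  shows "E - D * sqrt (1 - (norm w)\<^sup>2) - m \<bullet> w - ((1 - w \<bullet> w) * (B \<bullet> B) + (w \<bullet> B)\<^sup>2) / 2 \<le> lin_form w C (D, m, B, E)"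
proof -
  have "0 \<le> ((1 - w \<bullet> w) * ((C - B) \<bullet> (C - B)) + (w \<bullet> (C - B))\<^sup>2) / 2"
    using lorentz_facts(4)[OF w] by (simp add: power2_norm_eq_inner)
  then show ?thesis
    unfolding lin_form_def dual_vec_def pmag_def power2_norm_eq_inner
    by (simp add: inner_diff_left inner_diff_right inner_add_right inner_commute power2_eq_square field_simps)
qed

text \<open>
  Weak duality: bounding \<open>D * s\<close> by AM-GM with a parameter \<open>\<mu>\<close> turns the left-hand side into a concave
  quadratic in \<open>w\<close>, and the right-hand side is its maximum. That this maximum is at most \<open>E\<close> is a cubic
  inequality in \<open>\<mu>\<close>; \<open>Psi U \<ge> 0\<close> says that it holds at the local minimum of the cubic.
\<close>

lemma energy_duality:
  fixes m B w :: "'a::real_inner"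
  assumes mu: "\<mu> > 0" and s: "s\<^sup>2 = 1 - w \<bullet> w"
  shows "D * s + m \<bullet> w + ((1 - w \<bullet> w) * (B \<bullet> B) + (w \<bullet> B)\<^sup>2) / 2
     \<le> (D\<^sup>2 / \<mu> + \<mu> + B \<bullet> B + (m \<bullet> m + (m \<bullet> B)\<^sup>2 / \<mu>) / (\<mu> + B \<bullet> B)) / 2"
proof -
  define N where "N = \<mu> + B \<bullet> B"
  define g where "g = m \<bullet> B"
  \<comment> \<open>The maximizer in \<open>w\<close>: the gradient of the concave quadratic
    vanishes when N w - (w . B) B = m, and pairing this with \<open>B\<close> gives w . B = g /
    \<mu>.\<close>
  define u where "u = (1 / N) *\<^sub>R (m + (g / \<mu>) *\<^sub>R B)"
  have N: "N > 0" unfolding N_def using mu by (simp add: add_pos_nonneg)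
  have Bu: "B \<bullet> u = g / \<mu>"
    unfolding u_def using N mu
    by (simp add: inner_add_right inner_commute[of B m] g_def[symmetric] field_simps) (simp add: N_def algebra_simps)
  have Nu: "N * (x \<bullet> u) = x \<bullet> m + (g / \<mu>) * (x \<bullet> B)" for x
    unfolding u_def using N by (simp add: inner_add_right)
  have mu_u: "m \<bullet> u = (m \<bullet> m + g\<^sup>2 / \<mu>) / N"
    unfolding u_def using N by (simp add: inner_add_right g_def[symmetric] power2_eq_square)
  have "0 \<le> (D - \<mu> * s)\<^sup>2 / \<mu>" using mu by simp
  then have 1: "D * s \<le> (D\<^sup>2 / \<mu> + \<mu> * (1 - w \<bullet> w)) / 2"
    using mu unfolding s[symmetric] by (simp add: power2_eq_square field_simps)
  have "(B \<bullet> (w - u))\<^sup>2 \<le> (B \<bullet> B) * ((w - u) \<bullet> (w - u))" by (rule Cauchy_Schwarz_ineq)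
  also have "\<dots> \<le> N * ((w - u) \<bullet> (w - u))" using mu by (intro mult_right_mono) (auto simp: N_def)
  finally have "(B \<bullet> w - g / \<mu>)\<^sup>2 \<le> N * (w \<bullet> w) - 2 * (N * (w \<bullet> u)) + N * (u \<bullet> u)"
    by (simp add: inner_diff_left inner_diff_right Bu inner_commute algebra_simps)
  also have "\<dots> = N * (w \<bullet> w) - 2 * (w \<bullet> m + (g / \<mu>) * (w \<bullet> B)) + (u \<bullet> m + (g / \<mu>) * (g / \<mu>))"
    unfolding Nu using Bu by (simp add: inner_commute)
  finally have "2 * (m \<bullet> w) \<le> N * (w \<bullet> w) - (w \<bullet> B)\<^sup>2 + m \<bullet> u"
    by (simp add: inner_commute power2_eq_square algebra_simps)
  then have 2: "2 * (m \<bullet> w) \<le> \<mu> * (w \<bullet> w) + (B \<bullet> B) * (w \<bullet> w) - (w \<bullet> B)\<^sup>2 + m \<bullet> u"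
    by (simp add: N_def algebra_simps)
  have "D * s + m \<bullet> w + ((1 - w \<bullet> w) * (B \<bullet> B) + (w \<bullet> B)\<^sup>2) / 2 \<le> (D\<^sup>2 / \<mu> + \<mu> + B \<bullet> B + m \<bullet> u) / 2"
    using 1 2 by (simp add: field_simps)
  then show ?thesis unfolding mu_u g_def N_def .
qed

text \<open>The derivative of the cubic is 3 \<mu>^2 + 4 a \<mu> + c and
  \<open>\<Phi>\<^sup>2\<close> is a quarter of its discriminant, so \<open>\<mu>\<close> is a
  critical point. The value there contains the square of the first product in
  \<open>Psi\<close>.\<close>

lemma cubic_at_critical_point:
  fixes a \<Phi> c T :: real
  assumes c: "3 * c = 4 * a\<^sup>2 - \<Phi>\<^sup>2" and mu: "\<mu> = (\<Phi> - 2 * a) / 3"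
  shows "\<mu>^3 + 2 * a * \<mu>\<^sup>2 + c * \<mu> + T = T - 2 / 27 * ((\<Phi> - 2 * a)\<^sup>2 * (\<Phi> + a))"
proof -
  have c': "c = (4 * a\<^sup>2 - \<Phi>\<^sup>2) / 3" using c by simp
  show ?thesis unfolding mu c' by (simp add: power2_eq_square power3_eq_cube field_simps)
qed

lemma lin_form_nonneg_of_Psi:
  assumes D: "Dc U > 0" and q: "qf U \<ge> 0" and Psi: "Psi U \<ge> 0" and w: "norm w < 1"
  shows "0 \<le> lin_form w C U"
proof -
  obtain D m B E where U: "U = (D, m, B, E)" by (cases U) auto
  define b where "b = B \<bullet> B"
  define a where "a = b - E"
  define \<Phi> where "\<Phi> = Phi U"
  define T where "T = D\<^sup>2 * b + (m \<bullet> B)\<^sup>2"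
  define \<mu> where "\<mu> = (\<Phi> - 2 * a) / 3"
  have D0: "D > 0" using D U by simp
  have E: "sqrt (D\<^sup>2 + m \<bullet> m) \<le> E" using q unfolding U qf_def by (simp add: power2_norm_eq_inner)
  have "D\<^sup>2 + m \<bullet> m > 0" using D0 by (simp add: add_pos_nonneg)
  then have Epos: "E > 0" using E by (meson less_le_trans real_sqrt_gt_zero)
  have E2: "D\<^sup>2 + m \<bullet> m \<le> E\<^sup>2" using E Epos by (simp add: real_le_lsqrt sqrt_le_D)
  have Phi2: "\<Phi>\<^sup>2 = a\<^sup>2 + 3 * (E\<^sup>2 - D\<^sup>2 - m \<bullet> m)" and Phi_ge: "\<Phi> \<ge> \<bar>a\<bar>"
  proof -
    have *: "\<Phi> = sqrt (a\<^sup>2 + 3 * (E\<^sup>2 - D\<^sup>2 - m \<bullet> m))"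
      unfolding \<Phi>_def Phi_def U a_def b_def by (simp add: power2_norm_eq_inner)
    show "\<Phi>\<^sup>2 = a\<^sup>2 + 3 * (E\<^sup>2 - D\<^sup>2 - m \<bullet> m)" unfolding * using E2 by simp
    show "\<Phi> \<ge> \<bar>a\<bar>" unfolding * using E2 by (intro real_le_rsqrt) auto
  qed
  have P: "sqrt (27 / 2 * T) \<le> (\<Phi> - 2 * a) * sqrt (\<Phi> + a)"
    using Psi unfolding Psi_def \<Phi>_def[symmetric] unfolding U T_def a_def b_def
    by (simp add: power2_norm_eq_inner algebra_simps)
  \<comment> \<open>The left factor is the linear coefficient of the cubic that arises when the dual
    bound is multiplied by \<mu> (\<mu> + b).\<close>
  have crit: "3 * (b\<^sup>2 - 2 * E * b + D\<^sup>2 + m \<bullet> m) = 4 * a\<^sup>2 - \<Phi>\<^sup>2"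
    unfolding Phi2 a_def by (simp add: power2_eq_square algebra_simps)
  have T0: "T \<ge> 0" unfolding T_def b_def by simp
  have mu: "\<mu> > 0"
  \<comment> \<open>For \<open>B = 0\<close> the subtracted root in \<open>Psi\<close> is 0 and
    leaves the sign of \<open>\<Phi> - 2 * a\<close> open; there a = - E < 0 decides. Otherwise T >
    0 makes the product in \<open>Psi\<close> positive.\<close>
  proof (cases "B = 0")
    case True
    then show ?thesis unfolding \<mu>_def a_def b_def using Phi_ge Epos by (simp add: a_def b_def)
  next
    case False
    then have "T > 0" unfolding T_def b_def using D0 by (simp add: add_pos_nonneg)
    then have "0 < sqrt (27 / 2 * T)" by simp
    then have "0 < (\<Phi> - 2 * a) * sqrt (\<Phi> + a)" using P by linarith
    moreover have "sqrt (\<Phi> + a) \<ge> 0" using Phi_ge by simp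
    ultimately have "\<Phi> - 2 * a > 0" by (simp add: zero_less_mult_iff)
    then show ?thesis unfolding \<mu>_def by simp
  qed
  have "27 / 2 * T \<le> (\<Phi> - 2 * a)\<^sup>2 * (\<Phi> + a)"
  proof -
    have "(sqrt (27 / 2 * T))\<^sup>2 \<le> ((\<Phi> - 2 * a) * sqrt (\<Phi> + a))\<^sup>2"
      using P T0 by (intro power_mono) auto
    then show ?thesis using T0 Phi_ge by (simp add: power_mult_distrib)
  qed
  then have "\<mu>^3 + 2 * a * \<mu>\<^sup>2 + (b\<^sup>2 - 2 * E * b + D\<^sup>2 + m \<bullet> m) * \<mu> + T \<le> 0"
    using cubic_at_critical_point[OF crit \<mu>_def, of T] by linarith
  moreover have "\<mu>^3 + 2 * a * \<mu>\<^sup>2 + (b\<^sup>2 - 2 * E * b + D\<^sup>2 + m \<bullet> m) * \<mu> + T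
      = (\<mu> * (\<mu> + b)) * ((D\<^sup>2 / \<mu> + \<mu> + b + (m \<bullet> m + (m \<bullet> B)\<^sup>2 / \<mu>) / (\<mu> + b)) - 2 * E)"
  proof -
    have b: "\<mu> + b > 0" unfolding b_def using mu by (simp add: add_pos_nonneg)
    define Z where "Z = (m \<bullet> m + (m \<bullet> B)\<^sup>2 / \<mu>) / (\<mu> + b)"
    define Y where "Y = D\<^sup>2 / \<mu>"
    have "(\<mu> + b) * Z = m \<bullet> m + (m \<bullet> B)\<^sup>2 / \<mu>" unfolding Z_def using b by simp
    then have Z: "\<mu> * (\<mu> + b) * Z = \<mu> * (m \<bullet> m) + (m \<bullet> B)\<^sup>2"
      using mu by (simp only: mult.assoc) (simp add: distrib_left)
    have Y: "\<mu> * Y = D\<^sup>2" unfolding Y_def using mu by simp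
    have "\<mu> * (\<mu> + b) * (Y + \<mu> + b + Z - 2 * E) = (\<mu> + b) * (\<mu> * Y) + \<mu> * (\<mu> + b) * Z + \<mu> * (\<mu> + b) * (\<mu> + b - 2 * E)"
      by (simp add: algebra_simps)
    then show ?thesis unfolding Z Y unfolding Z_def[symmetric] Y_def[symmetric] T_def a_def
      by (simp add: power2_eq_square power3_eq_cube algebra_simps)
  qed
  moreover have "\<mu> * (\<mu> + b) > 0" unfolding b_def using mu by (simp add: add_pos_nonneg)
  ultimately have R: "(D\<^sup>2 / \<mu> + \<mu> + b + (m \<bullet> m + (m \<bullet> B)\<^sup>2 / \<mu>) / (\<mu> + b)) \<le> 2 * E"
    by (metis diff_le_0_iff_le mult_le_0_iff not_le)
  have aux: "x \<le> 2 * E \<Longrightarrow> r + s + t \<le> x / 2 \<Longrightarrow> E - r - s - t \<le> L \<Longrightarrow> 0 \<le> L" for x r s t L :: real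
    by linarith
  have s: "(sqrt (1 - (norm w)\<^sup>2))\<^sup>2 = 1 - w \<bullet> w"
    using lorentz_facts(4)[OF w] by (simp add: power2_norm_eq_inner)
  show ?thesis using R energy_duality[OF mu s, of D m B] lin_form_ge_at_field[OF w, of E D m B C]
    unfolding U b_def by (rule aux)
qed

section \<open>Recovering the primitive variables from the affine inequalities\<close>

lemma last_nonpos:
  fixes P :: "real \<Rightarrow> real"
  assumes "continuous_on {a..b} P" "P a \<le> 0" "P b > 0" "a \<le> b"
  obtains c where "a \<le> c" "c < b" "P c = 0" "\<And>x. c < x \<Longrightarrow> x \<le> b \<Longrightarrow> P x > 0"
proof -
  define S where "S = {a..b} \<inter> P -` {..0}"
  have "compact S" unfolding S_def
    using continuous_on_closed_vimage[of "{a..b}" P] assms(1)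
    by (metis closed_atMost closed_real_atLeastAtMost compact_Icc compact_Int_closed inf_commute inf_le1 compact_eq_bounded_closed bounded_subset)
  moreover have "a \<in> S" unfolding S_def using assms by auto
  ultimately obtain c where c: "c \<in> S" "\<And>x. x \<in> S \<Longrightarrow> x \<le> c"
    using compact_attains_sup[of S] by auto
  have pos: "P x > 0" if "c < x" "x \<le> b" for x
    using c(1) c(2)[of x] that unfolding S_def by (cases "P x > 0") auto
  have "P c = 0"
  proof (rule ccontr)
    assume "P c \<noteq> 0"
    then have "P c < 0" using c(1) unfolding S_def by auto
    moreover have "continuous_on {c..b} P" using assms(1) c(1) unfolding S_def
      by (auto intro: continuous_on_subset)
    ultimately obtain x where "c \<le> x" "x \<le> b" "P x = 0"
      using IVT'[of P c 0 b] assms(3) c(1) unfolding S_def by auto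
    then show False using pos[of x] \<open>P c \<noteq> 0\<close> by (cases "c = x") auto
  qed
  moreover have "c \<noteq> b" using \<open>P c = 0\<close> assms(3) by auto
  ultimately show ?thesis using c(1) pos that unfolding S_def by auto
qed

text \<open>The vanishing-energy limit is stated at a fixed density, whereas the density D s below
  moves with the unknown; monotonicity passes from one to the other.\<close>

lemma eos_antimono:
  assumes eos: "equation_of_state H" and "p > 0" "0 < r" "r \<le> r'"
  shows "H p r' \<le> H p r"
proof (rule DERIV_nonpos_imp_nonincreasing[OF assms(4)])
  fix x assume x: "r \<le> x" "x \<le> r'"
  then have "x > 0" using assms by auto
  then have d: "(\<lambda>(p, \<rho>). H p \<rho>) differentiable (at (p, x))" and n: "deriv (\<lambda>\<rho>. H p \<rho>) x < 0"
    using eos assms unfolding equation_of_state_def by auto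
  have "((\<lambda>(p, \<rho>). H p \<rho>) \<circ> (\<lambda>\<rho>. (p, \<rho>))) differentiable (at x)"
    by (rule differentiable_chain_at) (use d in \<open>auto intro!: differentiable_Pair\<close>)
  then have "(\<lambda>\<rho>. H p \<rho>) differentiable (at x)" by (simp add: o_def)
  then have "DERIV (\<lambda>\<rho>. H p \<rho>) x :> deriv (\<lambda>\<rho>. H p \<rho>) x"
    using DERIV_deriv_iff_real_differentiable by blast
  then show "\<exists>y. DERIV (\<lambda>\<rho>. H p \<rho>) x :> y \<and> y \<le> 0" using n by auto
qed

lemma eos_continuous:
  assumes eos: "equation_of_state H"
  shows "continuous_on ({0<..} \<times> {0<..}) (\<lambda>(p, \<rho>). H p \<rho>)"
  using eos unfolding equation_of_state_def
  by (intro continuous_at_imp_continuous_on ballI) (auto intro!: differentiable_imp_continuous_within)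

text \<open>
  The state is recovered from the unknown \<open>\<xi> = \<rho> H W\<^sup>2\<close>, which determines \<open>v\<close>, \<open>\<rho> = D / W\<close> and, through
  the energy, the pressure \<open>P \<xi>\<close>. The affine inequality at \<open>v\<^sup>* = v \<xi>\<close>, \<open>B\<^sup>* = B\<close> shows that \<open>P\<close> becomes
  nonpositive while \<open>|v| < 1\<close>, and that \<open>\<rho> H W\<^sup>2 < \<xi>\<close> at the last zero of \<open>P\<close>, where \<open>H\<close> tends to \<open>1\<close>.
  For large \<open>\<xi>\<close> the inequality is reversed.
\<close>

lemma admissible_of_lin_form:
  assumes eos: "equation_of_state H" and lim: "vanishing_energy_limit H"
    and D: "Dc U > 0" and lin: "\<And>w C. norm w < 1 \<Longrightarrow> lin_form w C U > 0"
  shows "U \<in> admissible H"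
proof -
  obtain D m B E where U: "U = (D, m, B, E)" by (cases U) auto
  have D0: "D > 0" using D U by simp
  define b where "b = B \<bullet> B"
  define g where "g = m \<bullet> B"
  \<comment> \<open>Solves m = (\<xi> + b) v - (v . B) B, the momentum equation with
    \<open>\<rho> H W\<^sup>2 = \<xi>\<close>.\<close>
  define v where "v \<xi> = (1 / (\<xi> + b)) *\<^sub>R (m + (g / \<xi>) *\<^sub>R B)" for \<xi>
  define P where "P \<xi> = \<xi> - E + b - ((1 - v \<xi> \<bullet> v \<xi>) * b + (v \<xi> \<bullet> B)\<^sup>2) / 2" for \<xi>
  define s where "s \<xi> = sqrt (1 - v \<xi> \<bullet> v \<xi>)" for \<xi>
  have b0: "b \<ge> 0" unfolding b_def by simp
  have vB: "v \<xi> \<bullet> B = g / \<xi>" if "\<xi> > 0" for \<xi>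
  proof -
    have "\<xi> + b > 0" using that b0 by simp
    moreover have "g + g / \<xi> * b = (\<xi> + b) * (g / \<xi>)" using that by (simp add: field_simps)
    moreover have "v \<xi> \<bullet> B = (g + g / \<xi> * b) / (\<xi> + b)"
      unfolding v_def by (simp add: inner_add_left g_def[symmetric] b_def[symmetric])
    ultimately show ?thesis by simp
  qed
  have m: "(\<xi> + b) *\<^sub>R v \<xi> - (v \<xi> \<bullet> B) *\<^sub>R B = m" if "\<xi> > 0" for \<xi>
    unfolding vB[OF that] using that b0 by (simp add: v_def)
  have mv: "m \<bullet> v \<xi> = (\<xi> + b) * (v \<xi> \<bullet> v \<xi>) - (v \<xi> \<bullet> B)\<^sup>2" if "\<xi> > 0" for \<xi>
  proof -
    have "m \<bullet> v \<xi> = ((\<xi> + b) *\<^sub>R v \<xi> - (v \<xi> \<bullet> B) *\<^sub>R B) \<bullet> v \<xi>" using m[OF that] by simp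
    then show ?thesis by (simp add: inner_diff_left inner_commute[of B] power2_eq_square)
  qed
  have lin': "P \<xi> < s \<xi> * (\<xi> * s \<xi> - D)" if "\<xi> > 0" "norm (v \<xi>) < 1" for \<xi>
  proof -
    have s2: "(s \<xi>)\<^sup>2 = 1 - v \<xi> \<bullet> v \<xi>" unfolding s_def using lorentz_facts(4)[OF that(2)] by (simp add: power2_norm_eq_inner)
    have "lin_form (v \<xi>) B U = - D * s \<xi> + \<xi> * (1 - v \<xi> \<bullet> v \<xi>) - P \<xi>"
      unfolding lin_form_def U dual_vec_def pmag_def P_def s_def
      by (simp add: mv[OF that(1)] inner_add_right inner_diff_right power2_norm_eq_inner b_def[symmetric])
        (simp add: inner_commute[of B] b_def[symmetric] power2_eq_square field_simps)
    then show ?thesis using lin[OF that(2), of B] unfolding s2[symmetric]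
      by (simp add: power2_eq_square algebra_simps)
  qed
  have cv: "continuous_on {0<..} v"
    unfolding v_def using b0 by (intro continuous_intros) auto
  have cP: "continuous_on {0<..} P"
    unfolding P_def by (intro continuous_intros cv) auto
  have cs: "continuous_on {0<..} s"
    unfolding s_def by (intro continuous_intros cv)
  have v_small: "norm (v \<xi>) < 1" if "\<xi> \<ge> 1" "\<xi> > norm m + \<bar>g\<bar> * norm B" for \<xi>
  proof -
    have "norm (m + (g / \<xi>) *\<^sub>R B) \<le> norm m + \<bar>g\<bar> / \<xi> * norm B"
      using that by (intro norm_triangle_le) (simp add: abs_divide)
    also have "\<bar>g\<bar> / \<xi> * norm B \<le> \<bar>g\<bar> * norm B"
      using that by (intro mult_right_mono) (auto simp: divide_le_eq mult_le_cancel_left1)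
    finally have "norm (m + (g / \<xi>) *\<^sub>R B) < \<xi> + b" using that b0 by linarith
    then show ?thesis unfolding v_def using that b0 by (simp add: divide_simps)
  qed
  \<comment> \<open>From \<open>M\<close> on the speed is below 1 by \<open>v_small\<close>, and M >
    |2 E| gives P M \<ge> M - E > M / 2.\<close>
  define M where "M = max 1 (max (norm m + \<bar>g\<bar> * norm B) \<bar>2 * E\<bar>) + 1"
  have M: "M > 1" "M > norm m + \<bar>g\<bar> * norm B" "M > \<bar>2 * E\<bar>" unfolding M_def by auto
  have P_ge: "P \<xi> \<ge> \<xi> - E" if "\<xi> > 0" "norm (v \<xi>) < 1" for \<xi>
  proof -
    have "(v \<xi> \<bullet> B)\<^sup>2 \<le> (v \<xi> \<bullet> v \<xi>) * b" unfolding b_def by (rule Cauchy_Schwarz_ineq)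
    then show ?thesis using b0 unfolding P_def by (simp add: algebra_simps)
  qed
  \<comment> \<open>\<open>a\<close> is 0 or the last \<xi> with |v \<xi>| = 1. The point with \<xi>
    s \<le> D will make \<open>P\<close> nonpositive: \<open>min D 1\<close> serves in the first
    case since s \<le> 1, and a point close to \<open>a\<close> in the second, since s tends to 0
    there.\<close>
  obtain a where a: "a \<ge> 0" "a < M" "\<And>\<xi>. \<xi> > a \<Longrightarrow> norm (v \<xi>) < 1" "\<exists>\<xi>>a. \<xi> * s \<xi> \<le> D \<and> \<xi> < M"
  proof (cases "\<exists>\<xi>\<in>{0<..<M}. norm (v \<xi>) \<ge> 1")
    case False
    have *: "norm (v \<xi>) < 1" if "\<xi> > 0" for \<xi>
    proof (cases "\<xi> < M")
      case True
      then show ?thesis using False that by (meson greaterThanLessThan_iff not_le)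
    next
      case False
      then show ?thesis using M v_small[of \<xi>] by auto
    qed
    have "min D 1 * s (min D 1) \<le> D"
    proof -
      have "s (min D 1) \<le> 1" unfolding s_def by simp
      then have "min D 1 * s (min D 1) \<le> min D 1 * 1" using D0 by (intro mult_left_mono) auto
      then show ?thesis by linarith
    qed
    then have "\<exists>\<xi>>0. \<xi> * s \<xi> \<le> D \<and> \<xi> < M" using D0 M(1) by (intro exI[of _ "min D 1"]) auto
    then show ?thesis using that[of 0] * M by auto
  next
    case True
    then obtain z where z: "0 < z" "z < M" "norm (v z) \<ge> 1" by auto
    have c: "continuous_on {z..M} (\<lambda>\<xi>. 1 - v \<xi> \<bullet> v \<xi>)"
      by (intro continuous_intros continuous_on_subset[OF cv]) (use z in auto)
    have nv: "(norm (v \<xi>) < 1) = (1 - v \<xi> \<bullet> v \<xi> > 0)" for \<xi>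
      by (simp add: dot_square_norm power2_eq_1_iff abs_square_less_1)
    have "norm (v M) < 1" using M v_small[of M] by auto
    then obtain a where a: "z \<le> a" "a < M" "1 - v a \<bullet> v a = 0" "\<And>x. a < x \<Longrightarrow> x \<le> M \<Longrightarrow> 1 - v x \<bullet> v x > 0"
      using last_nonpos[OF c] z nv by (metis less_imp_le not_less)
    have *: "norm (v \<xi>) < 1" if "\<xi> > a" for \<xi>
    proof (cases "\<xi> \<le> M")
      case True
      then show ?thesis using a(4)[of \<xi>] that unfolding nv by auto
    next
      case False
      then show ?thesis using M v_small[of \<xi>] by auto
    qed
    have "continuous_on {0<..} (\<lambda>\<xi>. \<xi> * s \<xi>)" by (intro continuous_intros cs)
    then have "isCont (\<lambda>\<xi>. \<xi> * s \<xi>) a" using a z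
      by (intro continuous_on_interior[of "{0<..}"]) (auto simp: interior_open)
    then have "(\<lambda>\<xi>. \<xi> * s \<xi>) \<midarrow>a\<rightarrow> a * s a" by (simp add: isCont_def)
    then have "((\<lambda>\<xi>. \<xi> * s \<xi>) \<longlongrightarrow> 0) (at_right a)"
      using a(3) tendsto_mono[OF at_le[OF subset_UNIV]] by (auto simp: s_def)
    then have "\<forall>\<^sub>F \<xi> in at_right a. \<xi> * s \<xi> < D" using D0 by (auto dest: order_tendstoD)
    moreover have "\<forall>\<^sub>F \<xi> in at_right a. \<xi> < M \<and> \<xi> > a"
      using a(2) by (auto simp: eventually_at_right_field intro: exI[of _ M])
    ultimately have "\<forall>\<^sub>F \<xi> in at_right a. \<xi> * s \<xi> < D \<and> \<xi> < M \<and> \<xi> > a" by eventually_elim auto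
    then have "\<exists>\<xi>. \<xi> * s \<xi> < D \<and> \<xi> < M \<and> \<xi> > a"
      using eventually_happens trivial_limit_at_right_real by blast
    then show ?thesis using that[of a] * a z by (meson less_imp_le order_trans less_le_trans)
  qed
  then obtain z where z: "z > a" "z * s z \<le> D" "z < M" by auto
  have "P z \<le> 0"
  proof -
    have "s z \<ge> 0" using a(3)[OF z(1)] lorentz_facts(4)[of "v z"] by (simp add: s_def power2_norm_eq_inner)
    then have "s z * (z * s z - D) \<le> 0" using z by (simp add: mult_le_0_iff)
    then show ?thesis using lin'[of z] z a(1) a(3)[of z] by linarith
  qed
  moreover have "P M > 0" using P_ge[of M] M a(2) a(3)[of M] by (simp add: abs_if split: if_splits)
  moreover have "continuous_on {z..M} P" using cP z a(1) by (auto intro: continuous_on_subset)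
  ultimately obtain c where c: "z \<le> c" "c < M" "P c = 0" "\<And>x. c < x \<Longrightarrow> x \<le> M \<Longrightarrow> P x > 0"
    using last_nonpos[of z M P] z less_imp_le[OF z(3)] by metis
  have c0: "c > 0" "c > a" using c z a by auto
  have s_pos: "s x > 0" if "x > a" for x
    using lorentz_facts(4)[OF a(3)[OF that]] by (simp add: s_def power2_norm_eq_inner)
  have c_large: "c * s c > D"
  proof -
    have "0 < s c * (c * s c - D)" using lin'[OF c0(1) a(3)[OF c0(2)]] c(3) by simp
    then show ?thesis using s_pos[OF c0(2)] by (simp add: zero_less_mult_iff)
  qed
  \<comment> \<open>With W = 1 / s and \<rho> = D s, the quantity \<rho> H W^2 is D / s * H; a zero
    of \<open>f\<close> is therefore a consistent \<xi>.\<close>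
  define f where "f \<xi> = D / s \<xi> * H (P \<xi>) (D * s \<xi>) - \<xi>" for \<xi>
  have c_at: "(h \<longlongrightarrow> h c) (at_right c)" if "continuous_on {0<..} h" for h :: "real \<Rightarrow> real"
  proof -
    have "isCont h c" using that c0
      by (intro continuous_on_interior[of "{0<..}"]) (auto simp: interior_open)
    then show ?thesis using tendsto_mono[OF at_le[OF subset_UNIV]] by (auto simp: isCont_def)
  qed
  have near: "\<forall>\<^sub>F \<xi> in at_right c. \<xi> < M \<and> \<xi> > c"
    using c(2) by (auto simp: eventually_at_right_field intro: exI[of _ M])
  \<comment> \<open>Half the density at \<open>c\<close>: just to the right of \<open>c\<close> the
    density D s stays above \<open>r\<close>, so \<open>eos_antimono\<close> bounds \<open>H\<close>
    by its value at \<open>r\<close>, which tends to 1.\<close>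
  define r where "r = D * s c / 2"
  have r: "r > 0" unfolding r_def using D0 s_pos[OF c0(2)] by simp
  have "filterlim P (at_right 0) (at_right c)"
    unfolding filterlim_at
  proof
    show "(P \<longlongrightarrow> 0) (at_right c)" using c_at[OF cP] c(3) by simp
    show "\<forall>\<^sub>F x in at_right c. P x \<in> {0<..} \<and> P x \<noteq> 0"
      using near by eventually_elim (use c(4) in force)
  qed
  moreover have "((\<lambda>p. H p r) \<longlongrightarrow> 1) (at_right 0)"
  proof -
    have "((\<lambda>p. H p r - 1 - p / r) \<longlongrightarrow> 0) (at_right 0)"
      using lim r unfolding vanishing_energy_limit_def by auto
    moreover have "((\<lambda>p. 1 + p / r) \<longlongrightarrow> 1 + 0 / r) (at_right 0)"
      by (intro tendsto_intros) (use r in auto)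
    ultimately have "((\<lambda>p. (H p r - 1 - p / r) + (1 + p / r)) \<longlongrightarrow> 0 + (1 + 0 / r)) (at_right 0)"
      by (rule tendsto_add)
    then show ?thesis by simp
  qed
  ultimately have H1: "((\<lambda>\<xi>. H (P \<xi>) r) \<longlongrightarrow> 1) (at_right c)"
    using filterlim_compose by blast
  have "((\<lambda>\<xi>. D / s \<xi> * H (P \<xi>) r - \<xi>) \<longlongrightarrow> D / s c * 1 - c) (at_right c)"
    by (intro tendsto_intros H1 c_at[OF cs]) (use s_pos[OF c0(2)] in auto)
  moreover have "D / s c * 1 - c < 0" using c_large s_pos[OF c0(2)] by (simp add: field_simps)
  ultimately have "\<forall>\<^sub>F \<xi> in at_right c. D / s \<xi> * H (P \<xi>) r - \<xi> < 0"
    by (rule order_tendstoD(2))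
  moreover have "\<forall>\<^sub>F \<xi> in at_right c. s \<xi> > s c / 2"
    using order_tendstoD(1)[OF c_at[OF cs], of "s c / 2"] s_pos[OF c0(2)] by simp
  ultimately have "\<forall>\<^sub>F \<xi> in at_right c. D / s \<xi> * H (P \<xi>) r - \<xi> < 0 \<and> s \<xi> > s c / 2 \<and> \<xi> < M \<and> \<xi> > c"
    using near by eventually_elim auto
  then obtain y where y: "D / s y * H (P y) r - y < 0" "s y > s c / 2" "y < M" "y > c"
    using eventually_happens trivial_limit_at_right_real by blast
  have "H (P y) (D * s y) \<le> H (P y) r"
    using eos_antimono[OF eos, of "P y" r "D * s y"] c(4)[of y] y r D0 unfolding r_def by (simp add: field_simps)
  then have "D / s y * H (P y) (D * s y) \<le> D / s y * H (P y) r"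
    using D0 s_pos[of y] y c0 by (intro mult_left_mono) auto
  then have fy: "f y \<le> 0" unfolding f_def using y by linarith
  \<comment> \<open>Here \<rho> H \<ge> 2 p by \<open>eos_bound\<close>, and p = P M \<ge> M / 2, so
    \<rho> H is at least M and hence at least M s^2.\<close>
  have fM: "f M \<ge> 0"
  proof -
    have aM: "M > a" using a(2) .
    define sM where "sM = s M"
    have sM: "sM > 0" "sM \<le> 1" unfolding sM_def using s_pos[OF aM] by (auto simp: s_def)
    have PM: "P M > 0" using c(4)[of M] c(2) by auto
    have "D * sM * H (P M) (D * sM) \<ge> 2 * P M"
      using eos_bound[OF eos, of "D * sM" "P M"] D0 sM PM
      by (smt (verit) real_le_rsqrt zero_le_power2 mult_pos_pos)
    then have "D * H (P M) (D * sM) * sM \<ge> 2 * P M" by (simp add: mult_ac)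
    moreover have "sM * M \<le> M" using sM M by (simp add: mult_left_le_one_le)
    moreover have "2 * P M \<ge> M" using P_ge[of M] M a(3)[OF aM] by simp
    ultimately have "M * sM * sM \<le> D * H (P M) (D * sM) * sM"
      using sM M by (smt (verit) mult.commute mult_left_le_one_le mult_nonneg_nonneg)
    then have "M * sM \<le> D * H (P M) (D * sM)" using sM by simp
    then show ?thesis unfolding f_def sM_def[symmetric] using sM by (simp add: field_simps)
  qed
  have "continuous_on {y..M} f"
  proof -
    have sub: "{y..M} \<subseteq> {0<..}" using y c0 by auto
    have "continuous_on {y..M} (\<lambda>\<xi>. (\<lambda>(p, \<rho>). H p \<rho>) (P \<xi>, D * s \<xi>))"
      by (rule continuous_on_compose2[OF eos_continuous[OF eos]])
        (use sub y c0 c(4) s_pos D0 in \<open>auto intro!: continuous_intros continuous_on_subset[OF cP] continuous_on_subset[OF cs]\<close>)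
    moreover have "\<forall>\<xi>\<in>{y..M}. s \<xi> \<noteq> 0"
    proof
      fix \<xi> assume "\<xi> \<in> {y..M}"
      then have "\<xi> > a" using y(4) c0(2) by simp
      then show "s \<xi> \<noteq> 0" using s_pos[of \<xi>] by simp
    qed
    ultimately show ?thesis unfolding f_def
      by (auto intro!: continuous_intros continuous_on_subset[OF cs sub])
  qed
  then obtain x where x: "y \<le> x" "x \<le> M" "f x = 0"
    using IVT'[of f y 0 M] fy fM y by auto
  have xa: "x > a" "x > 0" "x > c" using x y c0 by auto
  note vx = a(3)[OF xa(1)]
  note sx = s_pos[OF xa(1)]
  define \<rho> where "\<rho> = D * s x"
  define p where "p = P x"
  have p: "p > 0" unfolding p_def using c(4)[of x] x xa by auto
  have rho: "\<rho> > 0" unfolding \<rho>_def using D0 sx by simp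
  have W: "lorentz (v x) = 1 / s x" unfolding lorentz_def s_def by (simp add: power2_norm_eq_inner)
  have X: "\<rho> * H p \<rho> * (lorentz (v x))\<^sup>2 = x"
    using x(3) sx unfolding f_def \<rho>_def[symmetric] p_def[symmetric] W by (simp add: \<rho>_def power2_eq_square field_simps)
  have "H p \<rho> - 1 - p / \<rho> > 0"
  proof -
    have "sqrt (1 + p\<^sup>2 / \<rho>\<^sup>2) > 1" using p rho by simp
    moreover have "H p \<rho> \<ge> sqrt (1 + p\<^sup>2 / \<rho>\<^sup>2) + p / \<rho>" using eos p rho unfolding equation_of_state_def by auto
    ultimately show ?thesis by linarith
  qed
  moreover have "U = cons H \<rho> p (v x) B"
  proof -
    have "ptot p (v x) B = p + ((1 - v x \<bullet> v x) * b + (v x \<bullet> B)\<^sup>2) / 2"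
    proof -
      have "(norm B)\<^sup>2 / (lorentz (v x))\<^sup>2 = (1 - v x \<bullet> v x) * b"
        using arg_cong[OF lorentz_facts(1)[OF vx], of "\<lambda>t. (norm B)\<^sup>2 * t"] by (simp add: power2_norm_eq_inner mult.commute b_def)
      then show ?thesis unfolding ptot_def by simp
    qed
    then have "x - ptot p (v x) B + b = E" unfolding p_def P_def by simp
    moreover have "\<rho> * lorentz (v x) = D" unfolding W \<rho>_def using sx by simp
    ultimately show ?thesis unfolding cons_def X U using m[OF xa(2)] by (simp add: power2_norm_eq_inner b_def)
  qed
  ultimately have "is_prim H U (\<rho>, p, v x)"
    unfolding is_prim_def using rho p vx by (simp add: cons_def)
  then show ?thesis unfolding admissible_def by blast
qed

section \<open>Divergence theorem on polygons\<close>

text \<open>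
  \<open>s e = 1\<close> if \<open>A\<close> lies to the left of the jump \<open>p e\<close>, and \<open>s e = -1\<close> if it lies to the right. The
  restriction of \<open>f\<close> to \<open>A\<close> becomes continuous after adding the step functions \<open>T e\<close>.
\<close>

lemma integral_over_jump_set:
  fixes f f' :: "real \<Rightarrow> real" and A :: "real set" and p s :: "'i \<Rightarrow> real"
  assumes I: "finite I" "inj_on p I"
    and deriv: "\<And>x. (f has_real_derivative f' x) (at x)"
    and inA: "\<And>x. x \<in> A \<Longrightarrow> x \<notin> p ` I \<Longrightarrow> \<forall>\<^sub>F y in nhds x. y \<in> A"
    and outA: "\<And>x. x \<notin> A \<Longrightarrow> x \<notin> p ` I \<Longrightarrow> \<forall>\<^sub>F y in nhds x. y \<notin> A"
    and s: "\<And>e. e \<in> I \<Longrightarrow> p e \<in> A \<and> (s e = 1 \<or> s e = -1) \<and>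
       (\<exists>\<delta>>0. \<forall>t. 0 < t \<and> t < \<delta> \<longrightarrow> p e - t * s e \<in> A \<and> p e + t * s e \<notin> A)"
    and ab: "A \<subseteq> {a<..<b}" "a \<le> b"
  shows "((\<lambda>x. if x \<in> A then f' x else 0) has_integral (\<Sum>e\<in>I. s e * f (p e))) {a..b}"
proof -
  \<comment> \<open>\<open>p e\<close> lies in \<open>A\<close> in both cases, so a right end takes
    the strict inequality and a left end the non-strict one; then \<open>G\<close> has no jump at
    \<open>p e\<close>.\<close>
  define T where "T e x = (if s e = 1 then (if p e < x then f (p e) else 0) else (if p e \<le> x then - f (p e) else 0))" for e x
  define G where "G x = (if x \<in> A then f x else 0) + (\<Sum>e\<in>I. T e x)" for x
  have T_const: "\<forall>\<^sub>F x in nhds x0. T e x = T e x0" if "p e \<noteq> x0" for e x0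
  proof -
    have "\<forall>\<^sub>F x in nhds x0. dist x x0 < \<bar>p e - x0\<bar>"
      using that by (simp add: eventually_nhds_metric) (metis zero_less_abs_iff right_minus_eq)
    then show ?thesis by eventually_elim (auto simp: T_def dist_real_def)
  qed
  have sum_const: "\<forall>\<^sub>F x in nhds x0. (\<Sum>e\<in>J. T e x) = (\<Sum>e\<in>J. T e x0)" if "J \<subseteq> I" "x0 \<notin> p ` J" for J x0
  proof -
    have "finite J" using that I finite_subset by auto
    then have "\<forall>\<^sub>F x in nhds x0. \<forall>e\<in>J. T e x = T e x0"
      using that(2) by (intro eventually_ball_finite ballI T_const) auto
    then show ?thesis by eventually_elim auto
  qed
  have off: "(G has_real_derivative (if x \<in> A then f' x else 0)) (at x)" if x: "x \<notin> p ` I" for x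
  proof -
    have c: "\<forall>\<^sub>F y in nhds x. (\<Sum>e\<in>I. T e y) = (\<Sum>e\<in>I. T e x)" using sum_const[of I x] x by auto
    show ?thesis
    proof (cases "x \<in> A")
      case True
      have "\<forall>\<^sub>F y in nhds x. G y = f y + (\<Sum>e\<in>I. T e x)"
        using c inA[OF True x] by eventually_elim (simp add: G_def)
      then have "(G has_real_derivative f' x) (at x) \<longleftrightarrow> ((\<lambda>y. f y + (\<Sum>e\<in>I. T e x)) has_real_derivative f' x) (at x)"
        by (intro DERIV_cong_ev) auto
      then show ?thesis using True deriv[of x] by (auto intro!: derivative_eq_intros)
    next
      case False
      have "\<forall>\<^sub>F y in nhds x. G y = (\<Sum>e\<in>I. T e x)"
        using c outA[OF False x] by eventually_elim (simp add: G_def)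
      then have "(G has_real_derivative 0) (at x) \<longleftrightarrow> ((\<lambda>y. (\<Sum>e\<in>I. T e x)) has_real_derivative 0) (at x)"
        by (intro DERIV_cong_ev) auto
      then show ?thesis using False by auto
    qed
  qed
  have cf: "isCont f x" for x using deriv[of x] by (rule DERIV_isCont)
  have on: "isCont G (p e)" if e: "e \<in> I" for e
  proof -
    define c where "c = (\<Sum>d\<in>I - {e}. T d (p e))"
    have "p e \<notin> p ` (I - {e})" using I(2) e by (auto simp: inj_on_def)
    then have c: "\<forall>\<^sub>F x in nhds (p e). (\<Sum>d\<in>I - {e}. T d x) = c"
      unfolding c_def by (intro sum_const) auto
    have split: "(\<Sum>d\<in>I. T d x) = T e x + (\<Sum>d\<in>I - {e}. T d x)" for x
      using I(1) e by (simp add: sum.remove)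
    obtain \<delta> where d: "\<delta> > 0" "\<And>t. 0 < t \<Longrightarrow> t < \<delta> \<Longrightarrow> p e - t * s e \<in> A \<and> p e + t * s e \<notin> A"
      using s[OF e] by auto
    have near: "\<forall>\<^sub>F x in nhds (p e). \<bar>x - p e\<bar> < \<delta>"
      using d(1) by (auto simp: eventually_nhds_metric dist_real_def)
    show ?thesis
    proof (cases "s e = 1")
      case True
      \<comment> \<open>Left of \<open>p e\<close> this is f, right of it the constant f (p e), up
        to the contribution \<open>c\<close> of the other jumps.\<close>
      have "\<forall>\<^sub>F x in nhds (p e). G x = f (min x (p e)) + c"
        using c near
      proof eventually_elim
        case (elim x)
        have "x < p e \<Longrightarrow> x \<in> A" using d(2)[of "p e - x"] elim True by auto
        moreover have "x > p e \<Longrightarrow> x \<notin> A" using d(2)[of "x - p e"] elim True by auto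
        moreover have "G x = (if x \<in> A then f x else 0) + (if p e < x then f (p e) else 0) + c"
          unfolding G_def split elim(1) using True by (simp add: T_def)
        ultimately show ?case using s[OF e]
          by (cases "x < p e"; cases "x = p e") (auto simp: min_def)
      qed
      then have "isCont G (p e) \<longleftrightarrow> isCont (\<lambda>x. f (min x (p e)) + c) (p e)"
        by (rule isCont_cong)
      moreover have "isCont (\<lambda>x. f (min x (p e)) + c) (p e)"
      proof -
        have "isCont (\<lambda>x. min x (p e)) (p e)" by (intro continuous_min continuous_ident continuous_const)
        then have "isCont (\<lambda>x. f (min x (p e))) (p e)" by (rule isCont_o2) (rule cf)
        then show ?thesis by (intro continuous_add continuous_diff continuous_const)
      qed
      ultimately show ?thesis by simp
    next
      case False
      then have m: "s e = -1" using s[OF e] by auto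
      have "\<forall>\<^sub>F x in nhds (p e). G x = f (max x (p e)) - f (p e) + c"
        using c near
      proof eventually_elim
        case (elim x)
        have "x > p e \<Longrightarrow> x \<in> A" using d(2)[of "x - p e"] elim m by auto
        moreover have "x < p e \<Longrightarrow> x \<notin> A" using d(2)[of "p e - x"] elim m by auto
        moreover have "G x = (if x \<in> A then f x else 0) + (if p e \<le> x then - f (p e) else 0) + c"
          unfolding G_def split elim(1) using m by (simp add: T_def)
        ultimately show ?case using s[OF e]
          by (cases "x < p e"; cases "x = p e") (auto simp: max_def)
      qed
      then have "isCont G (p e) \<longleftrightarrow> isCont (\<lambda>x. f (max x (p e)) - f (p e) + c) (p e)"
        by (rule isCont_cong)
      moreover have "isCont (\<lambda>x. f (max x (p e)) - f (p e) + c) (p e)"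
      proof -
        have "isCont (\<lambda>x. max x (p e)) (p e)" by (intro continuous_max continuous_ident continuous_const)
        then have "isCont (\<lambda>x. f (max x (p e))) (p e)" by (rule isCont_o2) (rule cf)
        then show ?thesis by (intro continuous_add continuous_diff continuous_const)
      qed
      ultimately show ?thesis by simp
    qed
  qed
  have "isCont G x" for x
    using on off DERIV_isCont by (cases "x \<in> p ` I") blast+
  then have "continuous_on {a..b} G" by (simp add: continuous_at_imp_continuous_on)
  then have "((\<lambda>x. if x \<in> A then f' x else 0) has_integral (G b - G a)) {a..b}"
    using I(1) ab(2) off
    by (intro fundamental_theorem_of_calculus_interior_strong[of "p ` I"])
      (auto simp: has_real_derivative_iff_has_vector_derivative[symmetric])
  moreover have "G b = (\<Sum>e\<in>I. s e * f (p e))"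
  proof -
    have "b \<notin> A" using ab(1) by auto
    moreover have "T e b = s e * f (p e)" if "e \<in> I" for e
      using s[OF that] ab(1) unfolding T_def by (auto simp: subset_iff)
    ultimately show ?thesis unfolding G_def by simp
  qed
  moreover have "G a = 0"
  proof -
    have "a \<notin> A" using ab(1) by auto
    moreover have "T e a = 0" if "e \<in> I" for e
    proof -
      have "p e > a" using s[OF that] ab(1) by auto
      then show ?thesis unfolding T_def by auto
    qed
    ultimately show ?thesis unfolding G_def by simp
  qed
  ultimately show ?thesis by simp
qed

lemma polygon_edges_meet:
  assumes "polygon K es" "(a, b) \<in> es" "(c, d) \<in> es" "(a, b) \<noteq> (c, d)"
  shows "edge_seg (a, b) \<inter> edge_seg (c, d) \<subseteq> {a, b} \<inter> {c, d}"
proof -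
  have "\<forall>(a, b)\<in>es. \<forall>(c, d)\<in>es. (a, b) \<noteq> (c, d) \<longrightarrow>
        edge_seg (a, b) \<inter> edge_seg (c, d) \<subseteq> {a, b} \<inter> {c, d}"
    using assms(1) unfolding polygon_def by blast
  from bspec[OF this assms(2)] have "\<forall>(c, d)\<in>es. (a, b) \<noteq> (c, d) \<longrightarrow>
        edge_seg (a, b) \<inter> edge_seg (c, d) \<subseteq> {a, b} \<inter> {c, d}"
    by (simp only: prod.case)
  from bspec[OF this assms(3)] show ?thesis using assms(4) by (simp only: prod.case not_False_eq_True simp_thms)
qed

text \<open>
  The two open half-discs at \<open>z\<close> are connected and avoid the frontier of \<open>K\<close>.
\<close>

lemma polygon_near_edge:
  assumes K: "polygon K es" and e: "(a, b) \<in> es" and n: "outward_unit_normal K (a, b) n"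
    and z: "z \<in> open_segment a b"
  obtains \<delta> where "\<delta> > 0" "\<And>w. w \<in> ball z \<delta> \<Longrightarrow> n \<bullet> (w - z) < 0 \<Longrightarrow> w \<in> K"
    "\<And>w. w \<in> ball z \<delta> \<Longrightarrow> n \<bullet> (w - z) > 0 \<Longrightarrow> w \<notin> K"
proof -
  have fin: "finite es" and fr: "frontier K = (\<Union>e\<in>es. edge_seg e)"
    using K unfolding polygon_def by auto
  have n1: "norm n = 1" "n \<bullet> (b - a) = 0" and
    cross: "\<exists>r>0. \<forall>t. 0 < t \<and> t < r \<longrightarrow> z - t *\<^sub>R n \<in> interior K \<and> z + t *\<^sub>R n \<notin> K"
    using n z unfolding outward_unit_normal_def by auto
  define R where "R = (\<Union>e\<in>es - {(a, b)}. edge_seg e)"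
  have "closed R" unfolding R_def edge_seg_def using fin by (intro closed_UN) auto
  moreover have "z \<notin> R"
  proof
    assume "z \<in> R"
    then obtain c d where cd: "(c, d) \<in> es" "(c, d) \<noteq> (a, b)" "z \<in> edge_seg (c, d)" unfolding R_def by auto
    moreover have "z \<in> edge_seg (a, b)" using z by (auto simp: edge_seg_def open_segment_def)
    ultimately have "z \<in> {a, b}" using polygon_edges_meet[OF K e, of c d] by auto
    then show False using z by (auto simp: open_segment_def)
  qed
  ultimately obtain \<delta> where d: "\<delta> > 0" "ball z \<delta> \<subseteq> - R"
    using open_contains_ball[of "- R"] by (auto simp: open_closed)
  have level: "n \<bullet> (w - z) = 0" if "w \<in> edge_seg (a, b)" for w
  proof -
    have *: "n \<bullet> w = n \<bullet> a" if "w \<in> edge_seg (a, b)" for w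
    proof -
      obtain u where "w = a + u *\<^sub>R (b - a)" using \<open>w \<in> edge_seg (a, b)\<close>
        unfolding edge_seg_def closed_segment_def by (auto simp: algebra_simps)
      then show ?thesis using n1(2) by (simp add: inner_add_right)
    qed
    have "z \<in> edge_seg (a, b)" using z by (auto simp: edge_seg_def open_segment_def)
    then show ?thesis using *[of w] *[of z] that by (simp add: inner_diff_right)
  qed
  have nofr: "w \<notin> frontier K" if "w \<in> ball z \<delta>" "n \<bullet> (w - z) \<noteq> 0" for w
    using that d(2) level unfolding fr R_def by blast
  obtain r where r: "r > 0" "\<And>t. 0 < t \<Longrightarrow> t < r \<Longrightarrow> z - t *\<^sub>R n \<in> K \<and> z + t *\<^sub>R n \<notin> K"
    using cross interior_subset by blast
  define t where "t = min r \<delta> / 2"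
  have t: "0 < t" "t < r" "t < \<delta>" unfolding t_def using r d by auto
  have nn: "n \<bullet> n = 1" using n1(1) by (simp add: dot_square_norm)
  define Hm where "Hm = ball z \<delta> \<inter> {w. n \<bullet> w < n \<bullet> z}"
  define Hp where "Hp = ball z \<delta> \<inter> {w. n \<bullet> w > n \<bullet> z}"
  have "connected Hm" "connected Hp" unfolding Hm_def Hp_def
    by (auto intro!: convex_connected convex_Int convex_halfspace_lt convex_halfspace_gt)
  moreover have "Hm \<inter> frontier K = {}" "Hp \<inter> frontier K = {}"
    using nofr unfolding Hm_def Hp_def by (auto simp: inner_diff_right)
  moreover have "z - t *\<^sub>R n \<in> Hm \<inter> K" "z + t *\<^sub>R n \<in> Hp - K"
    using r(2)[OF t(1,2)] t n1(1) nn unfolding Hm_def Hp_def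
    by (auto simp: dist_norm inner_diff_right inner_add_right)
  ultimately have "Hm \<subseteq> K" "Hp \<inter> K = {}"
    using connected_Int_frontier[of Hm K] connected_Int_frontier[of Hp K] by blast+
  then have "w \<in> K" if "w \<in> ball z \<delta>" "n \<bullet> (w - z) < 0" for w
    using that unfolding Hm_def by (auto simp: inner_diff_right)
  moreover have "w \<notin> K" if "w \<in> ball z \<delta>" "n \<bullet> (w - z) > 0" for w
    using that \<open>Hp \<inter> K = {}\<close> unfolding Hp_def by (auto simp: inner_diff_right)
  ultimately show ?thesis using that[OF d(1)] by blast
qed

section \<open>Slices of a polygon parallel to an axis, and Fubini\<close>

definition slice_point :: "2 \<Rightarrow> real \<Rightarrow> real \<Rightarrow> point" where
  "slice_point i x y = (\<chi> l. if l = i then x else y)"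

lemma UNIV_2_eq: "i \<noteq> j \<Longrightarrow> UNIV = {i, j::2}"
  using exhaust_2 by auto metis+

lemma slice_point_nth: "slice_point i x y $ i = x" "j \<noteq> i \<Longrightarrow> slice_point i x y $ j = y"
  by (auto simp: slice_point_def)

lemma slice_point_collapse: "i \<noteq> j \<Longrightarrow> slice_point i (z $ i) (z $ j) = z"
  using UNIV_2_eq[of i j] by (auto simp: vec_eq_iff slice_point_def)

lemma slice_point_add: "slice_point i (x + h) y = slice_point i x y + h *\<^sub>R axis i 1"
  by (auto simp: slice_point_def vec_eq_iff axis_def)

lemma inner_2:
  fixes u v :: "real^2"
  assumes "i \<noteq> j"
  shows "u \<bullet> v = u $ i * v $ i + u $ j * v $ j"
  unfolding inner_vec_def UNIV_2_eq[OF assms] using assms by simp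

text \<open>On an edge parallel to the slices the division by 0 returns the first end point; the
  normal component \<open>n $ i\<close> vanishes on such an edge.\<close>

definition edge_at :: "2 \<Rightarrow> edge \<Rightarrow> real \<Rightarrow> point" where
  "edge_at j e y = fst e + ((y - fst e $ j) / (snd e $ j - fst e $ j)) *\<^sub>R (snd e - fst e)"

lemma isCont_slice_point: "isCont (\<lambda>x. slice_point i x y) x"
proof -
  have "slice_point i x y = slice_point i 0 y + x *\<^sub>R axis i 1" for x
    using slice_point_add[of i 0 x y] by simp
  then have "(\<lambda>x. slice_point i x y) = (\<lambda>x. slice_point i 0 y + x *\<^sub>R axis i 1)"
    by (rule ext)
  moreover have "isCont (\<lambda>x. slice_point i 0 y + x *\<^sub>R axis i 1) x"
    by (intro continuous_intros)
  ultimately show ?thesis by (simp only:)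
qed

lemma closed_segment_real_param:
  fixes y a b :: real
  assumes "y \<in> closed_segment a b" "y \<noteq> a" "y \<noteq> b"
  shows "a \<noteq> b" "0 < (y - a) / (b - a)" "(y - a) / (b - a) < 1"
proof -
  obtain u where u': "y = (1 - u) * a + u * b" "0 \<le> u" "u \<le> 1"
    using assms unfolding closed_segment_def by auto
  have "u \<noteq> 0" "u \<noteq> 1" using u'(1) assms(2,3) by auto
  moreover have "y = a + u * (b - a)" using u'(1) by (simp add: algebra_simps)
  ultimately have u: "y = a + u * (b - a)" "0 < u" "u < 1" using u' by auto
  show "a \<noteq> b" using u assms by auto
  then show "0 < (y - a) / (b - a)" "(y - a) / (b - a) < 1" using u by auto
qed

text \<open>A line that misses all vertices crosses each edge at most once and transversally, and
  \<open>sgn (n e $ i)\<close> tells whether it leaves or enters \<open>K\<close> there. So the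
  slice satisfies the assumptions of \<open>integral_over_jump_set\<close>.\<close>

lemma polygon_slice_integral:
  fixes f f' :: "point \<Rightarrow> real" and i j :: 2
  assumes K: "polygon K es" and n: "\<And>e. e \<in> es \<Longrightarrow> outward_unit_normal K e (n e)"
    and ij: "i \<noteq> j" and y: "\<And>e. e \<in> es \<Longrightarrow> y \<noteq> fst e $ j \<and> y \<noteq> snd e $ j"
    and deriv: "\<And>x. ((\<lambda>t. f (slice_point i t y)) has_real_derivative f' (slice_point i x y)) (at x)"
    and ab: "{x. slice_point i x y \<in> K} \<subseteq> {a<..<b}" "a \<le> b"
  shows "((\<lambda>x. if slice_point i x y \<in> K then f' (slice_point i x y) else 0) has_integral
    (\<Sum>e\<in>es. sgn (n e $ i) * (if y \<in> closed_segment (fst e $ j) (snd e $ j) then f (edge_at j e y) else 0))) {a..b}"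
proof -
  define A where "A = {x. slice_point i x y \<in> K}"
  define I where "I = {e\<in>es. y \<in> closed_segment (fst e $ j) (snd e $ j)}"
  define p where "p e = edge_at j e y $ i" for e
  define s where "s e = sgn (n e $ i)" for e
  have fin: "finite es" and fr: "frontier K = (\<Union>e\<in>es. edge_seg e)" and comp: "compact K"
    using K unfolding polygon_def by auto
  have cl: "closed K" using comp by (rule compact_imp_closed)
  have act: "fst e $ j \<noteq> snd e $ j" "edge_at j e y \<in> open_segment (fst e) (snd e)"
    "slice_point i (p e) y = edge_at j e y" if e: "e \<in> I" for e
  proof -
    define t where "t = (y - fst e $ j) / (snd e $ j - fst e $ j)"
    have es: "e \<in> es" "y \<in> closed_segment (fst e $ j) (snd e $ j)" using e unfolding I_def by auto
    have t: "fst e $ j \<noteq> snd e $ j" "0 < t" "t < 1"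
      using closed_segment_real_param[OF es(2)] y[OF es(1)] unfolding t_def by auto
    show "fst e $ j \<noteq> snd e $ j" by fact
    have ea: "edge_at j e y = fst e + t *\<^sub>R (snd e - fst e)" unfolding edge_at_def t_def ..
    then show "edge_at j e y \<in> open_segment (fst e) (snd e)"
      using t by (auto simp: in_segment algebra_simps intro!: exI[of _ t])
    have "edge_at j e y $ j = y" unfolding edge_at_def using t(1) by simp
    then show "slice_point i (p e) y = edge_at j e y"
      unfolding p_def using slice_point_collapse[OF ij, of "edge_at j e y"] by simp
  qed
  have in_seg: "edge_at j e y \<in> edge_seg e" if "e \<in> I" for e
    using act(2)[OF that] by (auto simp: edge_seg_def open_segment_def)
  have seg: "x \<in> p ` I" if x: "slice_point i x y \<in> frontier K" for x
  proof -
    obtain e where e: "e \<in> es" "slice_point i x y \<in> edge_seg e" using x fr by auto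
    then obtain u where u: "slice_point i x y = fst e + u *\<^sub>R (snd e - fst e)" "0 \<le> u" "u \<le> 1"
      unfolding edge_seg_def closed_segment_def by (auto simp: algebra_simps)
    have yj: "y = fst e $ j + u * (snd e $ j - fst e $ j)"
      using arg_cong[OF u(1), of "\<lambda>v. v $ j"] slice_point_nth(2)[of j i x y] ij by simp
    then have "y \<in> closed_segment (fst e $ j) (snd e $ j)"
      using u unfolding closed_segment_def by (auto simp: algebra_simps)
    then have eI: "e \<in> I" using e unfolding I_def by auto
    have "u = (y - fst e $ j) / (snd e $ j - fst e $ j)"
      using yj act(1)[OF eI] by (simp add: field_simps)
    then have "slice_point i x y = edge_at j e y" using u(1) unfolding edge_at_def by simp
    then have "x = p e" unfolding p_def by (metis slice_point_nth(1))
    then show ?thesis using eI by auto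
  qed
  \<comment> \<open>Distinct edges share at most end points, and the height \<open>y\<close> avoids
    those.\<close>
  have "inj_on p I"
  proof (rule inj_onI, rule ccontr)
    fix e d assume ed: "e \<in> I" "d \<in> I" "p e = p d" "e \<noteq> d"
    have "edge_at j e y = edge_at j d y" using ed act(3) by metis
    then have "edge_at j e y \<in> edge_seg e \<inter> edge_seg d"
      using in_seg[OF ed(1)] in_seg[OF ed(2)] by simp
    moreover have "edge_seg e \<inter> edge_seg d \<subseteq> {fst e, snd e}"
      using polygon_edges_meet[OF K, of "fst e" "snd e" "fst d" "snd d"] ed unfolding I_def by auto
    ultimately show False using act(2)[OF ed(1)] by (auto simp: open_segment_def)
  qed
  moreover have "\<forall>\<^sub>F t in nhds x. t \<in> A" if x: "x \<in> A" "x \<notin> p ` I" for x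
  proof -
    have "slice_point i x y \<in> interior K"
      using x seg cl unfolding A_def frontier_def by auto
    then have "\<forall>\<^sub>F t in at x. slice_point i t y \<in> interior K"
      using isCont_slice_point[where i=i and y=y and x=x] unfolding isCont_def by (auto dest: topological_tendstoD)
    then have "\<forall>\<^sub>F t in at x. slice_point i t y \<in> K"
      by (rule eventually_mono) (use interior_subset in blast)
    then show ?thesis using x(1) unfolding A_def eventually_nhds_conv_at by simp
  qed
  moreover have "\<forall>\<^sub>F t in nhds x. t \<notin> A" if x: "x \<notin> A" "x \<notin> p ` I" for x
  proof -
    have "slice_point i x y \<in> - K" "open (- K)" using x cl unfolding A_def by auto
    then have "\<forall>\<^sub>F t in at x. slice_point i t y \<in> - K"
      using isCont_slice_point[where i=i and y=y and x=x] unfolding isCont_def by (blast dest: topological_tendstoD)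
    then show ?thesis using x(1) unfolding A_def eventually_nhds_conv_at
      by (auto elim: eventually_mono)
  qed
  moreover have "p e \<in> A \<and> (s e = 1 \<or> s e = -1) \<and>
       (\<exists>\<delta>>0. \<forall>t. 0 < t \<and> t < \<delta> \<longrightarrow> p e - t * s e \<in> A \<and> p e + t * s e \<notin> A)" if e: "e \<in> I" for e
  proof -
    define z where "z = edge_at j e y"
    have es: "e \<in> es" using e unfolding I_def by auto
    note nor = n[OF es, unfolded outward_unit_normal_def]
    \<comment> \<open>Otherwise \<open>n e $ j\<close> would vanish too, since the edge is not
      parallel to the slice, against |n e| = 1.\<close>
    have ni: "n e $ i \<noteq> 0"
    proof
      assume 0: "n e $ i = 0"
      have "n e \<bullet> (snd e - fst e) = 0" using nor by auto
      then have "n e $ j = 0" using 0 act(1)[OF e] inner_2[OF ij] by auto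
      then have "n e \<bullet> n e = 0" using 0 inner_2[OF ij, of "n e" "n e"] by simp
      then show False using nor by auto
    qed
    have s1: "s e = 1 \<or> s e = -1" using ni unfolding s_def sgn_real_def by auto
    have "z \<in> frontier K" unfolding z_def fr using in_seg[OF e] es by auto
    then have "p e \<in> A" unfolding A_def using act(3)[OF e] cl z_def frontier_subset_closed by auto
    moreover obtain \<delta> where d: "\<delta> > 0" "\<And>w. w \<in> ball z \<delta> \<Longrightarrow> n e \<bullet> (w - z) < 0 \<Longrightarrow> w \<in> K"
      "\<And>w. w \<in> ball z \<delta> \<Longrightarrow> n e \<bullet> (w - z) > 0 \<Longrightarrow> w \<notin> K"
      using polygon_near_edge[OF K, of "fst e" "snd e" "n e" z] es n[OF es] act(2)[OF e] unfolding z_def by auto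
    have "p e - t * s e \<in> A \<and> p e + t * s e \<notin> A" if t: "0 < t" "t < \<delta>" for t
    proof -
      have w: "slice_point i (p e + h) y = z + h *\<^sub>R axis i 1" for h
        unfolding slice_point_add act(3)[OF e] z_def ..
      have pos: "t * s e * n e $ i > 0" using t ni unfolding s_def
        by (simp add: zero_less_mult_iff sgn_real_def)
      have b: "z + h *\<^sub>R axis i 1 \<in> ball z \<delta>" if "\<bar>h\<bar> = t" for h
        using that t by (simp add: dist_norm)
      have ab: "\<bar>t * s e\<bar> = t" using s1 t by auto
      have "z + (- (t * s e)) *\<^sub>R axis i 1 \<in> K"
        by (rule d(2)) (use b[of "- (t * s e)"] ab pos in \<open>auto simp: inner_axis\<close>)
      moreover have "z + (t * s e) *\<^sub>R axis i 1 \<notin> K"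
        by (rule d(3)) (use b[of "t * s e"] ab pos in \<open>auto simp: inner_axis\<close>)
      ultimately show ?thesis unfolding A_def using w[of "- (t * s e)"] w[of "t * s e"] by simp
    qed
    ultimately show ?thesis using s1 d(1) by blast
  qed
  moreover have "finite I" using fin unfolding I_def by auto
  ultimately have "((\<lambda>x. if x \<in> A then f' (slice_point i x y) else 0) has_integral
      (\<Sum>e\<in>I. s e * f (slice_point i (p e) y))) {a..b}"
    using ab deriv by (intro integral_over_jump_set) (auto simp: A_def)
  moreover have "(\<Sum>e\<in>I. s e * f (slice_point i (p e) y)) =
     (\<Sum>e\<in>es. sgn (n e $ i) * (if y \<in> closed_segment (fst e $ j) (snd e $ j) then f (edge_at j e y) else 0))"
  proof -
    have "(\<Sum>e\<in>I. s e * f (slice_point i (p e) y)) = (\<Sum>e\<in>I. s e * f (edge_at j e y))"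
      using act(3) by (intro sum.cong) auto
    also have "\<dots> = (\<Sum>e\<in>es. if y \<in> closed_segment (fst e $ j) (snd e $ j) then s e * f (edge_at j e y) else 0)"
      unfolding I_def by (rule sum.inter_filter[OF fin])
    also have "\<dots> = (\<Sum>e\<in>es. sgn (n e $ i) * (if y \<in> closed_segment (fst e $ j) (snd e $ j) then f (edge_at j e y) else 0))"
      unfolding s_def by (intro sum.cong) auto
    finally show ?thesis .
  qed
  ultimately show ?thesis unfolding A_def by simp
qed

lemma slice_point_eq:
  assumes "i \<noteq> j"
  shows "slice_point i x y = x *\<^sub>R axis i 1 + y *\<^sub>R axis j 1"
proof -
  have "k = i \<or> k = j" for k using UNIV_2_eq[OF assms] by blast
  then show ?thesis using assms by (auto simp: slice_point_def vec_eq_iff axis_def)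
qed

lemma slice_point_measurable:
  "(\<lambda>z. slice_point i (fst z) (snd z)) \<in> borel_measurable (borel \<Otimes>\<^sub>M borel)"
  "(\<lambda>z. slice_point i (snd z) (fst z)) \<in> borel_measurable (borel \<Otimes>\<^sub>M borel)"
proof -
  obtain j where "i \<noteq> j" by (metis exhaust_2 one_neq_zero zero_neq_one)
  note eq = slice_point_eq[OF this]
  show "(\<lambda>z. slice_point i (fst z) (snd z)) \<in> borel_measurable (borel \<Otimes>\<^sub>M borel)"
    "(\<lambda>z. slice_point i (snd z) (fst z)) \<in> borel_measurable (borel \<Otimes>\<^sub>M borel)"
    unfolding eq by measurable
qed

text \<open>Lebesgue measure is determined by its values on boxes. Both orders of the axes are
  covered, so that either partial derivative can be integrated first.\<close>

lemma lborel_slice: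
  assumes ij: "i \<noteq> (j::2)"
  shows "lborel = distr (lborel \<Otimes>\<^sub>M lborel) borel (\<lambda>z. slice_point i (fst z) (snd z))"
proof (rule lborel_eqI)
  let ?T = "\<lambda>z. slice_point i (fst z) (snd z)"
  have T: "?T \<in> (lborel \<Otimes>\<^sub>M lborel) \<rightarrow>\<^sub>M borel"
    using slice_point_measurable(1)[of i] by (simp cong: measurable_cong_sets)
  have sum_UNIV: "(\<Prod>l\<in>UNIV. g l) = g i * g j" for g :: "2 \<Rightarrow> real"
    unfolding UNIV_2_eq[OF ij] using ij by simp
  fix l u :: "real^2"
  assume lu: "\<And>b. b \<in> Basis \<Longrightarrow> l \<bullet> b \<le> u \<bullet> b"
  have le: "l $ k \<le> u $ k" for k using lu[of "axis k 1"] by (simp add: inner_axis)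
  have "?T -` box l u \<inter> space (lborel \<Otimes>\<^sub>M lborel) = {l $ i <..< u $ i} \<times> {l $ j <..< u $ j}"
  proof -
    have all: "(\<forall>k::2. Q k) \<longleftrightarrow> Q i \<and> Q j" for Q
      using UNIV_2_eq[OF ij] by (metis UNIV_I insertE singletonD)
    show ?thesis using ij by (auto simp: mem_box_cart all slice_point_nth space_pair_measure)
  qed
  then have "emeasure (distr (lborel \<Otimes>\<^sub>M lborel) borel ?T) (box l u)
      = emeasure (lborel \<Otimes>\<^sub>M lborel) ({l $ i <..< u $ i} \<times> {l $ j <..< u $ j})"
    by (subst emeasure_distr[OF T]) auto
  also have "\<dots> = ennreal (u $ i - l $ i) * ennreal (u $ j - l $ j)"
    using le by (subst lborel.emeasure_pair_measure_Times) auto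
  also have "\<dots> = ennreal (\<Prod>b\<in>Basis. (u - l) \<bullet> b)"
  proof -
    have "(\<Prod>b\<in>Basis. (u - l) \<bullet> b) = (\<Prod>k\<in>UNIV. (u - l) $ k)"
      unfolding Basis_vec_def
      by (subst prod.UNION_disjoint) (auto simp: inner_axis axis_eq_axis prod.reindex)
    then show ?thesis using le by (simp add: sum_UNIV ennreal_mult)
  qed
  finally show "emeasure (distr (lborel \<Otimes>\<^sub>M lborel) borel ?T) (box l u) = ennreal (\<Prod>b\<in>Basis. (u - l) \<bullet> b)" .
qed simp

lemma integral_by_slices:
  fixes F :: "point \<Rightarrow> real"
  assumes ij: "i \<noteq> (j::2)" and F: "integrable lborel F"
  shows "integral\<^sup>L lborel F = (\<integral>y. (\<integral>x. F (slice_point i x y) \<partial>lborel) \<partial>lborel)"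
proof -
  let ?T = "\<lambda>z. slice_point i (fst z) (snd z)"
  have T: "?T \<in> (lborel \<Otimes>\<^sub>M lborel) \<rightarrow>\<^sub>M borel"
    using slice_point_measurable(1)[of i] by (simp cong: measurable_cong_sets)
  have Fm: "F \<in> borel_measurable borel" using F by auto
  have "integral\<^sup>L lborel F = (\<integral>z. F (?T z) \<partial>(lborel \<Otimes>\<^sub>M lborel))"
    by (subst lborel_slice[OF ij]) (rule integral_distr[OF T Fm])
  moreover have "integrable (lborel \<Otimes>\<^sub>M lborel) (\<lambda>z. F (?T z))"
    using F by (subst (asm) lborel_slice[OF ij]) (rule integrable_distr[OF T])
  then have "integrable (lborel \<Otimes>\<^sub>M lborel) (\<lambda>(x, y). F (slice_point i x y))"
    by (simp add: case_prod_unfold)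
  note lborel_pair.integral_snd[OF this]
  ultimately show ?thesis by (simp add: case_prod_unfold)
qed

text \<open>The normal is the unit tangent turned by a right angle, so the edge projects to an
  interval of length |E| |n_i|; this converts integration over heights into arc length.\<close>

lemma sgn_times_projection:
  fixes a b n :: "real^2"
  assumes ij: "i \<noteq> j" and n: "norm n = 1" "n \<bullet> (b - a) = 0"
  shows "sgn (n $ i) * \<bar>b $ j - a $ j\<bar> = dist a b * n $ i"
proof -
  define d where "d = b - a"
  have 1: "n $ i * n $ i + n $ j * n $ j = 1"
    using n(1) inner_2[OF ij, of n n] by (simp add: dot_square_norm)
  have 2: "n $ i * d $ i = - (n $ j * d $ j)"
    using n(2) inner_2[OF ij, of n d] unfolding d_def by simp
  have "(d $ j)\<^sup>2 = (n $ i)\<^sup>2 * (d $ j)\<^sup>2 + (n $ j * d $ j)\<^sup>2"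
    using 1 by (simp add: power2_eq_square) algebra
  also have "(n $ j * d $ j)\<^sup>2 = (n $ i)\<^sup>2 * (d $ i)\<^sup>2" using 2 by (metis power2_minus power_mult_distrib)
  also have "(n $ i)\<^sup>2 * (d $ j)\<^sup>2 + (n $ i)\<^sup>2 * (d $ i)\<^sup>2 = (n $ i)\<^sup>2 * (norm d)\<^sup>2"
    unfolding power2_norm_eq_inner inner_2[OF ij, of d d] by (simp add: power2_eq_square algebra_simps)
  finally have "\<bar>d $ j\<bar> = \<bar>n $ i\<bar> * norm d"
    by (metis abs_mult abs_norm_cancel power_mult_distrib real_sqrt_abs)
  moreover have "sgn (n $ i) * \<bar>n $ i\<bar> = n $ i" by (simp add: mult_sgn_abs)
  ultimately show ?thesis unfolding d_def by (simp add: dist_norm norm_minus_commute algebra_simps)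
qed

lemma edge_fibre_integral:
  fixes g :: "point \<Rightarrow> real" and a b :: point
  assumes g: "continuous_on UNIV g" and ab: "a $ j \<noteq> b $ j"
  shows "integrable lborel (\<lambda>y. if y \<in> closed_segment (a $ j) (b $ j) then g (edge_at j (a, b) y) else 0)"
    and "(\<integral>y. (if y \<in> closed_segment (a $ j) (b $ j) then g (edge_at j (a, b) y) else 0) \<partial>lborel)
     = \<bar>b $ j - a $ j\<bar> * integral {0..1} (\<lambda>t. g (a + t *\<^sub>R (b - a)))"
proof -
  define G where "G y = (if y \<in> closed_segment (a $ j) (b $ j) then g (edge_at j (a, b) y) else 0)" for y
  define c where "c = b $ j - a $ j"
  have c: "c \<noteq> 0" using ab unfolding c_def by simp
  have mem: "a $ j + c * t \<in> closed_segment (a $ j) (b $ j) \<longleftrightarrow> t \<in> {0..1}" for t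
  proof
    assume "a $ j + c * t \<in> closed_segment (a $ j) (b $ j)"
    then obtain u where u: "a $ j + c * t = (1 - u) * a $ j + u * b $ j" "0 \<le> u" "u \<le> 1"
      unfolding closed_segment_def by auto
    then have "c * t = c * u" unfolding c_def by (simp add: algebra_simps)
    then show "t \<in> {0..1}" using c u by auto
  next
    assume "t \<in> {0..1}"
    then show "a $ j + c * t \<in> closed_segment (a $ j) (b $ j)"
      unfolding closed_segment_def c_def by (auto simp: algebra_simps intro!: exI[of _ t])
  qed
  have G: "G (a $ j + c * t) = indicator {0..1} t *\<^sub>R g (a + t *\<^sub>R (b - a))" for t
    unfolding G_def using mem[of t] c by (auto simp: edge_at_def c_def indicator_def)
  have "continuous_on {0..1::real} (\<lambda>t. g (a + t *\<^sub>R (b - a)))"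
    by (rule continuous_on_compose2[OF g]) (auto intro!: continuous_intros)
  then have int: "set_integrable lborel {0..1} (\<lambda>t. g (a + t *\<^sub>R (b - a)))"
    unfolding set_integrable_def by (intro borel_integrable_compact) auto
  then have int': "integrable lborel (\<lambda>t. G (a $ j + c * t))"
    unfolding G set_integrable_def .
  then show "integrable lborel (\<lambda>y. if y \<in> closed_segment (a $ j) (b $ j) then g (edge_at j (a, b) y) else 0)"
    using lborel_integrable_real_affine_iff[OF c, of G "a $ j"] unfolding G_def by simp
  have "integral\<^sup>L lborel G = \<bar>c\<bar> * (\<integral>t. G (a $ j + c * t) \<partial>lborel)"
    using lborel_integral_real_affine[OF c, of G "a $ j"] by simp
  also have "(\<integral>t. G (a $ j + c * t) \<partial>lborel) = integral {0..1} (\<lambda>t. g (a + t *\<^sub>R (b - a)))"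
    unfolding G using set_borel_integral_eq_integral(2)[OF int] by (simp add: set_lebesgue_integral_def)
  finally show "(\<integral>y. (if y \<in> closed_segment (a $ j) (b $ j) then g (edge_at j (a, b) y) else 0) \<partial>lborel)
     = \<bar>b $ j - a $ j\<bar> * integral {0..1} (\<lambda>t. g (a + t *\<^sub>R (b - a)))"
    unfolding G_def c_def .
qed

text \<open>Links the gauge integral used in \<open>cell_average\<close> to the Lebesgue integral,
  for which Fubini is applied.\<close>

lemma compact_integrals:
  fixes g :: "'a::euclidean_space \<Rightarrow> 'b::euclidean_space"
  assumes "compact K" "continuous_on K g"
  shows "g integrable_on K" "integrable lborel (\<lambda>x. indicator K x *\<^sub>R g x)"
    "integral K g = (\<integral>x. indicator K x *\<^sub>R g x \<partial>lborel)"
proof -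
  show i: "integrable lborel (\<lambda>x. indicator K x *\<^sub>R g x)"
    using assms by (intro borel_integrable_compact) auto
  then have "set_integrable lborel K g" unfolding set_integrable_def .
  from set_borel_integral_eq_integral[OF this] show "g integrable_on K"
    "integral K g = (\<integral>x. indicator K x *\<^sub>R g x \<partial>lborel)"
    by (simp_all add: set_lebesgue_integral_def)
qed

lemma polygon_divergence:
  fixes f f' :: "point \<Rightarrow> real"
  assumes K: "polygon K es" and n: "\<And>e. e \<in> es \<Longrightarrow> outward_unit_normal K e (n e)"
    and f: "continuous_on UNIV f" and f': "continuous_on UNIV f'"
    and deriv: "\<And>x y. ((\<lambda>t. f (slice_point i t y)) has_real_derivative f' (slice_point i x y)) (at x)"
  shows "integral K f' = (\<Sum>e\<in>es. edge_length e * n e $ i * integral {0..1} (\<lambda>t. f (fst e + t *\<^sub>R (snd e - fst e))))"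
proof -
  obtain j where ij: "i \<noteq> (j::2)" by (metis exhaust_2 one_neq_zero zero_neq_one)
  have comp: "compact K" and fin: "finite es" using K unfolding polygon_def by auto
  note I = compact_integrals[OF comp continuous_on_subset[OF f' subset_UNIV]]
  obtain R where R: "R > 0" "K \<subseteq> ball 0 R"
    using comp compact_imp_bounded bounded_subset_ballD by blast
  \<comment> \<open>The heights of the vertices, a finite and hence null set.\<close>
  define bad where "bad = (\<lambda>e. fst e $ j) ` es \<union> (\<lambda>e. snd e $ j) ` es"
  have "finite bad" unfolding bad_def using fin by auto
  then have ae: "AE y in lborel. y \<notin> bad" by (intro AE_not_in finite_imp_null_set_lborel)
  define h where "h e y = (if y \<in> closed_segment (fst e $ j) (snd e $ j) then f (edge_at j e y) else 0)" for e y
  have slice: "(\<integral>x. indicator K (slice_point i x y) *\<^sub>R f' (slice_point i x y) \<partial>lborel) = (\<Sum>e\<in>es. sgn (n e $ i) * h e y)"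
    if y: "y \<notin> bad" for y
  proof -
    define A where "A = {x. slice_point i x y \<in> K}"
    have sub: "A \<subseteq> {-R<..<R}"
    proof
      fix x assume "x \<in> A"
      then have "norm (slice_point i x y) < R" using R unfolding A_def by auto
      moreover have "\<bar>x\<bar> \<le> norm (slice_point i x y)" by (metis component_le_norm_cart slice_point_nth(1))
      ultimately show "x \<in> {-R<..<R}" by auto
    qed
    have cs: "continuous_on S (\<lambda>x. slice_point i x y)" for S
      by (simp add: continuous_at_imp_continuous_on isCont_slice_point)
    have "closed A" unfolding A_def
      using continuous_closed_vimage[of K "\<lambda>x. slice_point i x y"] comp isCont_slice_point
      by (auto simp: vimage_def compact_imp_closed)
    moreover have "bounded A" using sub by (intro boundedI[of _ R]) force
    ultimately have "compact A" by (simp add: compact_eq_bounded_closed)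
    note IA = compact_integrals[OF this, of "\<lambda>x. f' (slice_point i x y)"]
    have cf: "continuous_on A (\<lambda>x. f' (slice_point i x y))"
      by (rule continuous_on_compose2[OF f' cs]) auto
    have "((\<lambda>x. if x \<in> A then f' (slice_point i x y) else 0) has_integral (\<Sum>e\<in>es. sgn (n e $ i) * h e y)) {-R..R}"
      unfolding A_def h_def mem_Collect_eq
      by (rule polygon_slice_integral[OF K n ij _ deriv]) (use y sub R in \<open>auto simp: bad_def A_def\<close>)
    moreover have "((\<lambda>x. if x \<in> A then f' (slice_point i x y) else 0) has_integral integral A (\<lambda>x. f' (slice_point i x y))) {-R..R}"
    proof -
      have "A \<subseteq> {-R..R}" using sub by (auto simp: subset_iff less_imp_le)
      then show ?thesis
        using integrable_integral[OF IA(1)[OF cf]] by (simp only: has_integral_restrict)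
    qed
    ultimately have "integral A (\<lambda>x. f' (slice_point i x y)) = (\<Sum>e\<in>es. sgn (n e $ i) * h e y)"
      by (rule has_integral_unique[rotated])
    then show ?thesis unfolding IA(3)[OF cf] by (simp add: A_def indicator_def)
  qed
  have hint: "integrable lborel (\<lambda>y. sgn (n e $ i) * h e y)"
    and hval: "(\<integral>y. sgn (n e $ i) * h e y \<partial>lborel) = edge_length e * n e $ i * integral {0..1} (\<lambda>t. f (fst e + t *\<^sub>R (snd e - fst e)))"
    if e: "e \<in> es" for e
  proof -
    have nor: "norm (n e) = 1" "n e \<bullet> (snd e - fst e) = 0"
      using n[OF e] unfolding outward_unit_normal_def by auto
    note proj = sgn_times_projection[OF ij nor]
    have "integrable lborel (\<lambda>y. sgn (n e $ i) * h e y) \<and>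
       (\<integral>y. sgn (n e $ i) * h e y \<partial>lborel) = sgn (n e $ i) * \<bar>snd e $ j - fst e $ j\<bar> * integral {0..1} (\<lambda>t. f (fst e + t *\<^sub>R (snd e - fst e)))"
    proof (cases "fst e $ j = snd e $ j")
      case True
      \<comment> \<open>An edge parallel to the slices has n_i = 0 and contributes nothing to either
        side.\<close>
      have "fst e \<noteq> snd e" using K e unfolding polygon_def by auto
      then have "n e $ i = 0" using proj True by simp
      then show ?thesis by simp
    next
      case False
      note E = edge_fibre_integral[OF f False, unfolded prod.collapse]
      show ?thesis using E by (simp add: h_def)
    qed
    then show "integrable lborel (\<lambda>y. sgn (n e $ i) * h e y)"
      "(\<integral>y. sgn (n e $ i) * h e y \<partial>lborel) = edge_length e * n e $ i * integral {0..1} (\<lambda>t. f (fst e + t *\<^sub>R (snd e - fst e)))"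
      unfolding proj edge_length_def by auto
  qed
  have "integral K f' = (\<integral>y. (\<integral>x. indicator K (slice_point i x y) *\<^sub>R f' (slice_point i x y) \<partial>lborel) \<partial>lborel)"
    unfolding I(3) by (rule integral_by_slices[OF ij I(2)])
  also have "\<dots> = (\<integral>y. (\<Sum>e\<in>es. sgn (n e $ i) * h e y) \<partial>lborel)"
  proof (rule integral_cong_AE)
    show "AE y in lborel. (\<integral>x. indicator K (slice_point i x y) *\<^sub>R f' (slice_point i x y) \<partial>lborel) = (\<Sum>e\<in>es. sgn (n e $ i) * h e y)"
      using ae by eventually_elim (rule slice)
    show "(\<lambda>y. \<Sum>e\<in>es. sgn (n e $ i) * h e y) \<in> borel_measurable lborel"
      using hint by (intro borel_measurable_sum borel_measurable_integrable)
    have "(\<lambda>z. (indicator K (slice_point i (snd z) (fst z)) *\<^sub>R f' (slice_point i (snd z) (fst z)) :: real)) \<in> borel_measurable (lborel \<Otimes>\<^sub>M lborel)"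
    proof -
      have "(\<lambda>z. slice_point i (snd z) (fst z)) \<in> (lborel \<Otimes>\<^sub>M lborel) \<rightarrow>\<^sub>M borel"
        using slice_point_measurable(2)[of i] by (simp cong: measurable_cong_sets)
      from measurable_compose[OF this borel_measurable_integrable[OF I(2), unfolded measurable_lborel2]] show ?thesis .
    qed
    then have "(\<lambda>y. \<integral>x. (\<lambda>z. indicator K (slice_point i (snd z) (fst z)) *\<^sub>R f' (slice_point i (snd z) (fst z))) (y, x) \<partial>lborel) \<in> borel_measurable lborel"
      by (intro lborel.borel_measurable_lebesgue_integral) (simp add: case_prod_unfold)
    then show "(\<lambda>y. \<integral>x. indicator K (slice_point i x y) *\<^sub>R f' (slice_point i x y) \<partial>lborel) \<in> borel_measurable lborel"
      by simp
  qed
  also have "\<dots> = (\<Sum>e\<in>es. \<integral>y. sgn (n e $ i) * h e y \<partial>lborel)"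
    by (rule Bochner_Integration.integral_sum) (rule hint)
  also have "\<dots> = (\<Sum>e\<in>es. edge_length e * n e $ i * integral {0..1} (\<lambda>t. f (fst e + t *\<^sub>R (snd e - fst e))))"
    by (intro sum.cong refl hval)
  finally show ?thesis .
qed

section \<open>Polynomials and cell averages\<close>

lemma state_components: "Dc U = fst U" "mc U = fst (snd U)" "Bc U = fst (snd (snd U))" "Ec U = snd (snd (snd U))"
  by (cases U; simp)+

lemma linear_components: "linear Dc" "linear mc" "linear Bc" "linear Ec"
  by (rule linearI; simp add: state_components)+

lemma poly_le_linear:
  assumes "linear h" "poly_le k f"
  shows "poly_le k (\<lambda>x. h (f x))"
proof -
  obtain c where "\<And>x. f x = (\<Sum>i\<le>k. \<Sum>j\<le>k - i. ((x $ 1) ^ i * (x $ 2) ^ j) *\<^sub>R c i j)"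
    using assms(2) unfolding poly_le_def by auto
  then have "h (f x) = (\<Sum>i\<le>k. \<Sum>j\<le>k - i. ((x $ 1) ^ i * (x $ 2) ^ j) *\<^sub>R h (c i j))" for x
    using assms(1) by (simp add: linear_sum linear_scale)
  then show ?thesis unfolding poly_le_def by (intro exI[of _ "\<lambda>i j. h (c i j)"]) auto
qed

lemma poly_le_add:
  assumes "poly_le k f" "poly_le k g"
  shows "poly_le k (\<lambda>x. f x + g x)"
proof -
  obtain c d where "\<And>x. f x = (\<Sum>i\<le>k. \<Sum>j\<le>k - i. ((x $ 1) ^ i * (x $ 2) ^ j) *\<^sub>R c i j)"
    "\<And>x. g x = (\<Sum>i\<le>k. \<Sum>j\<le>k - i. ((x $ 1) ^ i * (x $ 2) ^ j) *\<^sub>R d i j)"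
    using assms unfolding poly_le_def by auto
  then have "f x + g x = (\<Sum>i\<le>k. \<Sum>j\<le>k - i. ((x $ 1) ^ i * (x $ 2) ^ j) *\<^sub>R (c i j + d i j))" for x
    by (simp add: sum.distrib scaleR_add_right)
  then show ?thesis unfolding poly_le_def by (intro exI[of _ "\<lambda>i j. c i j + d i j"]) auto
qed

lemma poly_le_scaleR: "poly_le k f \<Longrightarrow> poly_le k (\<lambda>x. r *\<^sub>R f x)"
  by (rule poly_le_linear) (auto intro: linearI simp: scaleR_add_right)

lemma poly_le_const: "poly_le k (\<lambda>x. a)"
proof -
  have "(\<Sum>i\<le>k. \<Sum>j\<le>k - i. ((x $ 1) ^ i * (x $ 2) ^ j) *\<^sub>R (if i = 0 then if j = 0 then a else 0 else 0)) = a" for x :: point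
  proof -
    have "(\<Sum>i\<le>k. \<Sum>j\<le>k - i. ((x $ 1) ^ i * (x $ 2) ^ j) *\<^sub>R (if i = 0 then if j = 0 then a else 0 else 0))
      = (\<Sum>i\<le>k. if i = 0 then a else 0)"
    proof (intro sum.cong refl)
      fix i assume "i \<in> {..k}"
      show "(\<Sum>j\<le>k - i. ((x $ 1) ^ i * (x $ 2) ^ j) *\<^sub>R (if i = 0 then if j = 0 then a else 0 else 0)) = (if i = 0 then a else 0)"
      proof (cases "i = 0")
        case True
        have "(\<Sum>j\<le>k. (x $ 2) ^ j *\<^sub>R (if j = 0 then a else 0)) = (\<Sum>j\<le>k. if j = 0 then a else 0)"
          by (intro sum.cong) auto
        then show ?thesis using True by (simp add: sum.delta)
      qed simp
    qed
    then show ?thesis by (simp add: sum.delta)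
  qed
  then show ?thesis unfolding poly_le_def by (intro exI[of _ "\<lambda>i j. if i = 0 then if j = 0 then a else 0 else 0"]) auto
qed

lemma poly_le_sum: "(\<And>l. l \<in> L \<Longrightarrow> poly_le k (f l)) \<Longrightarrow> poly_le k (\<lambda>x. \<Sum>l\<in>L. f l x)"
  by (induction L rule: infinite_finite_induct) (auto intro: poly_le_const poly_le_add)

lemma poly_le_inner:
  fixes f :: "point \<Rightarrow> 'a::real_inner"
  shows "poly_le k f \<Longrightarrow> poly_le k (\<lambda>x. f x \<bullet> b)"
  by (rule poly_le_linear) (auto intro: linearI simp: inner_add_left)

lemma poly_le_C1:
  fixes f :: "point \<Rightarrow> 'b::real_normed_vector"
  assumes "poly_le k f"
  shows "f differentiable (at x)" "continuous_on UNIV (partial i f)"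
proof -
  obtain c where c: "\<And>x. f x = (\<Sum>i\<le>k. \<Sum>j\<le>k - i. ((x $ 1) ^ i * (x $ 2) ^ j) *\<^sub>R c i j)"
    using assms unfolding poly_le_def by auto
  define f' where "f' x h = (\<Sum>i\<le>k. \<Sum>j\<le>k - i. (real i * (x $ 1) ^ (i - 1) * (h $ 1) * (x $ 2) ^ j
     + (x $ 1) ^ i * (real j * (x $ 2) ^ (j - 1) * (h $ 2))) *\<^sub>R c i j)" for x h :: point
  have comp: "((\<lambda>x::point. x $ l) has_derivative (\<lambda>h. h $ l)) (at x)" for l x
    by (intro bounded_linear_imp_has_derivative bounded_linear_vec_nth)
  have mono: "((\<lambda>x::point. (x $ 1) ^ i * (x $ 2) ^ j) has_derivative
     (\<lambda>h. real i * (x $ 1) ^ (i - 1) * (h $ 1) * (x $ 2) ^ j + (x $ 1) ^ i * (real j * (x $ 2) ^ (j - 1) * (h $ 2)))) (at x)" for i j x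
    using has_derivative_mult[OF has_derivative_power[OF comp[of 1 x], of i] has_derivative_power[OF comp[of 2 x], of j]]
    by (simp add: algebra_simps)
  have D: "(f has_derivative f' x) (at x)" for x
  proof -
    have "((\<lambda>x. \<Sum>i\<le>k. \<Sum>j\<le>k - i. ((x $ 1) ^ i * (x $ 2) ^ j) *\<^sub>R c i j) has_derivative f' x) (at x)"
      unfolding f'_def by (intro has_derivative_sum has_derivative_scaleR_left mono)
    then show ?thesis using c by presburger
  qed
  then show "f differentiable (at x)" unfolding differentiable_def by auto
  have "partial i f = (\<lambda>x. f' x (axis i 1))"
    unfolding partial_def using frechet_derivative_at[OF D] by auto
  moreover have "continuous_on UNIV (\<lambda>x. f' x (axis i 1))"
    unfolding f'_def by (intro continuous_intros)
  ultimately show "continuous_on UNIV (partial i f)" by simp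
qed

lemma poly_le_continuous:
  fixes f :: "point \<Rightarrow> 'b::real_normed_vector"
  assumes "poly_le k f"
  shows "continuous_on S f"
  using poly_le_C1(1)[OF assms] by (simp add: continuous_at_imp_continuous_on differentiable_imp_continuous_within)

lemma partial_linear:
  fixes f :: "point \<Rightarrow> 'a::real_normed_vector"
  assumes "bounded_linear h" "f differentiable (at x)"
  shows "partial i (\<lambda>y. h (f y)) x = h (partial i f x)"
proof -
  have "(f has_derivative frechet_derivative f (at x)) (at x)" using assms(2) by (simp add: frechet_derivative_works)
  then have "((\<lambda>y. h (f y)) has_derivative (\<lambda>v. h (frechet_derivative f (at x) v))) (at x)"
    by (rule bounded_linear.has_derivative[OF assms(1)])
  from frechet_derivative_at[OF this] show ?thesis unfolding partial_def by metis
qed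

lemma partial_add:
  fixes f g :: "point \<Rightarrow> 'a::real_normed_vector"
  assumes "f differentiable (at x)" "g differentiable (at x)"
  shows "partial i (\<lambda>y. f y + g y) x = partial i f x + partial i g x"
proof -
  have "((\<lambda>y. f y + g y) has_derivative (\<lambda>v. frechet_derivative f (at x) v + frechet_derivative g (at x) v)) (at x)"
    using assms by (intro has_derivative_add) (simp_all add: frechet_derivative_works)
  from frechet_derivative_at[OF this] show ?thesis unfolding partial_def by metis
qed

lemma partial_const: "partial i (\<lambda>y. a) x = 0"
  unfolding partial_def by simp

lemma slice_derivative:
  fixes f :: "point \<Rightarrow> real"
  assumes "f differentiable (at (slice_point i x y))"
  shows "((\<lambda>t. f (slice_point i t y)) has_real_derivative partial i f (slice_point i x y)) (at x)"
proof -
  obtain j where "i \<noteq> (j::2)" by (metis exhaust_2 one_neq_zero zero_neq_one)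
  note eq = slice_point_eq[OF this]
  let ?f' = "frechet_derivative f (at (slice_point i x y))"
  have f: "(f has_derivative ?f') (at (slice_point i x y))" using assms by (simp add: frechet_derivative_works)
  have "((\<lambda>t. slice_point i t y) has_derivative (\<lambda>h. h *\<^sub>R axis i 1)) (at x)"
    unfolding eq by (auto intro!: derivative_eq_intros)
  from has_derivative_compose[OF this f]
  have "((\<lambda>t. f (slice_point i t y)) has_derivative (\<lambda>h. ?f' (h *\<^sub>R axis i 1))) (at x)" .
  moreover have "?f' (h *\<^sub>R axis i 1) = partial i f (slice_point i x y) * h" for h
    unfolding partial_def using linear_scale[OF has_derivative_linear[OF f]] by simp
  ultimately show ?thesis by (simp add: has_field_derivative_def)
qed

section \<open>Gauss quadrature on edges and the divergence theorem\<close>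

lemma poly_le_on_line:
  fixes f :: "point \<Rightarrow> real"
  assumes "poly_le k f"
  obtains P where "degree P \<le> k" "\<And>t. poly P t = f (a + t *\<^sub>R d)"
proof -
  obtain c where c: "\<And>x. f x = (\<Sum>i\<le>k. \<Sum>j\<le>k - i. ((x $ 1) ^ i * (x $ 2) ^ j) *\<^sub>R c i j)"
    using assms unfolding poly_le_def by auto
  define P where "P = (\<Sum>i\<le>k. \<Sum>j\<le>k - i. smult (c i j) ([:a $ 1, d $ 1:] ^ i * [:a $ 2, d $ 2:] ^ j))"
  have "degree P \<le> k" unfolding P_def
  proof (intro degree_sum_le finite_atMost)
    fix i j assume ij: "i \<in> {..k}" "j \<in> {..k - i}"
    have lin: "degree ([:u, v:] ^ m) \<le> m" for u v :: real and m
      using degree_power_le[of "[:u, v:]" m] by (auto split: if_splits)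
    have "degree ([:a $ 1, d $ 1:] ^ i * [:a $ 2, d $ 2:] ^ j) \<le> i + j"
      by (rule order_trans[OF degree_mult_le]) (intro add_mono lin)
    also have "i + j \<le> k" using ij by auto
    finally show "degree (smult (c i j) ([:a $ 1, d $ 1:] ^ i * [:a $ 2, d $ 2:] ^ j)) \<le> k"
      by (rule order_trans[OF degree_smult_le])
  qed
  moreover have "poly P t = f (a + t *\<^sub>R d)" for t
    unfolding P_def c by (simp add: poly_sum mult_ac)
  ultimately show ?thesis using that by blast
qed

lemma gauss_edge:
  fixes f :: "point \<Rightarrow> real"
  assumes "gauss_rule (k + 1) (gauss_x M) (gauss_w M)" "poly_le k f"
  shows "integral {0..1} (\<lambda>t. f (fst e + t *\<^sub>R (snd e - fst e))) = (\<Sum>q=1..k+1. gauss_w M q * f (edge_point M e q))"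
proof -
  obtain P where P: "degree P \<le> k" "\<And>t. poly P t = f (fst e + t *\<^sub>R (snd e - fst e))"
    using poly_le_on_line[OF assms(2)] by metis
  have "degree P \<le> 2 * (k + 1) - 1" using P(1) by simp
  then have "integral {0..1} (poly P) = (\<Sum>q=1..k+1. gauss_w M q * poly P (gauss_x M q))"
    using assms(1) unfolding gauss_rule_def by blast
  moreover have "poly P = (\<lambda>t. f (fst e + t *\<^sub>R (snd e - fst e)))" using P(2) by auto
  ultimately show ?thesis unfolding edge_point_def by simp
qed

text \<open>The normal is constant on an edge, so the integrand has degree at most \<open>k\<close>
  and the Gauss rule, exact to degree 2 k + 1, loses nothing. Zero divergence inside the cell
  thereby acts on the quadrature sums of the scheme.\<close>

lemma polygon_gauss_divergence:
  fixes f :: "point \<Rightarrow> real"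
  assumes K: "polygon K es" and n: "\<And>e. e \<in> es \<Longrightarrow> outward_unit_normal K e (n e)"
    and g: "gauss_rule (k + 1) (gauss_x M) (gauss_w M)" and f: "poly_le k f"
  shows "(\<Sum>e\<in>es. edge_length e * (\<Sum>q=1..k+1. gauss_w M q * (n e $ i * f (edge_point M e q)))) = integral K (partial i f)"
proof -
  have "integral K (partial i f) = (\<Sum>e\<in>es. edge_length e * n e $ i * (\<Sum>q=1..k+1. gauss_w M q * f (edge_point M e q)))"
    unfolding gauss_edge[OF g f, symmetric]
    by (rule polygon_divergence[OF K n poly_le_continuous[OF f] poly_le_C1(2)[OF f]])
      (assumption, rule slice_derivative, rule poly_le_C1(1)[OF f])
  then show ?thesis by (simp only: sum_distrib_left mult_ac)
qed

lemma polygon_compact: "polygon K es \<Longrightarrow> compact K"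
  unfolding polygon_def by simp

lemma polygon_interior: "polygon K es \<Longrightarrow> interior K \<noteq> {}"
  unfolding polygon_def by force

lemma polygon_area_pos:
  assumes "polygon K es"
  shows "area K > 0"
proof -
  obtain x r where x: "r > 0" "cball x r \<subseteq> K"
    using polygon_interior[OF assms] by (meson equals0I mem_interior_cball)
  have "0 < measure lebesgue (cball x r)" using x by (simp add: content_cball_pos)
  also have "\<dots> \<le> measure lebesgue K"
    by (rule measure_mono_fmeasurable[OF x(2)]) (auto intro: lmeasurable_compact polygon_compact[OF assms])
  finally show ?thesis unfolding area_def .
qed

lemma cell_average_linear:
  assumes "polygon K es" "poly_le k f" "linear h"
  shows "cell_average K (\<lambda>x. h (f x)) = h (cell_average K f)"
proof -
  have h: "bounded_linear h" using assms(3) by (simp add: linear_conv_bounded_linear)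
  have "f integrable_on K"
    by (rule compact_integrals(1)[OF polygon_compact[OF assms(1)] poly_le_continuous[OF assms(2)]])
  then have "integral K (h \<circ> f) = h (integral K f)"
    by (rule integral_linear[OF _ h])
  then show ?thesis unfolding cell_average_def using assms(3) by (simp add: o_def linear_scale)
qed

lemma cell_average_add:
  assumes "polygon K es" "poly_le k f" "poly_le k g"
  shows "cell_average K (\<lambda>x. f x + g x) = cell_average K f + cell_average K g"
proof -
  have "f integrable_on K" "g integrable_on K"
    using compact_integrals(1)[OF polygon_compact[OF assms(1)] poly_le_continuous] assms by blast+
  then show ?thesis unfolding cell_average_def by (simp add: Henstock_Kurzweil_Integration.integral_add scaleR_add_right)
qed

lemma cell_average_const:
  assumes "polygon K es"
  shows "cell_average K (\<lambda>x. a) = a"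
proof -
  have K: "K \<in> lmeasurable" using polygon_compact[OF assms] by (rule lmeasurable_compact)
  have c: "((\<lambda>x. 1::real) has_integral measure lebesgue K) K"
    unfolding lmeasure_integral[OF K]
    by (intro integrable_integral compact_integrals(1)[OF polygon_compact[OF assms]] continuous_on_const)
  have "((\<lambda>x. 1 *\<^sub>R a) has_integral measure lebesgue K *\<^sub>R a) K"
    using has_integral_scaleR_left[OF c] .
  then have "integral K (\<lambda>x. a) = measure lebesgue K *\<^sub>R a" by (simp add: integral_unique)
  then show ?thesis using polygon_area_pos[OF assms] unfolding cell_average_def area_def by simp
qed

lemma cell_average_sum:
  assumes "polygon K es" "\<And>l. l \<in> L \<Longrightarrow> poly_le k (f l)"
  shows "cell_average K (\<lambda>x. \<Sum>l\<in>L. f l x) = (\<Sum>l\<in>L. cell_average K (f l))"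
  using assms(2)
proof (induction L rule: infinite_finite_induct)
  case (insert l L)
  then have "cell_average K (\<lambda>x. f l x + (\<Sum>l\<in>L. f l x)) = cell_average K (f l) + cell_average K (\<lambda>x. \<Sum>l\<in>L. f l x)"
    by (intro cell_average_add[OF assms(1)] poly_le_sum) auto
  then show ?case using insert by simp
qed (simp_all add: cell_average_const[OF assms(1)])

lemma cell_average_quadrature:
  fixes f :: "point \<Rightarrow> 'a::euclidean_space"
  assumes "polygon K (edges M K)" "special_quadrature M k K" "poly_le k f"
  shows "cell_average K f = (\<Sum>e\<in>edges M K. \<Sum>q=1..k+1. dec_edge_w M K e q *\<^sub>R f (edge_point M e q))
          + (\<Sum>q=1..dec_Q M K. dec_w M K q *\<^sub>R f (dec_x M K q))"
proof (rule euclidean_eqI)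
  fix b :: 'a
  have "cell_average K f \<bullet> b = cell_average K (\<lambda>x. f x \<bullet> b)"
    using cell_average_linear[OF assms(1,3), of "\<lambda>v. v \<bullet> b"] by (simp add: linearI inner_add_left)
  also have "\<dots> = (\<Sum>e\<in>edges M K. \<Sum>q=1..k+1. dec_edge_w M K e q * (f (edge_point M e q) \<bullet> b))
          + (\<Sum>q=1..dec_Q M K. dec_w M K q * (f (dec_x M K q) \<bullet> b))"
    using assms(2) poly_le_inner[OF assms(3), of b] unfolding special_quadrature_def by blast
  finally show "cell_average K f \<bullet> b = ((\<Sum>e\<in>edges M K. \<Sum>q=1..k+1. dec_edge_w M K e q *\<^sub>R f (edge_point M e q))
          + (\<Sum>q=1..dec_Q M K. dec_w M K q *\<^sub>R f (dec_x M K q))) \<bullet> b"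
    by (simp only: inner_add_left inner_sum_left inner_scaleR_left)
qed

section \<open>Existence of the discrete operator\<close>

text \<open>\<open>V\<close> lies in the span of the generators, which need not belong to
  \<open>V\<close>, and \<open>B\<close> may be degenerate; hence an induction on the number of
  generators. \<open>V'\<close> drops one generator, a vector with a nonzero coefficient there is
  made orthogonal to \<open>V'\<close>, and the solution on \<open>V'\<close> is corrected along it.
  The functional is generalized because the induction hypothesis is used for \<open>J\<close> and
  for \<open>B v\<close>.\<close>

lemma riesz_finite_span:
  fixes B :: "('x \<Rightarrow> 'b::real_vector) \<Rightarrow> ('x \<Rightarrow> 'b) \<Rightarrow> real"
  assumes "finite G"
    and "(\<lambda>x. 0) \<in> V" and "\<And>u w r. u \<in> V \<Longrightarrow> w \<in> V \<Longrightarrow> (\<lambda>x. u x + r *\<^sub>R w x) \<in> V"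
    and "\<And>u. u \<in> V \<Longrightarrow> \<exists>a. \<forall>x. u x = (\<Sum>s\<in>G. a s *\<^sub>R g s x)"
    and "\<And>u w. u \<in> V \<Longrightarrow> w \<in> V \<Longrightarrow> B u w = B w u"
    and "\<And>u w z r. u \<in> V \<Longrightarrow> w \<in> V \<Longrightarrow> z \<in> V \<Longrightarrow> B (\<lambda>x. u x + r *\<^sub>R w x) z = B u z + r * B w z"
    and "\<And>u w. u \<in> V \<Longrightarrow> w \<in> V \<Longrightarrow> B u u = 0 \<Longrightarrow> B w u = 0"
    and "\<And>u w r. u \<in> V \<Longrightarrow> w \<in> V \<Longrightarrow> J (\<lambda>x. u x + r *\<^sub>R w x) = J u + r * J w"
    and "\<And>u. u \<in> V \<Longrightarrow> B u u = 0 \<Longrightarrow> J u = 0"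
  shows "\<exists>L\<in>V. \<forall>u\<in>V. B L u = J u"
  using assms
proof (induction G arbitrary: V J rule: finite_induct)
  case (empty V J)
  let ?z = "\<lambda>x::'x. 0::'b"
  have V: "u = ?z" if "u \<in> V" for u using empty.prems(3)[OF that] by auto
  have "B ?z ?z = 0" using empty.prems(5)[OF empty.prems(1,1,1), of "-1"] by simp
  moreover from this have "J ?z = 0" using empty.prems(8)[OF empty.prems(1)] by simp
  ultimately show ?case using V empty.prems(1) by (metis (no_types, lifting))
next
  case (insert t G V J)
  note zero = insert.prems(1) and lin = insert.prems(2) and gen = insert.prems(3) and sym = insert.prems(4)
    and Blin = insert.prems(5) and Bnull = insert.prems(6) and Jlin = insert.prems(7) and Jnull = insert.prems(8)
  define V' where "V' = {u \<in> V. \<exists>a. \<forall>x. u x = (\<Sum>s\<in>G. a s *\<^sub>R g s x)}"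
  have sub: "u \<in> V" if "u \<in> V'" for u using that unfolding V'_def by auto
  have zero': "(\<lambda>x. 0) \<in> V'" unfolding V'_def using zero by (auto intro!: exI[of _ "\<lambda>s. 0"])
  have lin': "(\<lambda>x. u x + r *\<^sub>R w x) \<in> V'" if uw: "u \<in> V'" "w \<in> V'" for u w r
  proof -
    obtain a b where "\<forall>x. u x = (\<Sum>s\<in>G. a s *\<^sub>R g s x)" "\<forall>x. w x = (\<Sum>s\<in>G. b s *\<^sub>R g s x)"
      using uw unfolding V'_def by auto
    then have "u x + r *\<^sub>R w x = (\<Sum>s\<in>G. (a s + r * b s) *\<^sub>R g s x)" for x
      by (simp add: scaleR_add_left sum.distrib scaleR_sum_right)
    then show ?thesis unfolding V'_def using lin[OF sub[OF uw(1)] sub[OF uw(2)], of r]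
      by (auto intro!: exI[of _ "\<lambda>s. a s + r * b s"])
  qed
  have IH: "\<exists>L\<in>V'. \<forall>u\<in>V'. B L u = J' u"
    if J': "\<And>u w r. u \<in> V \<Longrightarrow> w \<in> V \<Longrightarrow> J' (\<lambda>x. u x + r *\<^sub>R w x) = J' u + r * J' w"
      "\<And>u. u \<in> V \<Longrightarrow> B u u = 0 \<Longrightarrow> J' u = 0" for J'
  proof (rule insert.IH)
    show "\<exists>a. \<forall>x. u x = (\<Sum>s\<in>G. a s *\<^sub>R g s x)" if "u \<in> V'" for u using that unfolding V'_def by auto
    show "(\<lambda>x. 0) \<in> V'" by (rule zero')
    show "(\<lambda>x. u x + r *\<^sub>R w x) \<in> V'" if "u \<in> V'" "w \<in> V'" for u w r by (rule lin'[OF that])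
    show "B u w = B w u" if "u \<in> V'" "w \<in> V'" for u w using that by (intro sym sub)
    show "B (\<lambda>x. u x + r *\<^sub>R w x) z = B u z + r * B w z" if "u \<in> V'" "w \<in> V'" "z \<in> V'" for u w z r
      using that by (intro Blin sub)
    show "B w u = 0" if "u \<in> V'" "w \<in> V'" "B u u = 0" for u w by (rule Bnull[OF sub[OF that(1)] sub[OF that(2)] that(3)])
    show "J' (\<lambda>x. u x + r *\<^sub>R w x) = J' u + r * J' w" if "u \<in> V'" "w \<in> V'" for u w r
      using that by (intro J'(1) sub)
    show "J' u = 0" if "u \<in> V'" "B u u = 0" for u by (rule J'(2)[OF sub[OF that(1)] that(2)])
  qed
  obtain L where L: "L \<in> V'" "\<And>u. u \<in> V' \<Longrightarrow> B L u = J u" using IH[where J'=J] Jlin Jnull by metis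
  show ?case
  proof (cases "\<exists>v\<in>V. \<exists>a. a t \<noteq> 0 \<and> (\<forall>x. v x = (\<Sum>s\<in>insert t G. a s *\<^sub>R g s x))")
    case False
    have "V \<subseteq> V'"
    proof
      fix u assume u: "u \<in> V"
      then obtain a where a: "\<forall>x. u x = (\<Sum>s\<in>insert t G. a s *\<^sub>R g s x)" using gen by blast
      then have "a t = 0" using False u by blast
      then show "u \<in> V'" unfolding V'_def using u a insert.hyps by (auto intro!: exI[of _ a])
    qed
    then show ?thesis using L sub by blast
  next
    case True
    then obtain v a where v: "v \<in> V" "a t \<noteq> 0" "\<And>x. v x = (\<Sum>s\<in>insert t G. a s *\<^sub>R g s x)" by blast
    have "\<exists>P\<in>V'. \<forall>u\<in>V'. B P u = B v u"
    proof (rule IH)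
      show "B v (\<lambda>x. u x + r *\<^sub>R w x) = B v u + r * B v w" if "u \<in> V" "w \<in> V" for u w r
        using Blin[OF that v(1), of r] sym v(1) that lin[OF that, of r] by simp
      show "B v u = 0" if "u \<in> V" "B u u = 0" for u by (rule Bnull[OF that(1) v(1) that(2)])
    qed
    then obtain P where P: "P \<in> V'" "\<And>u. u \<in> V' \<Longrightarrow> B P u = B v u" by metis
    define r where "r = (\<lambda>x. v x + (-1) *\<^sub>R P x)"
    have r: "r \<in> V" unfolding r_def by (rule lin[OF v(1) sub[OF P(1)]])
    have r_orth: "B r u = 0" "B u r = 0" if "u \<in> V'" for u
    proof -
      show "B r u = 0" unfolding r_def using Blin[OF v(1) sub[OF P(1)] sub[OF that], of "-1"] P(2)[OF that] by simp
      then show "B u r = 0" using sym[OF sub[OF that] r] by simp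
    qed
    \<comment> \<open>If \<open>B r r = 0\<close> the quotient is 0 by convention; then
      \<open>B L' r\<close> and \<open>J r\<close> are both 0 and the equation along
      \<open>r\<close> still holds.\<close>
    define c where "c = (J r - B L r) / B r r"
    define L' where "L' = (\<lambda>x. L x + c *\<^sub>R r x)"
    have L': "L' \<in> V" unfolding L'_def by (rule lin[OF sub[OF L(1)] r])
    have L'_V': "B L' u = J u" if "u \<in> V'" for u
      unfolding L'_def using Blin[OF sub[OF L(1)] r sub[OF that], of c] r_orth(1)[OF that] L(2)[OF that] by simp
    have L'_r: "B L' r = J r"
    proof (cases "B r r = 0")
      case True
      then show ?thesis using Bnull[OF r L'] Jnull[OF r] by simp
    next
      case False
      then show ?thesis unfolding L'_def using Blin[OF sub[OF L(1)] r r, of c] by (simp add: c_def)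
    qed
    have "B L' u = J u" if u: "u \<in> V" for u
    proof -
      obtain b where b: "\<forall>x. u x = (\<Sum>s\<in>insert t G. b s *\<^sub>R g s x)" using gen[OF u] by blast
      \<comment> \<open>Cancels the coefficient of \<open>t\<close>: \<open>P\<close> has none, so
        \<open>r\<close> carries \<open>a t\<close>.\<close>
      define d where "d = b t / a t"
      define w where "w = (\<lambda>x. u x + (- d) *\<^sub>R r x)"
      have wV: "w \<in> V" unfolding w_def by (rule lin[OF u r])
      obtain p where p: "\<forall>x. P x = (\<Sum>s\<in>G. p s *\<^sub>R g s x)" using P(1) unfolding V'_def by auto
      have "w x = (\<Sum>s\<in>G. (b s - d * a s + d * p s) *\<^sub>R g s x)" for x
      proof -
        have "w x = (b t - d * a t) *\<^sub>R g t x + (\<Sum>s\<in>G. (b s - d * a s + d * p s) *\<^sub>R g s x)"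
          unfolding w_def r_def v(3) using b p insert.hyps
          by (simp add: scaleR_add_left scaleR_diff_left scaleR_add_right scaleR_diff_right sum.distrib sum_subtractf sum_negf scaleR_sum_right)
        then show ?thesis using v(2) unfolding d_def by simp
      qed
      then have w: "w \<in> V'" unfolding V'_def using wV by (auto intro!: exI[of _ "\<lambda>s. b s - d * a s + d * p s"])
      have u_eq: "u = (\<lambda>x. w x + d *\<^sub>R r x)" unfolding w_def by auto
      have "B L' u = B u L'" by (rule sym[OF L' u])
      also have "\<dots> = B w L' + d * B r L'" by (subst u_eq) (rule Blin[OF wV r L'])
      also have "\<dots> = B L' w + d * B L' r" using sym L' wV r by simp
      also have "\<dots> = J w + d * J r" using L'_V'[OF w] L'_r by simp
      also have "\<dots> = J u" using Jlin[OF wV r, of d] unfolding u_eq[symmetric] by simp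
      finally show ?thesis .
    qed
    then show ?thesis using L' by blast
  qed
qed

lemma poly_le_span:
  fixes f :: "point \<Rightarrow> 'b::euclidean_space"
  assumes "poly_le k f"
  defines "G \<equiv> (SIGMA i:{..k}. SIGMA j:{..k - i}. (Basis :: 'b set))"
  shows "\<exists>a. \<forall>x. f x = (\<Sum>s\<in>G. a s *\<^sub>R (\<lambda>(i, j, b) x. ((x $ 1) ^ i * (x $ 2) ^ j) *\<^sub>R b) s x)"
proof -
  obtain c where c: "\<And>x. f x = (\<Sum>i\<le>k. \<Sum>j\<le>k - i. ((x $ 1) ^ i * (x $ 2) ^ j) *\<^sub>R c i j)"
    using assms unfolding poly_le_def by auto
  define a where "a = (\<lambda>(i, j, b). c i j \<bullet> b)"
  have "f x = (\<Sum>s\<in>G. a s *\<^sub>R (\<lambda>(i, j, b) x. ((x $ 1) ^ i * (x $ 2) ^ j) *\<^sub>R b) s x)" for x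
  proof -
    have "f x = (\<Sum>i\<le>k. \<Sum>j\<le>k - i. \<Sum>b\<in>Basis. (c i j \<bullet> b) *\<^sub>R (((x $ 1) ^ i * (x $ 2) ^ j) *\<^sub>R b))"
    proof -
      have "((x $ 1) ^ i * (x $ 2) ^ j) *\<^sub>R c i j = (\<Sum>b\<in>Basis. (c i j \<bullet> b) *\<^sub>R (((x $ 1) ^ i * (x $ 2) ^ j) *\<^sub>R b))" for i j
        by (subst euclidean_representation[of "c i j", symmetric]) (simp add: scaleR_sum_right mult_ac del: euclidean_representation)
      then show ?thesis unfolding c by simp
    qed
    then show ?thesis unfolding G_def a_def by (simp add: sum.Sigma case_prod_unfold)
  qed
  then show ?thesis by blast
qed

section \<open>The variational problem on one cell\<close>

definition divB :: "(point \<Rightarrow> state) \<Rightarrow> point \<Rightarrow> real" where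
  "divB f x = partial 1 (\<lambda>y. Bc (f y) $ 1) x + partial 2 (\<lambda>y. Bc (f y) $ 2) x"

text \<open>\<open>Wh\<close> imposes its conditions cell by cell, so the problem defining
  \<open>L_h\<close> decouples into one problem in each of these spaces.\<close>

definition cell_space :: "nat \<Rightarrow> cell \<Rightarrow> (point \<Rightarrow> state) set" where
  "cell_space k K = {f. poly_le k f \<and> (\<forall>x\<in>K. divB f x = 0)}"

lemma Wh_iff: "u \<in> Wh M k \<longleftrightarrow> (\<forall>K\<in>cells M. u K \<in> cell_space k K)"
  by (simp add: Wh_def cell_space_def divB_def)

lemma linear_Bc_nth: "linear (\<lambda>U. Bc U $ l)"
  using linear_components(3) by (auto intro!: linearI simp: linear_add linear_scale)

lemma poly_le_Bc_nth: "poly_le k f \<Longrightarrow> poly_le k (\<lambda>y. Bc (f y) $ l)"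
  by (rule poly_le_linear[OF linear_Bc_nth])

lemma divB_affine:
  assumes "poly_le k g" "\<And>y. Bc (f y) = \<theta> *\<^sub>R Bc (g y) + c"
  shows "divB f x = \<theta> * divB g x"
proof -
  have "partial i (\<lambda>y. Bc (f y) $ l) x = \<theta> * partial i (\<lambda>y. Bc (g y) $ l) x" for i l
  proof -
    have d: "(\<lambda>y. Bc (g y) $ l) differentiable (at x)" by (rule poly_le_C1(1)[OF poly_le_Bc_nth[OF assms(1)]])
    have "(\<lambda>y. Bc (f y) $ l) = (\<lambda>y. \<theta> * Bc (g y) $ l + c $ l)" using assms(2) by auto
    moreover have "partial i (\<lambda>y. \<theta> * Bc (g y) $ l + c $ l) x
       = partial i (\<lambda>y. \<theta> * Bc (g y) $ l) x + partial i (\<lambda>y. c $ l) x"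
      by (rule partial_add) (use d in auto)
    ultimately show ?thesis
      using partial_linear[OF bounded_linear_mult_right d, of i \<theta>] by (simp add: partial_const)
  qed
  then show ?thesis unfolding divB_def by (simp add: algebra_simps)
qed

lemma divB_add:
  assumes "poly_le k f" "poly_le k g"
  shows "divB (\<lambda>y. f y + g y) x = divB f x + divB g x"
proof -
  have "partial i (\<lambda>y. Bc (f y + g y) $ l) x = partial i (\<lambda>y. Bc (f y) $ l) x + partial i (\<lambda>y. Bc (g y) $ l) x" for i l
    unfolding linear_add[OF linear_Bc_nth]
    by (rule partial_add[OF poly_le_C1(1)[OF poly_le_Bc_nth[OF assms(1)]] poly_le_C1(1)[OF poly_le_Bc_nth[OF assms(2)]]])
  then show ?thesis unfolding divB_def by simp
qed

text \<open>Made for the limiter, which changes the magnetic field of a cell by a constant factor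
  and a constant shift; both preserve zero divergence.\<close>

lemma cell_space_affine:
  assumes "g \<in> cell_space k K" "poly_le k f" "\<And>y. Bc (f y) = \<theta> *\<^sub>R Bc (g y) + c"
  shows "f \<in> cell_space k K"
  using assms divB_affine[OF _ assms(3)] unfolding cell_space_def by auto

lemma cell_space_scaleR: "f \<in> cell_space k K \<Longrightarrow> (\<lambda>x. r *\<^sub>R f x) \<in> cell_space k K"
  by (rule cell_space_affine[where \<theta>=r and c=0])
    (auto simp: cell_space_def linear_scale[OF linear_components(3)] intro: poly_le_scaleR)

lemma cell_space_add: "f \<in> cell_space k K \<Longrightarrow> g \<in> cell_space k K \<Longrightarrow> (\<lambda>x. f x + g x) \<in> cell_space k K"
  by (auto simp: cell_space_def divB_add intro: poly_le_add)

lemma cell_space_const: "(\<lambda>x. c) \<in> cell_space k K"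
  unfolding cell_space_def divB_def by (simp add: poly_le_const partial_const)

lemma cell_space_sum: "(\<And>l. l \<in> L \<Longrightarrow> f l \<in> cell_space k K) \<Longrightarrow> (\<lambda>x. \<Sum>l\<in>L. f l x) \<in> cell_space k K"
  by (induction L rule: infinite_finite_induct) (auto intro: cell_space_const cell_space_add)

lemma cell_space_poly: "f \<in> cell_space k K \<Longrightarrow> poly_le k f"
  by (simp add: cell_space_def)

lemma edge_point_in_segment:
  assumes "gauss_rule (k + 1) (gauss_x M) (gauss_w M)" "q \<in> {1..k+1}"
  shows "edge_point M e q \<in> edge_seg e"
proof -
  have "gauss_x M q \<in> {0..1}" using assms unfolding gauss_rule_def by blast
  then show ?thesis unfolding edge_point_def edge_seg_def closed_segment_def
    by (auto simp: algebra_simps intro!: exI[of _ "gauss_x M q"])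
qed

lemma edge_seg_subset:
  assumes "polygon K es" "e \<in> es"
  shows "edge_seg e \<subseteq> K"
  using assms frontier_subset_closed[OF compact_imp_closed[OF polygon_compact[OF assms(1)]]]
  unfolding polygon_def by auto

text \<open>Supplies the null-space conditions of \<open>riesz_finite_span\<close>, since
  \<open>J_form\<close> sees values and first partial derivatives at points of \<open>K\<close>, the
  boundary included. Both vanish in the interior, and \<open>K\<close> is the closure of its
  interior.\<close>

lemma zero_square_integral:
  fixes f :: "point \<Rightarrow> state"
  assumes K: "polygon K es" and f: "poly_le k f" and int: "integral K (\<lambda>x. f x \<bullet> f x) = 0"
  shows "x \<in> K \<Longrightarrow> f x = 0" "x \<in> K \<Longrightarrow> partial i f x = 0"
proof -
  have ci: "closure (interior K) = K" using K unfolding polygon_def by simp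
  have cont: "continuous_on S f" for S by (rule poly_le_continuous[OF f])
  have c2: "continuous_on S (\<lambda>x. f x \<bullet> f x)" for S by (intro continuous_intros cont)
  have zero_int: "f x = 0" if x: "x \<in> interior K" for x
  proof -
    obtain a b where ab: "x \<in> box a b" "cbox a b \<subseteq> interior K"
      using open_contains_cbox[of "interior K" x] x by (metis open_interior)
    have sub: "cbox a b \<subseteq> K" using ab interior_subset by blast
    have I: "(\<lambda>x. f x \<bullet> f x) integrable_on cbox a b" "(\<lambda>x. f x \<bullet> f x) integrable_on K"
      by (rule integrable_continuous[OF c2]) (rule compact_integrals(1)[OF polygon_compact[OF K] c2])
    have "integral (cbox a b) (\<lambda>x. f x \<bullet> f x) \<le> integral K (\<lambda>x. f x \<bullet> f x)"
      by (rule integral_subset_le[OF sub I]) auto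
    moreover have "0 \<le> integral (cbox a b) (\<lambda>x. f x \<bullet> f x)"
      by (rule Henstock_Kurzweil_Integration.integral_nonneg[OF I(1)]) auto
    ultimately have "integral (cbox a b) (\<lambda>x. f x \<bullet> f x) = 0" using int by linarith
    then have "((\<lambda>x. f x \<bullet> f x) has_integral 0) (cbox a b)" using I(1) by (metis integrable_integral)
    then have "f x \<bullet> f x = 0"
      by (rule has_integral_0_cbox_imp_0[OF c2, rotated]) (use ab box_subset_cbox in auto)
    then show ?thesis by simp
  qed
  show "f x = 0" if "x \<in> K"
    using continuous_constant_on_closure[of "interior K" f 0 x] cont zero_int that unfolding ci by blast
  have "partial i f x = 0" if x: "x \<in> interior K" for x
  proof -
    have "((\<lambda>x. 0) has_derivative (\<lambda>h. 0)) (at x)" by simp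
    then have "(f has_derivative (\<lambda>h. 0)) (at x)"
      by (rule has_derivative_transform_within_open[OF _ open_interior x]) (simp add: zero_int)
    from frechet_derivative_at[OF this] show ?thesis unfolding partial_def by metis
  qed
  moreover have "continuous_on K (partial i f)"
    using poly_le_C1(2)[OF f] continuous_on_subset by blast
  ultimately show "partial i f x = 0" if "x \<in> K"
    using continuous_constant_on_closure[of "interior K" "partial i f" 0 x] that unfolding ci by blast
qed

lemma J_form_local: "J_form H M k K U u = J_form H M k K U (\<lambda>_. u K)"
  unfolding J_form_def by simp

lemma J_form_lin:
  assumes "poly_le k f" "poly_le k g"
  shows "J_form H M k K U (\<lambda>_ x. f x + r *\<^sub>R g x) = J_form H M k K U (\<lambda>_. f) + r * J_form H M k K U (\<lambda>_. g)"
proof -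
  have p: "partial i (\<lambda>x. f x + r *\<^sub>R g x) x = partial i f x + r *\<^sub>R partial i g x" for i x
    using partial_add[OF poly_le_C1(1)[OF assms(1), of x] poly_le_C1(1)[OF poly_le_scaleR[OF assms(2), of r], of x], where i=i]
      partial_linear[OF bounded_linear_scaleR_right[of r] poly_le_C1(1)[OF assms(2), of x], where i=i] by simp
  have v: "a \<bullet> (p + r *\<^sub>R q) + b \<bullet> (p' + r *\<^sub>R q') = (a \<bullet> p + b \<bullet> p') + r * (a \<bullet> q + b \<bullet> q')" for a b p q p' q' :: state
    by (simp add: inner_add_right algebra_simps)
  have w: "a \<bullet> (p + r *\<^sub>R q) = a \<bullet> p + r * (a \<bullet> q)" for a p q :: state
    by (simp add: inner_add_right)
  have t: "(\<Sum>s\<in>S. c s * (a s + r * b s)) = (\<Sum>s\<in>S. c s * a s) + r * (\<Sum>s\<in>S. c s * b s)" for S :: "edge set" and a b c :: "edge \<Rightarrow> real"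
    by (simp add: sum.distrib sum_distrib_left algebra_simps)
  have u: "(\<Sum>s\<in>S. c s * (a s + r * b s)) = (\<Sum>s\<in>S. c s * a s) + r * (\<Sum>s\<in>S. c s * b s)" for S :: "nat set" and a b c :: "nat \<Rightarrow> real"
    by (simp add: sum.distrib sum_distrib_left algebra_simps)
  show ?thesis
    unfolding J_form_def Let_def p unfolding v unfolding w unfolding t u unfolding t
    by (simp add: algebra_simps del: sum.cl_ivl_Suc)
qed

lemma exists_L:
  assumes disc: "discretization M k" and K: "K \<in> cells M"
  shows "\<exists>L\<in>cell_space k K. \<forall>u\<in>cell_space k K. integral K (\<lambda>x. L x \<bullet> u x) = J_form H M k K U (\<lambda>_. u)"
proof -
  have P: "polygon K (edges M K)" using disc K unfolding discretization_def polygonal_mesh_def by auto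
  have G: "gauss_rule (k + 1) (gauss_x M) (gauss_w M)" using disc unfolding discretization_def by auto
  have vq: "vol_x M K q \<in> K" if "q \<in> {1..vol_Q M K}" for q
    using disc K that unfolding discretization_def volume_quadrature_def by auto
  have ep: "edge_point M e q \<in> K" if "e \<in> edges M K" "q \<in> {1..k+1}" for e q
    using edge_point_in_segment[OF G that(2)] edge_seg_subset[OF P that(1)] by blast
  have int: "(\<lambda>x. u x \<bullet> w x) integrable_on K" if "u \<in> cell_space k K" "w \<in> cell_space k K" for u w
    using that by (intro compact_integrals(1)[OF polygon_compact[OF P]] continuous_on_inner poly_le_continuous[of k])
      (auto dest: cell_space_poly)
  show ?thesis
  proof (rule riesz_finite_span)
    show "finite (SIGMA i:{..k}. SIGMA j:{..k - i}. (Basis :: state set))" by (intro finite_SigmaI) auto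
    show "(\<lambda>x. 0) \<in> cell_space k K" by (rule cell_space_const)
    show "(\<lambda>x. u x + r *\<^sub>R w x) \<in> cell_space k K" if "u \<in> cell_space k K" "w \<in> cell_space k K" for u w r
      using that by (intro cell_space_add cell_space_scaleR)
    show "\<exists>a. \<forall>x. u x = (\<Sum>s\<in>(SIGMA i:{..k}. SIGMA j:{..k - i}. (Basis :: state set)).
       a s *\<^sub>R (\<lambda>(i, j, b) x. ((x $ 1) ^ i * (x $ 2) ^ j) *\<^sub>R b) s x)" if "u \<in> cell_space k K" for u
      by (rule poly_le_span[OF cell_space_poly[OF that]])
    show "integral K (\<lambda>x. u x \<bullet> w x) = integral K (\<lambda>x. w x \<bullet> u x)" for u w :: "point \<Rightarrow> state"
      by (simp add: inner_commute)
    show "integral K (\<lambda>x. (u x + r *\<^sub>R w x) \<bullet> z x) = integral K (\<lambda>x. u x \<bullet> z x) + r * integral K (\<lambda>x. w x \<bullet> z x)"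
      if "u \<in> cell_space k K" "w \<in> cell_space k K" "z \<in> cell_space k K" for u w z r
    proof -
      have "integral K (\<lambda>x. u x \<bullet> z x + r * (w x \<bullet> z x)) = integral K (\<lambda>x. u x \<bullet> z x) + integral K (\<lambda>x. r * (w x \<bullet> z x))"
        using int[OF that(1,3)] integrable_cmul[OF int[OF that(2,3)], of r]
        by (intro Henstock_Kurzweil_Integration.integral_add) simp_all
      then show ?thesis by (simp add: inner_add_left)
    qed
    show "integral K (\<lambda>x. w x \<bullet> u x) = 0"
      if "u \<in> cell_space k K" "w \<in> cell_space k K" "integral K (\<lambda>x. u x \<bullet> u x) = 0" for u w
    proof -
      have "integral K (\<lambda>x. w x \<bullet> u x) = integral K (\<lambda>x. 0)"
        using zero_square_integral(1)[OF P cell_space_poly[OF that(1)] that(3)]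
        by (intro Henstock_Kurzweil_Integration.integral_cong) simp
      then show ?thesis by simp
    qed
    show "J_form H M k K U (\<lambda>_ x. u x + r *\<^sub>R w x) = J_form H M k K U (\<lambda>_. u) + r * J_form H M k K U (\<lambda>_. w)"
      if "u \<in> cell_space k K" "w \<in> cell_space k K" for u w r
      by (rule J_form_lin[OF cell_space_poly[OF that(1)] cell_space_poly[OF that(2)]])
    show "J_form H M k K U (\<lambda>_. u) = 0" if "u \<in> cell_space k K" "integral K (\<lambda>x. u x \<bullet> u x) = 0" for u
    proof -
      note Z = zero_square_integral[OF P cell_space_poly[OF that(1)] that(2)]
      show ?thesis unfolding J_form_def Let_def
        using Z(1)[OF ep] Z(2)[OF vq] by (simp del: sum.cl_ivl_Suc)
    qed
  qed
qed

text \<open>Local solutions, chosen on each cell, are glued into a witness for the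
  \<open>SOME\<close> in \<open>L_h\<close>.\<close>

lemma L_h_spec:
  assumes disc: "discretization M k"
  shows "L_h H M k U \<in> Wh M k"
    "\<And>u K. u \<in> Wh M k \<Longrightarrow> K \<in> cells M \<Longrightarrow> integral K (\<lambda>x. L_h H M k U K x \<bullet> u K x) = J_form H M k K U u"
proof -
  have "\<forall>K\<in>cells M. \<exists>L. L \<in> cell_space k K \<and> (\<forall>u\<in>cell_space k K. integral K (\<lambda>x. L x \<bullet> u x) = J_form H M k K U (\<lambda>_. u))"
    using exists_L[OF disc] by blast
  from bchoice[OF this] obtain L where L: "\<forall>K\<in>cells M. L K \<in> cell_space k K \<and>
      (\<forall>u\<in>cell_space k K. integral K (\<lambda>x. L K x \<bullet> u x) = J_form H M k K U (\<lambda>_. u))"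
    by (rule exE)
  have "integral K (\<lambda>x. L K x \<bullet> u K x) = J_form H M k K U u" if "u \<in> Wh M k" "K \<in> cells M" for u K
  proof -
    have "u K \<in> cell_space k K" using that unfolding Wh_iff by blast
    then have "integral K (\<lambda>x. L K x \<bullet> u K x) = J_form H M k K U (\<lambda>_. u K)"
      using bspec[OF L that(2)] by blast
    then show ?thesis using J_form_local[of H M k K U u] by simp
  qed
  moreover have "L \<in> Wh M k" unfolding Wh_iff using L by blast
  ultimately have "L \<in> Wh M k \<and> (\<forall>u\<in>Wh M k. \<forall>K\<in>cells M. integral K (\<lambda>x. L K x \<bullet> u K x) = J_form H M k K U u)"
    by blast
  from someI[where P="\<lambda>L. L \<in> Wh M k \<and> (\<forall>u\<in>Wh M k. \<forall>K\<in>cells M. integral K (\<lambda>x. L K x \<bullet> u K x) = J_form H M k K U u)", OF this]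
  show "L_h H M k U \<in> Wh M k"
    "\<And>u K. u \<in> Wh M k \<Longrightarrow> K \<in> cells M \<Longrightarrow> integral K (\<lambda>x. L_h H M k U K x \<bullet> u K x) = J_form H M k K U u"
    unfolding L_h_def by auto
qed

text \<open>
  The bracket in the edge term of \<open>J_form\<close>.
\<close>

definition edge_residual :: "(real \<Rightarrow> real \<Rightarrow> real) \<Rightarrow> disc \<Rightarrow> field \<Rightarrow> cell \<Rightarrow> edge \<Rightarrow> nat \<Rightarrow> state" where
  "edge_residual H M U K e q = (let x = edge_point M e q; n = normal M K e; Ui = U K x; Ue = ext_trace M U K e x
     in num_flux H 1 Ui Ue n + (dirB n (Bc Ue - Bc Ui) / 2) *\<^sub>R source H Ui)"

text \<open>Test with constants, which are divergence-free; the volume term contains only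
  derivatives of the test function and drops out.\<close>

lemma cell_average_L_h:
  assumes disc: "discretization M k" and K: "K \<in> cells M"
  shows "cell_average K (L_h H M k U K) =
    - ((1 / area K) *\<^sub>R (\<Sum>e\<in>edges M K. edge_length e *\<^sub>R (\<Sum>q=1..k+1. gauss_w M q *\<^sub>R edge_residual H M U K e q)))"
proof (rule euclidean_eqI)
  fix c :: state
  have P: "polygon K (edges M K)" using disc K unfolding discretization_def polygonal_mesh_def by auto
  have L: "L_h H M k U K \<in> cell_space k K" using L_h_spec(1)[OF disc] K unfolding Wh_iff by auto
  have "(\<lambda>_ _. c) \<in> Wh M k" unfolding Wh_iff using cell_space_const by auto
  note spec = L_h_spec(2)[OF disc this K, of H U]
  have "cell_average K (L_h H M k U K) \<bullet> c = cell_average K (\<lambda>x. L_h H M k U K x \<bullet> c)"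
    using cell_average_linear[OF P cell_space_poly[OF L], of "\<lambda>v. v \<bullet> c"] by (simp add: linearI inner_add_left)
  also have "\<dots> = (1 / area K) * J_form H M k K U (\<lambda>_ _. c)"
    unfolding cell_average_def spec[symmetric] by simp
  also have "J_form H M k K U (\<lambda>_ _. c) =
    - (\<Sum>e\<in>edges M K. edge_length e * (\<Sum>q=1..k+1. gauss_w M q * (edge_residual H M U K e q \<bullet> c)))"
    unfolding J_form_def edge_residual_def Let_def by (simp add: partial_const del: sum.cl_ivl_Suc)
  finally show "cell_average K (L_h H M k U K) \<bullet> c =
    - ((1 / area K) *\<^sub>R (\<Sum>e\<in>edges M K. edge_length e *\<^sub>R (\<Sum>q=1..k+1. gauss_w M q *\<^sub>R edge_residual H M U K e q))) \<bullet> c"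
    by (simp add: inner_sum_left del: sum.cl_ivl_Suc)
qed

section \<open>Cell averages after an Euler step\<close>

lemma prim_admissible:
  assumes "U \<in> admissible H"
  shows "is_prim H U (rho_of H U, p_of H U, v_of H U)"
proof -
  have "\<exists>w. is_prim H U w" using assms unfolding admissible_def by auto
  then have "is_prim H U (prim H U)" unfolding prim_def by (rule someI_ex)
  then show ?thesis unfolding rho_of_def p_of_def v_of_def by simp
qed

text \<open>Makes the planar normals instances of the flux inequality for directions in
  three-space.\<close>

definition embed3 :: "real^2 \<Rightarrow> real^3" where
  "embed3 n = n $ 1 *\<^sub>R axis 1 1 + n $ 2 *\<^sub>R axis 2 1"

lemma embed3_inner: "embed3 n \<bullet> v = n $ 1 * v $ 1 + n $ 2 * v $ 2"
  by (simp add: embed3_def inner_add_left inner_axis')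

lemma dirB_embed3: "dirB n B = embed3 n \<bullet> B"
  by (simp add: dirB_def embed3_inner)

lemma norm_embed3: "norm (embed3 n) = norm n"
proof -
  have "embed3 n \<bullet> embed3 n = n \<bullet> n"
    unfolding embed3_inner by (simp add: embed3_def axis_def inner_vec_def sum_2)
  then show ?thesis by (simp add: norm_eq_sqrt_inner)
qed

lemma dir_flux_eq: "dir_flux H n U = prim_flux (embed3 n) (p_of H U) (v_of H U) U"
  unfolding dir_flux_def flux_def prim_flux_def Let_def embed3_inner
  by (simp add: embed3_def algebra_simps)

lemma source_eq: "source H U = prim_source (v_of H U) U"
  unfolding source_def prim_source_def Let_def by simp

lemma prim_flux_minus: "prim_flux (- k) p v U = - prim_flux k p v U"
  by (simp add: prim_flux_def)

lemma Dc_pos: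
  assumes "U \<in> admissible H"
  shows "Dc U > 0"
proof -
  note P = is_primD[OF prim_admissible[OF assms]]
  have "Dc U = rho_of H U * lorentz (v_of H U)" by (subst P(5)) (simp add: cons_def)
  then show ?thesis using P(1) lorentz_facts(2)[OF P(4)] by simp
qed

context
  fixes H :: "real \<Rightarrow> real \<Rightarrow> real" and n :: "real^2" and Ui Ue :: state
  assumes eos: "equation_of_state H" and n: "norm n = 1"
    and Ui: "Ui \<in> admissible H" and Ue: "Ue \<in> admissible H"
begin

lemma flux_inequality_dir:
  assumes "U \<in> admissible H" "norm w < 1"
  shows "- (pmag w C * (1 - embed3 n \<bullet> w)) - (embed3 n \<bullet> Bc U) * (w \<bullet> C) \<le> (U - dir_flux H n U) \<bullet> dual_vec w C"
  using flux_inequality[OF eos prim_admissible[OF assms(1)], of "- embed3 n" w C] assms(2) n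
  by (simp add: norm_embed3 prim_flux_minus dir_flux_eq)

text \<open>With F the flux in direction \<open>n\<close>, the negative numerical flux is - Ui +
  ((Ui - F Ui) + (Ue - F Ue)) / 2, so \<open>flux_inequality_dir\<close> is used once for each
  trace. It leaves minus the mean of the two normal fields times w . C; the term b (w . C) from
  \<open>source_inequality\<close>, with \<open>b\<close> half the jump, turns the mean into the
  interior trace.\<close>

lemma residual_lin_form:
  assumes w: "norm w < 1"
  shows "- (1 + \<bar>dirB n (Bc Ui - Bc Ue)\<bar> / 2 / sqrt (rho_of H Ui * H (p_of H Ui) (rho_of H Ui))) * lin_form w C Ui
      + (pmag w C * (embed3 n \<bullet> w) - (embed3 n \<bullet> Bc Ui) * (w \<bullet> C))
    \<le> - ((num_flux H 1 Ui Ue n + (dirB n (Bc Ue - Bc Ui) / 2) *\<^sub>R source H Ui) \<bullet> dual_vec w C)"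
proof -
  define h where "h = sqrt (rho_of H Ui * H (p_of H Ui) (rho_of H Ui))"
  define b where "b = dirB n (Bc Ue - Bc Ui) / 2"
  define X where "X = dual_vec w C"
  have b: "\<bar>dirB n (Bc Ui - Bc Ue)\<bar> / 2 = \<bar>b\<bar>" "b = (embed3 n \<bullet> Bc Ue - embed3 n \<bullet> Bc Ui) / 2"
    unfolding b_def dirB_embed3 by (simp_all add: inner_diff_right)
  have "\<bar>source H Ui \<bullet> X + w \<bullet> C\<bar> \<le> lin_form w C Ui / h"
    unfolding source_eq h_def X_def by (rule source_inequality[OF eos prim_admissible[OF Ui] w])
  then have "\<bar>b\<bar> * \<bar>source H Ui \<bullet> X + w \<bullet> C\<bar> \<le> \<bar>b\<bar> * (lin_form w C Ui / h)"
    by (rule mult_left_mono) simp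
  then have S: "b * (source H Ui \<bullet> X) + b * (w \<bullet> C) \<le> \<bar>b\<bar> / h * lin_form w C Ui"
    unfolding abs_mult[symmetric] distrib_left by simp
  note flux_inequality_dir[OF Ui w, of C, folded X_def] flux_inequality_dir[OF Ue w, of C, folded X_def]
  then have F: "- (pmag w C * (1 - embed3 n \<bullet> w)) - (embed3 n \<bullet> Bc Ui + embed3 n \<bullet> Bc Ue) / 2 * (w \<bullet> C)
     \<le> ((Ui - dir_flux H n Ui) \<bullet> X + (Ue - dir_flux H n Ue) \<bullet> X) / 2"
    by (simp add: field_simps)
  have "(num_flux H 1 Ui Ue n + b *\<^sub>R source H Ui) \<bullet> X
     = Ui \<bullet> X - ((Ui - dir_flux H n Ui) \<bullet> X + (Ue - dir_flux H n Ue) \<bullet> X) / 2 + b * (source H Ui \<bullet> X)"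
    unfolding num_flux_def by (simp add: inner_add_left inner_diff_left field_simps)
  moreover have "Ui \<bullet> X = lin_form w C Ui - pmag w C" unfolding lin_form_def X_def by simp
  moreover have "b * (w \<bullet> C) = (embed3 n \<bullet> Bc Ue) / 2 * (w \<bullet> C) - (embed3 n \<bullet> Bc Ui) / 2 * (w \<bullet> C)"
    unfolding b(2) by (simp add: algebra_simps diff_divide_distrib)
  \<comment> \<open>The remaining arithmetic, isolated with variables for the forms and inner
    products.\<close>
  moreover have "- (1 + c) * L + (p * m - i * d) \<le> - R"
    if "R = u - G + y" "u = L - p" "z = e / 2 * d - i / 2 * d" "y + z \<le> c * L" "- (p * (1 - m)) - (i + e) / 2 * d \<le> G"
    for R u G y L p z e i d c m :: real
  proof -
    have "(i + e) / 2 * d = e / 2 * d + i / 2 * d" "- (p * (1 - m)) = p * m - p" "- (1 + c) * L = - L - c * L"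
      "i * d = i / 2 * d + i / 2 * d"
      by (simp_all add: field_simps)
    then show ?thesis using that by linarith
  qed
  ultimately show ?thesis using S F unfolding b(1) h_def[symmetric] b_def[symmetric] X_def[symmetric] by blast
qed

text \<open>The source has no density entry, and |n . v| < 1 gives D (1 - n . v) \<ge> 0 for both
  traces.\<close>

lemma residual_density:
  "- Dc Ui \<le> - Dc (num_flux H 1 Ui Ue n + (dirB n (Bc Ue - Bc Ui) / 2) *\<^sub>R source H Ui)"
proof -
  have *: "0 \<le> Dc U - Dc (dir_flux H n U)" if U: "U \<in> admissible H" for U
  proof -
    have "1 - embed3 n \<bullet> v_of H U > 0"
      using one_plus_inner_pos[of "- embed3 n" "v_of H U"] is_primD(4)[OF prim_admissible[OF U]] n by (simp add: norm_embed3)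
    then have "0 \<le> Dc U * (1 - embed3 n \<bullet> v_of H U)" using Dc_pos[OF U] by simp
    then show ?thesis unfolding dir_flux_eq prim_flux_def by (simp add: algebra_simps)
  qed
  have "Dc (num_flux H 1 Ui Ue n + (dirB n (Bc Ue - Bc Ui) / 2) *\<^sub>R source H Ui)
     = Dc Ui - ((Dc Ui - Dc (dir_flux H n Ui)) + (Dc Ue - Dc (dir_flux H n Ue))) / 2"
    unfolding num_flux_def source_def Let_def
    by (simp add: state_components field_simps)
  then show ?thesis using *[OF Ui] *[OF Ue] by simp
qed

end

lemma discretizationD:
  assumes disc: "discretization M k" and K: "K \<in> cells M"
  shows "polygon K (edges M K)" "gauss_rule (k + 1) (gauss_x M) (gauss_w M)" "special_quadrature M k K"
    "\<And>e. e \<in> edges M K \<Longrightarrow> outward_unit_normal K e (normal M K e)"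
  using assms unfolding discretization_def polygonal_mesh_def by auto

lemma edges_nonempty:
  assumes "polygon K es"
  shows "es \<noteq> {}"
proof
  assume "es = {}"
  then have "frontier K = {}" using assms unfolding polygon_def by auto
  then have "K = {} \<or> K = UNIV" using frontier_eq_empty by blast
  then show False using assms compact_imp_bounded[of K] unfolding polygon_def by auto
qed

lemma edge_node: "e \<in> edges M K \<Longrightarrow> q \<in> {1..k+1} \<Longrightarrow> edge_point M e q \<in> nodes M k K"
  unfolding nodes_def by blast

lemma ext_trace_admissible:
  assumes disc: "discretization M k" and K: "K \<in> cells M" and e: "e \<in> edges M K" and q: "q \<in> {1..k+1}"
    and U: "U \<in> G_h H M k"
  shows "ext_trace M U K e (edge_point M e q) \<in> admissible H"
proof -
  define K' where "K' = nbr M K e"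
  define s where "s = shift M K e"
  define e' where "e' = (fst e + s, snd e + s)"
  have "\<forall>K\<in>cells M. \<forall>e\<in>edges M K.
        let K' = nbr M K e; s = shift M K e; e' = (fst e + s, snd e + s) in
          K' \<in> cells M \<and> e' \<in> edges M K' \<and>
          nbr M K' e' = K \<and> shift M K' e' = - s \<and> normal M K' e' = - normal M K e \<and>
          (s \<noteq> 0 \<longrightarrow> edge_seg e \<subseteq> frontier (domain M))"
    using disc unfolding discretization_def polygonal_mesh_def by blast
  from bspec[OF bspec[OF this K] e] have K': "K' \<in> cells M" "e' \<in> edges M K'"
    unfolding K'_def s_def e'_def Let_def by blast+
  have "edge_point M e' q = edge_point M e q + s" unfolding edge_point_def e'_def by simp
  then have "edge_point M e q + s \<in> nodes M k K'" using edge_node[OF K'(2) q] by simp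
  then have "U K' (edge_point M e q + s) \<in> admissible H" using U K' unfolding G_h_def by blast
  then show ?thesis unfolding ext_trace_def K'_def s_def .
qed

lemma dec_node: "q \<in> {1..dec_Q M K} \<Longrightarrow> dec_x M K q \<in> nodes M k K"
  unfolding nodes_def by blast

lemma G_h_cell_space: "U \<in> G_h H M k \<Longrightarrow> K \<in> cells M \<Longrightarrow> U K \<in> cell_space k K"
  unfolding G_h_def Gbar_h_def using Wh_iff by blast

lemma jump_sigma_nonneg:
  assumes "equation_of_state H" "U K (edge_point M e q) \<in> admissible H"
  shows "jump_sigma H M K e q U \<ge> 0"
proof -
  note P = is_primD(1,2)[OF prim_admissible[OF assms(2)]]
  have "0 \<le> sqrt ((rho_of H (U K (edge_point M e q)))\<^sup>2 + (p_of H (U K (edge_point M e q)))\<^sup>2) + p_of H (U K (edge_point M e q))"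
    using P(2) by simp
  then show ?thesis using eos_bound[OF assms(1) P] unfolding jump_sigma_def Let_def by simp
qed

text \<open>The first part vanishes by the divergence theorem for constants, the second because the
  trace comes from a single field that is divergence-free in \<open>K\<close>.\<close>

lemma sum_edges_gauss_zero:
  assumes disc: "discretization M k" and K: "K \<in> cells M" and f: "f \<in> cell_space k K"
  shows "(\<Sum>e\<in>edges M K. \<Sum>q=1..k+1. edge_length e * gauss_w M q *
     (c * (embed3 (normal M K e) \<bullet> w) - (embed3 (normal M K e) \<bullet> Bc (f (edge_point M e q))) * d)) = 0"
proof -
  note F = discretizationD[OF disc K]
  let ?n = "normal M K"
  define A where "A i = (\<Sum>e\<in>edges M K. edge_length e * (\<Sum>q=1..k+1. gauss_w M q * (?n e $ i * 1)))" for i :: 2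
  define D where "D i l = (\<Sum>e\<in>edges M K. edge_length e * (\<Sum>q=1..k+1. gauss_w M q * (?n e $ i * (Bc (f (edge_point M e q)) $ l))))" for i :: 2 and l :: 3
  have A: "A i = 0" for i
  proof -
    have "partial i (\<lambda>x::point. 1::real) = (\<lambda>x. 0)" by (rule ext) (rule partial_const)
    then show ?thesis unfolding A_def
      using polygon_gauss_divergence[OF F(1) F(4) F(2) poly_le_const[of k "1::real"], of i] by (simp del: sum.cl_ivl_Suc)
  qed
  have D: "D i l = integral K (partial i (\<lambda>y. Bc (f y) $ l))" for i l
    unfolding D_def
    by (rule polygon_gauss_divergence[OF F(1) F(4) F(2) poly_le_Bc_nth[OF cell_space_poly[OF f]]])
  have "D 1 1 + D 2 2 = integral K (divB f)"
  proof -
    have "partial i (\<lambda>y. Bc (f y) $ l) integrable_on K" for i l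
      by (rule compact_integrals(1)[OF polygon_compact[OF F(1)]])
        (rule continuous_on_subset[OF poly_le_C1(2)[OF poly_le_Bc_nth[OF cell_space_poly[OF f]]] subset_UNIV])
    then show ?thesis unfolding D divB_def by (simp add: Henstock_Kurzweil_Integration.integral_add)
  qed
  also have "integral K (divB f) = integral K (\<lambda>x. 0)"
    by (rule Henstock_Kurzweil_Integration.integral_cong) (use f in \<open>simp add: cell_space_def\<close>)
  finally have D0: "D 1 1 + D 2 2 = 0" by simp
  have "(\<Sum>e\<in>edges M K. \<Sum>q=1..k+1. edge_length e * gauss_w M q *
     (c * (embed3 (?n e) \<bullet> w) - (embed3 (?n e) \<bullet> Bc (f (edge_point M e q))) * d))
    = c * w $ 1 * A 1 + c * w $ 2 * A 2 - d * (D 1 1 + D 2 2)"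
  proof -
    have "(\<Sum>e\<in>edges M K. \<Sum>q=1..k+1. edge_length e * gauss_w M q *
       (c * (embed3 (?n e) \<bullet> w) - (embed3 (?n e) \<bullet> Bc (f (edge_point M e q))) * d))
      = (\<Sum>e\<in>edges M K. \<Sum>q=1..k+1. c * w $ 1 * (edge_length e * (gauss_w M q * (?n e $ 1 * 1)))
        + c * w $ 2 * (edge_length e * (gauss_w M q * (?n e $ 2 * 1)))
        - d * (edge_length e * (gauss_w M q * (?n e $ 1 * (Bc (f (edge_point M e q)) $ 1)))
             + edge_length e * (gauss_w M q * (?n e $ 2 * (Bc (f (edge_point M e q)) $ 2)))))"
      unfolding embed3_inner by (intro sum.cong refl) (simp add: algebra_simps)
    then show ?thesis unfolding A_def D_def
      by (simp only: sum.distrib sum_subtractf sum_distrib_left distrib_left)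
  qed
  then show ?thesis using A D0 by simp
qed

text \<open>One statement for the density, with \<open>g\<close> zero, and for all
  \<open>lin_form w C\<close>. The special quadrature writes the average as a sum over nodes, and
  the CFL condition keeps the coefficient of every edge node positive after the residual has taken
  its share.\<close>

lemma euler_average_pos:
  fixes \<phi> :: "state \<Rightarrow> real"
  assumes disc: "discretization M k" and K: "K \<in> cells M" and U: "U \<in> G_h H M k"
    and eos: "equation_of_state H" and \<tau>: "\<tau> \<ge> 0"
    and cfl: "\<And>e q. e \<in> edges M K \<Longrightarrow> q \<in> {1..k+1} \<Longrightarrow>
      \<tau> * gauss_w M q * (1 + jump_sigma H M K e q U) * edge_length e < dec_edge_w M K e q * area K"
    and lin: "linear \<phi>" and pos: "\<And>V. V \<in> admissible H \<Longrightarrow> \<phi> V + a > 0"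
    and res: "\<And>e q. e \<in> edges M K \<Longrightarrow> q \<in> {1..k+1} \<Longrightarrow>
       - (1 + jump_sigma H M K e q U) * (\<phi> (U K (edge_point M e q)) + a) + g e q \<le> - \<phi> (edge_residual H M U K e q)"
    and bal: "(\<Sum>e\<in>edges M K. \<Sum>q=1..k+1. edge_length e * gauss_w M q * g e q) = 0"
  shows "\<phi> (cell_average K (\<lambda>x. U K x + \<tau> *\<^sub>R L_h H M k U K x)) + a > 0"
proof -
  note F = discretizationD[OF disc K]
  have ar: "area K > 0" by (rule polygon_area_pos[OF F(1)])
  define E where "E = edges M K"
  define Q where "Q = {1..k+1}"
  define X where "X e q = \<phi> (U K (edge_point M e q)) + a" for e q
  define Y where "Y q = \<phi> (U K (dec_x M K q)) + a" for q
  define W where "W = dec_edge_w M K"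
  define \<sigma> where "\<sigma> e q = jump_sigma H M K e q U" for e q
  define t where "t = \<tau> / area K"
  have t: "t \<ge> 0" unfolding t_def using \<tau> ar by simp
  have Uc: "U K \<in> cell_space k K" by (rule G_h_cell_space[OF U K])
  have Lc: "L_h H M k U K \<in> cell_space k K" using L_h_spec(1)[OF disc] K unfolding Wh_iff by blast
  have avg: "cell_average K (\<lambda>x. U K x + \<tau> *\<^sub>R L_h H M k U K x) = cell_average K (U K) + \<tau> *\<^sub>R cell_average K (L_h H M k U K)"
  proof -
    have "cell_average K (\<lambda>x. U K x + \<tau> *\<^sub>R L_h H M k U K x) = cell_average K (U K) + cell_average K (\<lambda>x. \<tau> *\<^sub>R L_h H M k U K x)"
      by (rule cell_average_add[OF F(1) cell_space_poly[OF Uc] poly_le_scaleR[OF cell_space_poly[OF Lc]]])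
    then show ?thesis
      using cell_average_linear[OF F(1) cell_space_poly[OF Lc], of "\<lambda>v. \<tau> *\<^sub>R v"] by (simp add: linearI scaleR_add_right)
  qed
  have wsum: "(\<Sum>e\<in>E. \<Sum>q\<in>Q. W e q) + (\<Sum>q=1..dec_Q M K. dec_w M K q) = 1"
    using F(3) unfolding special_quadrature_def E_def Q_def W_def by blast
  have 1: "\<phi> (cell_average K (U K)) + a = (\<Sum>e\<in>E. \<Sum>q\<in>Q. W e q * X e q) + (\<Sum>q=1..dec_Q M K. dec_w M K q * Y q)"
  proof -
    have "\<phi> (cell_average K (U K)) = (\<Sum>e\<in>E. \<Sum>q\<in>Q. W e q * \<phi> (U K (edge_point M e q))) + (\<Sum>q=1..dec_Q M K. dec_w M K q * \<phi> (U K (dec_x M K q)))"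
      unfolding cell_average_quadrature[OF F(1,3) cell_space_poly[OF Uc]] E_def Q_def W_def
      using lin by (simp only: linear_add linear_sum linear_scale real_scaleR_def)
    moreover have "a = (\<Sum>e\<in>E. \<Sum>q\<in>Q. W e q * a) + (\<Sum>q=1..dec_Q M K. dec_w M K q * a)"
      using arg_cong[OF wsum, of "\<lambda>s. s * a"] by (simp only: distrib_right sum_distrib_right mult_1)
    ultimately show ?thesis unfolding X_def Y_def by (simp only: distrib_left sum.distrib)
  qed
  have 2: "\<phi> (\<tau> *\<^sub>R cell_average K (L_h H M k U K)) = t * (\<Sum>e\<in>E. \<Sum>q\<in>Q. edge_length e * gauss_w M q * (- \<phi> (edge_residual H M U K e q)))"
    unfolding cell_average_L_h[OF disc K] E_def[symmetric] Q_def[symmetric] t_def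
    using lin by (simp add: linear_scale linear_neg linear_sum sum_distrib_left sum_negf mult.assoc)
  have len: "edge_length e \<ge> 0" for e unfolding edge_length_def by simp
  have gw: "gauss_w M q > 0" if "q \<in> Q" for q using F(2) that unfolding gauss_rule_def Q_def by blast
  have "(\<Sum>e\<in>E. \<Sum>q\<in>Q. edge_length e * gauss_w M q * (- (1 + \<sigma> e q) * X e q + g e q))
     \<le> (\<Sum>e\<in>E. \<Sum>q\<in>Q. edge_length e * gauss_w M q * (- \<phi> (edge_residual H M U K e q)))"
  proof (intro sum_mono mult_left_mono)
    fix e q assume "e \<in> E" "q \<in> Q"
    then show "- (1 + \<sigma> e q) * X e q + g e q \<le> - \<phi> (edge_residual H M U K e q)"
      using res[of e q] unfolding E_def Q_def \<sigma>_def X_def by blast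
    show "0 \<le> edge_length e * gauss_w M q" using len[of e] gw[OF \<open>q \<in> Q\<close>] by simp
  qed
  then have "(\<Sum>e\<in>E. \<Sum>q\<in>Q. edge_length e * gauss_w M q * (- (1 + \<sigma> e q) * X e q))
     \<le> (\<Sum>e\<in>E. \<Sum>q\<in>Q. edge_length e * gauss_w M q * (- \<phi> (edge_residual H M U K e q)))"
    using bal unfolding distrib_left sum.distrib E_def[symmetric] Q_def[symmetric] by simp
  from mult_left_mono[OF this t]
  have "(\<Sum>e\<in>E. \<Sum>q\<in>Q. W e q * X e q) + t * (\<Sum>e\<in>E. \<Sum>q\<in>Q. edge_length e * gauss_w M q * (- (1 + \<sigma> e q) * X e q)) + (\<Sum>q=1..dec_Q M K. dec_w M K q * Y q)
    \<le> \<phi> (cell_average K (\<lambda>x. U K x + \<tau> *\<^sub>R L_h H M k U K x)) + a"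
    unfolding avg linear_add[OF lin] 2 using 1 by linarith
  moreover have "(\<Sum>e\<in>E. \<Sum>q\<in>Q. W e q * X e q) + t * (\<Sum>e\<in>E. \<Sum>q\<in>Q. edge_length e * gauss_w M q * (- (1 + \<sigma> e q) * X e q))
     = (\<Sum>e\<in>E. \<Sum>q\<in>Q. (W e q - t * gauss_w M q * (1 + \<sigma> e q) * edge_length e) * X e q)"
  proof -
    have "(W e q - t * gauss_w M q * (1 + \<sigma> e q) * edge_length e) * X e q
       = W e q * X e q + t * (edge_length e * gauss_w M q * (- (1 + \<sigma> e q) * X e q))" for e q
      by (simp add: algebra_simps)
    then show ?thesis by (simp only: sum.distrib sum_distrib_left)
  qed
  \<comment> \<open>Strictness comes from the edge nodes, which always exist;
    \<open>dec_Q M K\<close> may be 0.\<close>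
  moreover have "0 < (\<Sum>e\<in>E. \<Sum>q\<in>Q. (W e q - t * gauss_w M q * (1 + \<sigma> e q) * edge_length e) * X e q)"
  proof (rule sum_pos)
    show "finite E" using F(1) unfolding polygon_def E_def by simp
    show "E \<noteq> {}" using edges_nonempty[OF F(1)] unfolding E_def .
    show "0 < (\<Sum>q\<in>Q. (W e q - t * gauss_w M q * (1 + \<sigma> e q) * edge_length e) * X e q)" if e: "e \<in> E" for e
    proof (rule sum_pos)
      show "0 < (W e q - t * gauss_w M q * (1 + \<sigma> e q) * edge_length e) * X e q" if q: "q \<in> Q" for q
      proof (rule mult_pos_pos)
        have "\<tau> * gauss_w M q * (1 + \<sigma> e q) * edge_length e / area K < W e q"
          using cfl[of e q] e q ar unfolding E_def Q_def W_def \<sigma>_def by (simp add: pos_divide_less_eq)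
        then show "0 < W e q - t * gauss_w M q * (1 + \<sigma> e q) * edge_length e" unfolding t_def by simp
        have "U K (edge_point M e q) \<in> admissible H"
          using U K edge_node[of e M K q k] e q unfolding G_h_def E_def Q_def by blast
        then show "0 < X e q" unfolding X_def by (rule pos)
      qed
    qed (auto simp: Q_def)
  qed
  moreover have "0 \<le> (\<Sum>q=1..dec_Q M K. dec_w M K q * Y q)"
  proof (rule sum_nonneg)
    fix q assume q: "q \<in> {1..dec_Q M K}"
    have "U K (dec_x M K q) \<in> admissible H" using U K dec_node[OF q] unfolding G_h_def by blast
    then have "Y q > 0" unfolding Y_def by (rule pos)
    moreover have "dec_w M K q > 0" using F(3) q unfolding special_quadrature_def by blast
    ultimately show "0 \<le> dec_w M K q * Y q" by simp
  qed
  ultimately show ?thesis by linarith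
qed

text \<open>This set does not involve \<open>H\<close>; that is why limiter functions free of
  \<open>H\<close> can certify admissibility.\<close>

definition lin_admissible :: "state set" where
  "lin_admissible = {U. Dc U > 0 \<and> (\<forall>w C. norm w < 1 \<longrightarrow> lin_form w C U > 0)}"

lemma admissible_eq:
  assumes "equation_of_state H" "vanishing_energy_limit H"
  shows "admissible H = lin_admissible"
  unfolding lin_admissible_def
  using Dc_pos lin_form_pos[OF assms(1) prim_admissible] admissible_of_lin_form[OF assms] by blast

lemma euler_average_admissible:
  assumes disc: "discretization M k" and K: "K \<in> cells M" and U: "U \<in> G_h H M k"
    and eos: "equation_of_state H" and lim: "vanishing_energy_limit H" and \<tau>: "\<tau> \<ge> 0"
    and cfl: "\<And>e q. e \<in> edges M K \<Longrightarrow> q \<in> {1..k+1} \<Longrightarrow>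
      \<tau> * gauss_w M q * (1 + jump_sigma H M K e q U) * edge_length e < dec_edge_w M K e q * area K"
  shows "cell_average K (\<lambda>x. U K x + \<tau> *\<^sub>R L_h H M k U K x) \<in> admissible H"
proof -
  have n: "norm (normal M K e) = 1" if "e \<in> edges M K" for e
    using discretizationD(4)[OF disc K that] unfolding outward_unit_normal_def by blast
  have Ui: "U K (edge_point M e q) \<in> admissible H" if "e \<in> edges M K" "q \<in> {1..k+1}" for e q
    using U K edge_node[OF that] unfolding G_h_def by blast
  note Ue = ext_trace_admissible[OF disc K _ _ U]
  note pos = euler_average_pos[OF disc K U eos \<tau> cfl]
  let ?V = "cell_average K (\<lambda>x. U K x + \<tau> *\<^sub>R L_h H M k U K x)"
  have "Dc ?V + 0 > 0"
  proof (rule pos[where g="\<lambda>e q. 0"])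
    show "- (1 + jump_sigma H M K e q U) * (Dc (U K (edge_point M e q)) + 0) + 0 \<le> - Dc (edge_residual H M U K e q)"
      if "e \<in> edges M K" "q \<in> {1..k+1}" for e q
    proof -
      have "0 \<le> jump_sigma H M K e q U * Dc (U K (edge_point M e q))"
        using jump_sigma_nonneg[of H U K M e q, OF eos Ui[OF that]] Dc_pos[OF Ui[OF that]] by simp
      then show ?thesis
        using residual_density[OF eos n[OF that(1)] Ui[OF that] Ue[OF that]]
        unfolding edge_residual_def Let_def by (simp add: algebra_simps)
    qed
  qed (use linear_components(1) Dc_pos in auto)
  moreover have "lin_form w C ?V > 0" if w: "norm w < 1" for w C
  proof -
    have "?V \<bullet> dual_vec w C + pmag w C > 0"
    proof (rule pos[where g="\<lambda>e q. pmag w C * (embed3 (normal M K e) \<bullet> w) - (embed3 (normal M K e) \<bullet> Bc (U K (edge_point M e q))) * (w \<bullet> C)"])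
      show "linear (\<lambda>V. V \<bullet> dual_vec w C)" by (simp add: linearI inner_add_left)
      show "V \<bullet> dual_vec w C + pmag w C > 0" if "V \<in> admissible H" for V
        using lin_form_pos[OF eos prim_admissible[OF that] w] unfolding lin_form_def .
      show "(\<Sum>e\<in>edges M K. \<Sum>q=1..k+1. edge_length e * gauss_w M q *
         (pmag w C * (embed3 (normal M K e) \<bullet> w) - (embed3 (normal M K e) \<bullet> Bc (U K (edge_point M e q))) * (w \<bullet> C))) = 0"
        by (rule sum_edges_gauss_zero[OF disc K G_h_cell_space[OF U K]])
      show "- (1 + jump_sigma H M K e q U) * (U K (edge_point M e q) \<bullet> dual_vec w C + pmag w C)
         + (pmag w C * (embed3 (normal M K e) \<bullet> w) - (embed3 (normal M K e) \<bullet> Bc (U K (edge_point M e q))) * (w \<bullet> C))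
         \<le> - (edge_residual H M U K e q \<bullet> dual_vec w C)"
        if "e \<in> edges M K" "q \<in> {1..k+1}" for e q
        using residual_lin_form[OF eos n[OF that(1)] Ui[OF that] Ue[OF that] w, of C]
        unfolding edge_residual_def jump_sigma_def Let_def lin_form_def .
    qed
    then show ?thesis unfolding lin_form_def .
  qed
  ultimately show ?thesis unfolding admissible_eq[OF eos lim] lin_admissible_def by simp
qed

section \<open>Limiter\<close>

lemma lin_admissible_segment:
  assumes "U \<in> lin_admissible" "V \<in> lin_admissible" "0 \<le> t" "t \<le> 1"
  shows "(1 - t) *\<^sub>R U + t *\<^sub>R V \<in> lin_admissible"
proof -
  have pos: "(1 - t) * a + t * b > 0" if "a > 0" "b > 0" for a b :: real
    using that assms(3,4) by (cases "t = 0") (auto intro!: add_nonneg_pos mult_nonneg_nonneg mult_pos_pos)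
  have "lin_form w C ((1 - t) *\<^sub>R U + t *\<^sub>R V) = (1 - t) * lin_form w C U + t * lin_form w C V" for w C
    unfolding lin_form_def by (simp add: inner_add_left algebra_simps)
  then show ?thesis using assms pos unfolding lin_admissible_def
    by (simp add: linear_add[OF linear_components(1)] linear_scale[OF linear_components(1)])
qed

lemma convex_lin_admissible: "convex lin_admissible"
  unfolding convex_alt using lin_admissible_segment by blast

text \<open>The index set is a disjoint sum because edge points and interior nodes may
  coincide.\<close>

lemma quadrature_convex_combination:
  assumes P: "polygon K (edges M K)" and sq: "special_quadrature M k K"
  obtains I :: "(edge \<times> nat + nat) set" and c x where
    "finite I" "\<And>i. i \<in> I \<Longrightarrow> c i \<ge> 0 \<and> x i \<in> nodes M k K" "sum c I = 1"
    "\<And>f::point \<Rightarrow> state. poly_le k f \<Longrightarrow> cell_average K f = (\<Sum>i\<in>I. c i *\<^sub>R f (x i))"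
proof -
  let ?A = "edges M K \<times> {1..k+1}"
  let ?B = "{1..dec_Q M K}"
  define c where "c = case_sum (\<lambda>(e, q). dec_edge_w M K e q) (dec_w M K)"
  define x where "x = case_sum (\<lambda>(e, q). edge_point M e q) (dec_x M K)"
  have fin: "finite ?A" "finite ?B" using P unfolding polygon_def by auto
  have plus: "(\<Sum>i\<in>?A <+> ?B. h i) = (\<Sum>e\<in>edges M K. \<Sum>q=1..k+1. h (Inl (e, q))) + (\<Sum>q\<in>?B. h (Inr q))" for h :: "edge \<times> nat + nat \<Rightarrow> 'b::comm_monoid_add"
    unfolding sum.Plus[OF fin] by (simp add: sum.cartesian_product del: sum.cl_ivl_Suc)
  show ?thesis
  proof (rule that)
    show "finite (?A <+> ?B)" using fin by simp
    show "c i \<ge> 0 \<and> x i \<in> nodes M k K" if "i \<in> ?A <+> ?B" for i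
      using that
    proof (rule PlusE)
      fix a assume a: "a \<in> ?A" "i = Inl a"
      obtain e q where eq: "a = (e, q)" by (cases a)
      have "dec_edge_w M K e q > 0" using sq a eq unfolding special_quadrature_def by blast
      then show ?thesis using a eq edge_node[of e M K q k] by (simp add: c_def x_def)
    next
      fix q assume q: "q \<in> ?B" "i = Inr q"
      have "dec_w M K q > 0" using sq q unfolding special_quadrature_def by blast
      then show ?thesis using q dec_node[of q M K k] by (simp add: c_def x_def)
    qed
    show "sum c (?A <+> ?B) = 1"
      unfolding plus using sq unfolding special_quadrature_def by (simp add: c_def del: sum.cl_ivl_Suc)
    show "cell_average K f = (\<Sum>i\<in>?A <+> ?B. c i *\<^sub>R f (x i))" if "poly_le k f" for f :: "point \<Rightarrow> state"
      unfolding plus cell_average_quadrature[OF P sq that] by (simp add: c_def x_def del: sum.cl_ivl_Suc)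
  qed
qed

lemma qf_eq: "qf U = Ec U - norm (Dc U, mc U)"
  by (simp add: qf_def norm_Pair)

lemma linear_Dm: "linear (\<lambda>U. (Dc U, mc U))"
  by (rule linearI) (simp_all add: state_components)

lemma qf_concave:
  assumes "finite I" "\<And>i. i \<in> I \<Longrightarrow> c i \<ge> 0"
  shows "(\<Sum>i\<in>I. c i * qf (V i)) \<le> qf (\<Sum>i\<in>I. c i *\<^sub>R V i)"
proof -
  have "norm (\<Sum>i\<in>I. c i *\<^sub>R (Dc (V i), mc (V i))) \<le> (\<Sum>i\<in>I. c i * norm (Dc (V i), mc (V i)))"
    by (rule order_trans[OF norm_sum], rule sum_mono) (simp only: norm_scaleR abs_of_nonneg[OF assms(2)] order_refl)
  moreover have "qf (\<Sum>i\<in>I. c i *\<^sub>R V i) = (\<Sum>i\<in>I. c i * Ec (V i)) - norm (\<Sum>i\<in>I. c i *\<^sub>R (Dc (V i), mc (V i)))"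
    unfolding qf_eq linear_sum[OF linear_components(4)] linear_sum[OF linear_Dm] linear_scale[OF linear_components(4)] linear_scale[OF linear_Dm]
    by simp
  moreover have "(\<Sum>i\<in>I. c i * qf (V i)) = (\<Sum>i\<in>I. c i * Ec (V i)) - (\<Sum>i\<in>I. c i * norm (Dc (V i), mc (V i)))"
    unfolding qf_eq by (simp add: right_diff_distrib sum_subtractf)
  ultimately show ?thesis by linarith
qed

lemma qf_segment:
  assumes "0 \<le> t" "t \<le> 1"
  shows "(1 - t) * qf U + t * qf V \<le> qf ((1 - t) *\<^sub>R U + t *\<^sub>R V)"
  using qf_concave[of "{True, False}" "\<lambda>i. if i then 1 - t else t" "\<lambda>i. if i then U else V"] assms by simp

lemma continuous_Psi_eps: "continuous_on UNIV (Psi_eps \<epsilon>)"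
proof -
  have "continuous_on UNIV Dc" "continuous_on UNIV mc" "continuous_on UNIV Bc" "continuous_on UNIV Ec"
    using linear_components by (simp_all add: linear_continuous_on linear_conv_bounded_linear)
  then have "continuous_on UNIV (\<lambda>U. Psi_eps \<epsilon> U)"
    unfolding Psi_eps_def Psi_def Phi_def Dc.simps mc.simps Bc.simps Ec.simps
    by (intro continuous_intros)
  then show ?thesis by simp
qed

text \<open>\<open>Psi_eps\<close> changes sign on the segment from \<open>Ub\<close> to
  \<open>V\<close>, so there is a root below 1; whichever root \<open>SOME\<close> selects has these
  properties, in the borderline case too.\<close>

lemma theta_tilde:
  assumes "Psi_eps \<epsilon> Ub \<ge> 0"
  shows "0 \<le> theta_tilde \<epsilon> Ub V" "theta_tilde \<epsilon> Ub V \<le> 1"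
    "Psi_eps \<epsilon> ((1 - theta_tilde \<epsilon> Ub V) *\<^sub>R Ub + theta_tilde \<epsilon> Ub V *\<^sub>R V) \<ge> 0"
proof -
  define g where "g \<theta> = Psi_eps \<epsilon> ((1 - \<theta>) *\<^sub>R Ub + \<theta> *\<^sub>R V)" for \<theta>
  have "0 \<le> theta_tilde \<epsilon> Ub V \<and> theta_tilde \<epsilon> Ub V \<le> 1 \<and> g (theta_tilde \<epsilon> Ub V) \<ge> 0"
  proof (cases "Psi_eps \<epsilon> V \<ge> 0")
    case True
    then show ?thesis by (simp add: theta_tilde_def g_def)
  next
    case False
    have "continuous_on {0..1} g" unfolding g_def
      by (rule continuous_on_compose2[OF continuous_Psi_eps]) (auto intro!: continuous_intros)
    moreover have "g 1 \<le> 0" "0 \<le> g 0" using False assms by (simp_all add: g_def)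
    ultimately obtain t where t: "0 \<le> t" "t \<le> 1" "g t = 0"
      using IVT2'[of g 1 0 0] by auto
    moreover have "t \<noteq> 1" using t(3) False by (auto simp: g_def)
    ultimately have "\<exists>t. 0 \<le> t \<and> t < 1 \<and> g t = 0" by (intro exI[of _ t]) auto
    from someI_ex[OF this] show ?thesis
      using False unfolding theta_tilde_def g_def by auto
  qed
  then show "0 \<le> theta_tilde \<epsilon> Ub V" "theta_tilde \<epsilon> Ub V \<le> 1"
    "Psi_eps \<epsilon> ((1 - theta_tilde \<epsilon> Ub V) *\<^sub>R Ub + theta_tilde \<epsilon> Ub V *\<^sub>R V) \<ge> 0"
    unfolding g_def by auto
qed

text \<open>The energy lowered by \<open>\<epsilon>\<close> satisfies the weak inequalities;
  restoring it adds \<open>\<epsilon>\<close> to every affine form and makes them strict.\<close>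

lemma G_eps_lin_admissible:
  assumes e: "\<epsilon> > 0" and U: "U \<in> G_eps \<epsilon>"
  shows "U \<in> lin_admissible"
proof -
  define V where "V = (Dc U, mc U, Bc U, Ec U - \<epsilon>)"
  have D: "Dc U \<ge> \<epsilon>" and q: "qf U \<ge> \<epsilon>" and P: "Psi V \<ge> 0"
    using U unfolding G_eps_def Psi_eps_def V_def by auto
  have "Dc V > 0" using D e unfolding V_def by simp
  moreover have "qf V \<ge> 0" using q unfolding V_def qf_def by simp
  ultimately have nn: "0 \<le> lin_form w C V" if "norm w < 1" for w C
    using lin_form_nonneg_of_Psi[OF _ _ P that] by blast
  have "lin_form w C U = lin_form w C V + \<epsilon>" for w C
    unfolding lin_form_def V_def dual_vec_def by (cases U) simp
  then show ?thesis using nn D e unfolding lin_admissible_def by (auto intro: add_nonneg_pos)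
qed

text \<open>Each of the three limiter steps has this form, with \<open>h\<close> scaling some of the
  components; so all of them work about the same average.\<close>

lemma cell_average_affine_invariant:
  assumes P: "polygon K es" and f: "poly_le k f" and h: "linear h"
    and g: "\<And>x. g x = h (f x) + (cell_average K f - h (cell_average K f))"
  shows "poly_le k g" "cell_average K g = cell_average K f"
proof -
  have hf: "poly_le k (\<lambda>x. h (f x))" by (rule poly_le_linear[OF h f])
  have g': "g = (\<lambda>x. h (f x) + (cell_average K f - h (cell_average K f)))" using g by auto
  show "poly_le k g" unfolding g' by (rule poly_le_add[OF hf poly_le_const])
  show "cell_average K g = cell_average K f"
    unfolding g' cell_average_add[OF P hf poly_le_const] cell_average_linear[OF P f h] cell_average_const[OF P] by simp
qed

lemma cell_limiter:
  fixes f :: "point \<Rightarrow> state"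
  assumes P: "polygon K (edges M K)" and sq: "special_quadrature M k K" and f: "f \<in> cell_space k K"
    and e: "\<epsilon> > 0" and avg: "cell_average K f \<in> G_eps \<epsilon>"
  defines "S \<equiv> nodes M k K" and "Ub \<equiv> cell_average K f"
  shows "cell_limiter \<epsilon> S Ub f \<in> cell_space k K" "cell_average K (cell_limiter \<epsilon> S Ub f) = Ub"
    "\<And>x. x \<in> S \<Longrightarrow> cell_limiter \<epsilon> S Ub f x \<in> lin_admissible"
proof -
  note fp = cell_space_poly[OF f]
  obtain I :: "(edge \<times> nat + nat) set" and c x where I: "finite I"
    "\<And>i. i \<in> I \<Longrightarrow> c i \<ge> 0 \<and> x i \<in> S" "sum c I = 1"
    "\<And>f::point \<Rightarrow> state. poly_le k f \<Longrightarrow> cell_average K f = (\<Sum>i\<in>I. c i *\<^sub>R f (x i))"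
    using quadrature_convex_combination[OF P sq] unfolding S_def by blast
  have finS: "finite S"
  proof -
    have "finite (edges M K)" using P unfolding polygon_def by simp
    then have "finite {edge_point M e q | e q. e \<in> edges M K \<and> q \<in> {1..k+1}}"
      by (intro finite_image_set2) simp_all
    then show ?thesis unfolding S_def nodes_def by simp
  qed
  have neS: "S \<noteq> {}" using I(2,3) by (metis empty_iff sum.empty zero_neq_one equals0I)
  \<comment> \<open>The average is a convex combination of nodal values. Hence the denominators in
    \<open>theta1\<close> and, by concavity of \<open>qf\<close>, in \<open>theta2\<close> are
    nonnegative.\<close>
  have Min_le: "Min (h ` S) \<le> (\<Sum>i\<in>I. c i * h (x i))" for h :: "point \<Rightarrow> real"
  proof -
    have "Min (h ` S) = (\<Sum>i\<in>I. c i * Min (h ` S))" using I(3) by (simp add: sum_distrib_right[symmetric])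
    also have "\<dots> \<le> (\<Sum>i\<in>I. c i * h (x i))"
      using I(2) finS by (intro sum_mono mult_left_mono) auto
    finally show ?thesis .
  qed
  have Min_node: "Min (h ` S) \<le> h y" if "y \<in> S" for h :: "point \<Rightarrow> real" and y
    using finS that by simp
  have Ub: "Dc Ub \<ge> \<epsilon>" "qf Ub \<ge> \<epsilon>" "Psi_eps \<epsilon> Ub \<ge> 0" using avg unfolding Ub_def G_eps_def by auto
  have scale: "0 \<le> \<theta> \<and> \<theta> \<le> 1 \<and> \<theta> * d \<le> a - \<epsilon>"
    if "d \<ge> 0" "a \<ge> \<epsilon>" "\<theta> = (if d = 0 then 1 else min 1 ((a - \<epsilon>) / d))" for d a \<theta> :: real
  proof (cases "d = 0")
    case False
    then have "\<theta> \<le> (a - \<epsilon>) / d" "d > 0" using that by auto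
    then have "\<theta> * d \<le> a - \<epsilon>" by (simp add: pos_le_divide_eq)
    then show ?thesis using that by auto
  qed (use that in auto)
  have shrink: "\<epsilon> \<le> (1 - \<theta>) * a + \<theta> * b"
    if "0 \<le> \<theta>" "\<theta> * d \<le> a - \<epsilon>" "a - d \<le> b" for \<theta> a b d :: real
  proof -
    have "\<theta> * (a - d) \<le> \<theta> * b" using that by (intro mult_left_mono) auto
    then show ?thesis using that(2) by (simp add: algebra_simps)
  qed

  define t1 where "t1 = theta1 \<epsilon> S Ub f"
  define d1 where "d1 = Dc Ub - Min ((\<lambda>x. Dc (f x)) ` S)"
  define g where "g = lim_hat \<epsilon> S Ub f"
  have g: "g y = (t1 * (Dc (f y) - Dc Ub) + Dc Ub, mc (f y), Bc (f y), Ec (f y))" for y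
    unfolding g_def lim_hat_def t1_def Let_def ..
  have "d1 \<ge> 0"
  proof -
    have "Dc Ub = (\<Sum>i\<in>I. c i * Dc (f (x i)))"
      unfolding Ub_def I(4)[OF fp] by (simp add: linear_sum[OF linear_components(1)] linear_scale[OF linear_components(1)])
    then show ?thesis using Min_le[of "\<lambda>x. Dc (f x)"] unfolding d1_def by simp
  qed
  then have t1: "0 \<le> t1" "t1 \<le> 1" "t1 * d1 \<le> Dc Ub - \<epsilon>"
    using scale[of d1 "Dc Ub" t1] Ub(1) unfolding t1_def theta1_def d1_def Let_def by blast+
  have gD: "Dc (g y) \<ge> \<epsilon>" if "y \<in> S" for y
    using shrink[OF t1(1,3), of "Dc (f y)"] Min_node[OF that, of "\<lambda>x. Dc (f x)"]
    unfolding g d1_def by (simp add: algebra_simps)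
  define h1 :: "state \<Rightarrow> state" where "h1 U = (t1 * Dc U, mc U, Bc U, Ec U)" for U
  have "linear h1" unfolding h1_def
    by (rule linearI) (simp_all add: state_components prod_eq_iff algebra_simps)
  moreover have "g y = h1 (f y) + (Ub - h1 Ub)" for y
    unfolding g h1_def by (cases Ub) (simp add: algebra_simps)
  ultimately have gp: "poly_le k g" "cell_average K g = Ub"
    using cell_average_affine_invariant[OF P fp, of h1 g] unfolding Ub_def by blast+

  define t2 where "t2 = theta2 \<epsilon> S Ub f"
  define d2 where "d2 = qf Ub - Min ((\<lambda>x. qf (g x)) ` S)"
  define u where "u = lim_check \<epsilon> S Ub f"
  have u: "u y = (t2 * (Dc (g y) - Dc Ub) + Dc Ub, t2 *\<^sub>R (mc (f y) - mc Ub) + mc Ub, Bc (f y), t2 * (Ec (f y) - Ec Ub) + Ec Ub)" for y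
    unfolding u_def lim_check_def t2_def g_def Let_def ..
  have "d2 \<ge> 0"
  proof -
    have "(\<Sum>i\<in>I. c i * qf (g (x i))) \<le> qf Ub"
      using qf_concave[OF I(1), of c "\<lambda>i. g (x i)"] I(2) unfolding gp(2)[symmetric] I(4)[OF gp(1)] by blast
    then show ?thesis using Min_le[of "\<lambda>x. qf (g x)"] unfolding d2_def by simp
  qed
  then have t2: "0 \<le> t2" "t2 \<le> 1" "t2 * d2 \<le> qf Ub - \<epsilon>"
    using scale[of d2 "qf Ub" t2] Ub(2) unfolding t2_def theta2_def d2_def g_def Let_def by blast+
  have uD: "Dc (u y) \<ge> \<epsilon>" if "y \<in> S" for y
  proof -
    have "(1 - t2) * \<epsilon> + t2 * \<epsilon> \<le> (1 - t2) * Dc Ub + t2 * Dc (g y)"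
      using t2 Ub(1) gD[OF that] by (intro add_mono mult_left_mono) auto
    then show ?thesis unfolding u by (simp add: algebra_simps)
  qed
  have uq: "qf (u y) \<ge> \<epsilon>" if "y \<in> S" for y
  proof -
    have "\<epsilon> \<le> (1 - t2) * qf Ub + t2 * qf (g y)"
      using shrink[OF t2(1,3), of "qf (g y)"] Min_node[OF that, of "\<lambda>x. qf (g x)"] unfolding d2_def by simp
    also have "\<dots> \<le> qf ((1 - t2) *\<^sub>R Ub + t2 *\<^sub>R g y)" by (rule qf_segment[OF t2(1,2)])
    also have "\<dots> = qf (u y)"
      unfolding qf_eq u g by (simp add: state_components algebra_simps)
    finally show ?thesis .
  qed
  define h2 :: "state \<Rightarrow> state" where "h2 U = (t2 * Dc U, t2 *\<^sub>R mc U, Bc U, t2 * Ec U)" for U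
  have "linear h2" unfolding h2_def
    by (rule linearI) (simp_all add: state_components prod_eq_iff algebra_simps)
  moreover have "u y = h2 (g y) + (Ub - h2 Ub)" for y
    unfolding u g h2_def by (cases Ub) (simp add: algebra_simps)
  ultimately have up: "poly_le k u" "cell_average K u = Ub"
    using cell_average_affine_invariant[OF P gp(1), of h2 u] unfolding gp(2) by blast+

  define t3 where "t3 = theta3 \<epsilon> S Ub f"
  define v where "v = cell_limiter \<epsilon> S Ub f"
  have v: "v y = t3 *\<^sub>R (u y - Ub) + Ub" for y unfolding v_def cell_limiter_def t3_def u_def ..
  have "linear (\<lambda>U::state. t3 *\<^sub>R U)" by (rule linearI) (simp_all add: algebra_simps)
  moreover have "v y = t3 *\<^sub>R u y + (Ub - t3 *\<^sub>R Ub)" for y unfolding v by (simp add: algebra_simps)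
  ultimately have vp: "poly_le k v" "cell_average K v = Ub"
    using cell_average_affine_invariant[OF P up(1), of "\<lambda>U. t3 *\<^sub>R U" v] unfolding up(2) by blast+
  show "cell_average K (cell_limiter \<epsilon> S Ub f) = Ub" using vp(2) unfolding v_def .
  have "Bc (v y) = t3 *\<^sub>R Bc (f y) + (Bc Ub - t3 *\<^sub>R Bc Ub)" for y
    unfolding v u by (simp add: state_components algebra_simps)
  from cell_space_affine[OF f vp(1) this] show "cell_limiter \<epsilon> S Ub f \<in> cell_space k K" unfolding v_def .
  fix y assume y: "y \<in> S"
  have T: "0 \<le> theta_tilde \<epsilon> Ub (u z)" "theta_tilde \<epsilon> Ub (u z) \<le> 1" for z using theta_tilde[OF Ub(3)] by auto
  define s where "s = theta_tilde \<epsilon> Ub (u y)"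
  have t3: "0 \<le> t3" "t3 \<le> s"
    using finS neS T y unfolding t3_def theta3_def s_def u_def[symmetric] by auto
  have s1: "s \<le> 1" "0 \<le> s" unfolding s_def using T by auto
  \<comment> \<open>\<open>Z\<close> uses the factor \<open>s\<close> of this node alone. The common
    factor \<open>t3\<close> is at most \<open>s\<close>, so the limited value lies on the segment
    from \<open>Ub\<close> to \<open>Z\<close>, whose ends are both in the convex set.\<close>
  define Z where "Z = (1 - s) *\<^sub>R Ub + s *\<^sub>R u y"
  have "Z \<in> G_eps \<epsilon>"
  proof -
    have "Psi_eps \<epsilon> Z \<ge> 0" unfolding Z_def s_def by (rule theta_tilde(3)[OF Ub(3)])
    moreover have "(1 - s) * \<epsilon> + s * \<epsilon> \<le> (1 - s) * Dc Ub + s * Dc (u y)"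
      using s1 Ub(1) uD[OF y] by (intro add_mono mult_left_mono) auto
    moreover have "Dc Z = (1 - s) * Dc Ub + s * Dc (u y)" unfolding Z_def by (simp add: state_components)
    ultimately have "Psi_eps \<epsilon> Z \<ge> 0" "Dc Z \<ge> \<epsilon>" by (simp_all add: algebra_simps)
    moreover have "(1 - s) * \<epsilon> + s * \<epsilon> \<le> (1 - s) * qf Ub + s * qf (u y)"
      using s1 Ub(2) uq[OF y] by (intro add_mono mult_left_mono) auto
    then have "qf Z \<ge> \<epsilon>" using qf_segment[OF s1(2,1), of Ub "u y"] unfolding Z_def by (simp add: algebra_simps)
    ultimately show ?thesis unfolding G_eps_def by simp
  qed
  then have Z: "Z \<in> lin_admissible" by (rule G_eps_lin_admissible[OF e])
  have Ub': "Ub \<in> lin_admissible" using G_eps_lin_admissible[OF e] avg unfolding Ub_def .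
  have "v y \<in> lin_admissible"
  proof (cases "s = 0")
    case True
    then have "v y = Ub" using t3 unfolding v by simp
    then show ?thesis using Ub' by simp
  next
    case False
    define r where "r = t3 / s"
    have "0 \<le> r" "r \<le> 1" "r * s = t3" using t3 False s1 unfolding r_def by (auto simp: divide_le_eq)
    moreover have "v y = (1 - r) *\<^sub>R Ub + r *\<^sub>R Z"
      unfolding v Z_def using \<open>r * s = t3\<close> by (simp add: scaleR_add_right scaleR_diff_left scaleR_diff_right)
    ultimately show ?thesis using lin_admissible_segment[OF Ub' Z] by simp
  qed
  then show "cell_limiter \<epsilon> S Ub f y \<in> lin_admissible" unfolding v_def .
qed

section \<open>The limiter on the whole mesh and the Runge-Kutta stages\<close>

lemma limiter_in_G_h:
  assumes eos: "equation_of_state H" "vanishing_energy_limit H" and disc: "discretization M k"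
    and eps: "eps_choice H M k \<epsilon>" and U: "U \<in> Gbar_h H M k"
  shows "limiter M k \<epsilon> U \<in> G_h H M k"
proof -
  have Uc: "U K \<in> cell_space k K" "cell_average K (U K) \<in> admissible H" if "K \<in> cells M" for K
    using U that unfolding Gbar_h_def Wh_iff by auto
  have "limiter M k \<epsilon> U K \<in> cell_space k K \<and> cell_average K (limiter M k \<epsilon> U K) \<in> admissible H
      \<and> (\<forall>x\<in>nodes M k K. limiter M k \<epsilon> U K x \<in> admissible H)" if K: "K \<in> cells M" for K
  proof (cases "k = 0")
    case True
    \<comment> \<open>A polynomial of degree 0 equals its average at every node, so the identity is
      a valid limiter.\<close>
    obtain c where "\<forall>x. U K x = (\<Sum>i\<le>k. \<Sum>j\<le>k - i. ((x $ 1) ^ i * (x $ 2) ^ j) *\<^sub>R c i j)"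
      using cell_space_poly[OF Uc(1)[OF K]] unfolding poly_le_def by auto
    then have const: "U K = (\<lambda>x. c 0 0)" using True by auto
    then have "cell_average K (U K) = c 0 0"
      using cell_average_const[OF discretizationD(1)[OF disc K]] by simp
    then show ?thesis using Uc[OF K] True const unfolding limiter_def by auto
  next
    case False
    have e: "\<epsilon> U > 0" "cell_average K (U K) \<in> G_eps (\<epsilon> U)" using eps U K unfolding eps_choice_def by auto
    note F = discretizationD[OF disc K]
    note L = cell_limiter[OF F(1,3) Uc(1)[OF K] e]
    show ?thesis using L Uc(2)[OF K] False unfolding limiter_def admissible_eq[OF eos] by auto
  qed
  then show ?thesis unfolding G_h_def Gbar_h_def Wh_iff by auto
qed

text \<open>Averages are linear and the admissible set is convex, so a stage before limiting is a
  convex combination of Euler steps, each with its own step size \<open>\<tau> l\<close>.\<close>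

lemma stage_in_Gbar_h:
  fixes a \<tau> :: "nat \<Rightarrow> real"
  assumes eos: "equation_of_state H" "vanishing_energy_limit H" and disc: "discretization M k"
    and a: "\<And>l. l < i \<Longrightarrow> a l \<ge> 0" "(\<Sum>l<i. a l) = 1" and \<tau>: "\<And>l. l < i \<Longrightarrow> \<tau> l \<ge> 0"
    and U: "\<And>l. l < i \<Longrightarrow> U l \<in> G_h H M k"
    and cfl: "\<And>l K e q. l < i \<Longrightarrow> K \<in> cells M \<Longrightarrow> e \<in> edges M K \<Longrightarrow> q \<in> {1..k+1} \<Longrightarrow>
      \<tau> l * gauss_w M q * (1 + jump_sigma H M K e q (U l)) * edge_length e < dec_edge_w M K e q * area K"
  shows "(\<lambda>K x. \<Sum>l<i. a l *\<^sub>R (U l K x + \<tau> l *\<^sub>R L_h H M k (U l) K x)) \<in> Gbar_h H M k"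
proof -
  have "(\<lambda>x. \<Sum>l<i. a l *\<^sub>R (U l K x + \<tau> l *\<^sub>R L_h H M k (U l) K x)) \<in> cell_space k K \<and>
    cell_average K (\<lambda>x. \<Sum>l<i. a l *\<^sub>R (U l K x + \<tau> l *\<^sub>R L_h H M k (U l) K x)) \<in> admissible H"
    if K: "K \<in> cells M" for K
  proof
    note P = discretizationD(1)[OF disc K]
    have s: "(\<lambda>x. U l K x + \<tau> l *\<^sub>R L_h H M k (U l) K x) \<in> cell_space k K" if "l < i" for l
      using G_h_cell_space[OF U[OF that] K] L_h_spec(1)[OF disc, of H "U l"] K unfolding Wh_iff
      by (intro cell_space_add cell_space_scaleR) auto
    then show "(\<lambda>x. \<Sum>l<i. a l *\<^sub>R (U l K x + \<tau> l *\<^sub>R L_h H M k (U l) K x)) \<in> cell_space k K"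
      by (intro cell_space_sum cell_space_scaleR) auto
    have "cell_average K (\<lambda>x. \<Sum>l<i. a l *\<^sub>R (U l K x + \<tau> l *\<^sub>R L_h H M k (U l) K x))
       = (\<Sum>l<i. cell_average K (\<lambda>x. a l *\<^sub>R (U l K x + \<tau> l *\<^sub>R L_h H M k (U l) K x)))"
      using s by (intro cell_average_sum[OF P, of _ k] poly_le_scaleR cell_space_poly) auto
    also have "\<dots> = (\<Sum>l<i. a l *\<^sub>R cell_average K (\<lambda>x. U l K x + \<tau> l *\<^sub>R L_h H M k (U l) K x))"
    proof (rule sum.cong[OF refl])
      fix l assume "l \<in> {..<i}"
      then have "poly_le k (\<lambda>x. U l K x + \<tau> l *\<^sub>R L_h H M k (U l) K x)" using s cell_space_poly by auto
      from cell_average_linear[OF P this, of "\<lambda>v. a l *\<^sub>R v"]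
      show "cell_average K (\<lambda>x. a l *\<^sub>R (U l K x + \<tau> l *\<^sub>R L_h H M k (U l) K x))
        = a l *\<^sub>R cell_average K (\<lambda>x. U l K x + \<tau> l *\<^sub>R L_h H M k (U l) K x)"
        by (simp add: linearI scaleR_add_right)
    qed
    also have "\<dots> \<in> lin_admissible"
    proof (rule convex_sum[OF _ convex_lin_admissible a(2)])
      show "cell_average K (\<lambda>x. U l K x + \<tau> l *\<^sub>R L_h H M k (U l) K x) \<in> lin_admissible" if "l \<in> {..<i}" for l
        unfolding admissible_eq[OF eos, symmetric]
        using that by (intro euler_average_admissible[OF disc K _ eos] U \<tau> cfl K) auto
    qed (use a(1) in auto)
    finally show "cell_average K (\<lambda>x. \<Sum>l<i. a l *\<^sub>R (U l K x + \<tau> l *\<^sub>R L_h H M k (U l) K x)) \<in> admissible H"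
      unfolding admissible_eq[OF eos] .
  qed
  then show ?thesis unfolding Gbar_h_def Wh_iff by auto
qed

theorem theorem4p9:
  fixes H :: "real \<Rightarrow> real \<Rightarrow> real"
    and M :: disc
    and k Nr :: nat
    and \<epsilon> :: "field \<Rightarrow> real"
    and \<alpha> \<beta> :: "nat \<Rightarrow> nat \<Rightarrow> real"
    and \<Delta>t :: real
    and U :: "nat \<Rightarrow> field"
  assumes eos: "equation_of_state H"
    and eos_limit: "vanishing_energy_limit H"
    and disc: "discretization M k"
    and eps: "eps_choice H M k \<epsilon>"
    and stages: "Nr \<ge> 1"
    and alpha_nonneg: "\<forall>i\<in>{1..Nr}. \<forall>l<i. \<alpha> i l \<ge> 0"
    and beta_nonneg: "\<forall>i\<in>{1..Nr}. \<forall>l<i. \<beta> i l \<ge> 0"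
    and alpha_sum: "\<forall>i\<in>{1..Nr}. (\<Sum>l<i. \<alpha> i l) = 1"
    and dt: "\<Delta>t > 0"
    and init: "U 0 \<in> G_h H M k"
    and scheme: "\<forall>i\<in>{1..Nr}. U i = limiter M k \<epsilon>
      (\<lambda>K x. \<Sum>l<i. \<alpha> i l *\<^sub>R (U l K x + (\<beta> i l * \<Delta>t) *\<^sub>R L_h H M k (U l) K x))"
    and CFL: "\<forall>i\<in>{1..Nr}. \<forall>l<i. \<forall>K\<in>cells M. \<forall>e\<in>edges M K. \<forall>q\<in>{1..k+1}.
      \<Delta>t * \<beta> i l * gauss_w M q * (1 + jump_sigma H M K e q (U l)) * edge_length e
        < dec_edge_w M K e q * area K"
  shows "\<forall>i\<in>{1..Nr}. U i \<in> G_h H M k"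
proof -
  have "i \<le> Nr \<Longrightarrow> U i \<in> G_h H M k" for i
  proof (induction i rule: less_induct)
    case (less i)
    show ?case
    proof (cases "i = 0")
      case True
      then show ?thesis using init by simp
    next
      case False
      then have i: "i \<in> {1..Nr}" using less.prems by auto
      have "(\<lambda>K x. \<Sum>l<i. \<alpha> i l *\<^sub>R (U l K x + (\<beta> i l * \<Delta>t) *\<^sub>R L_h H M k (U l) K x)) \<in> Gbar_h H M k"
      proof (rule stage_in_Gbar_h[OF eos eos_limit disc])
        show "\<beta> i l * \<Delta>t * gauss_w M q * (1 + jump_sigma H M K e q (U l)) * edge_length e < dec_edge_w M K e q * area K"
          if "l < i" "K \<in> cells M" "e \<in> edges M K" "q \<in> {1..k+1}" for l K e q
          using CFL i that by (metis mult.commute[of \<Delta>t])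
        show "U l \<in> G_h H M k" if "l < i" for l using less.IH[OF that] that less.prems by simp
      qed (use i alpha_nonneg alpha_sum beta_nonneg dt in auto)
      from limiter_in_G_h[OF eos eos_limit disc eps this] show ?thesis
        unfolding bspec[OF scheme i, symmetric] .
    qed
  qed
  then show ?thesis by simp
qed

end
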